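(* Let $n\ge1$, $\gamma>-1$, $1<p<\infty$ and $\frac1p+\frac1q=1$. A weight $w$ on $\mathbb{B}_n$ is in $\mathrm{B}_{p,\gamma}$ if and only if $$\|w\|_{\mathrm{B}_{p,\gamma}^{\mathrm{Ber.}}}=\sup_{z\in\mathbb{B}_n}\left\{B_\gamma\left(w|k_z^{p-2}|\right)(z)\right\}\left\{B_\gamma\left(w^{-\frac{1}{p-1}}|k_z^{q-2}|\right)(z)\right\}^{p-1}<\infty.$$ In particular, there exists a constant $C$ independent of $w$ such that $$\frac1C\|w\|_{\mathrm{B}_{p,\gamma}}\le\|w\|_{\mathrm{B}_{p,\gamma}^{\mathrm{Ber.}}}\le C\|w\|_{\mathrm{B}_{p,\gamma}}^{\max\{p+1,\,q+1\}}.$$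
   Context: $\mathbb{B}_n$ is the open unit ball of $\mathbb{C}^n$, $dv_\gamma(z)=c_\gamma(1-|z|^2)^\gamma dv(z)$ is the normalized weighted volume measure, and $z\cdot u=\sum_jz_j\overline{u_j}$. A weight is a measurable function that is positive a.e. The normalized Bergman kernel is $k_z(u)=\frac{(1-|z|^2)^{(n+1+\gamma)/2}}{(1-u\cdot z)^{n+1+\gamma}}$ and $B_\gamma(h)(z)=\int_{\mathbb{B}_n}h(u)|k_z(u)|^2\,dv_\gamma(u)$ is the Berezin transform. Let $d$ be the pseudo-metric on $\mathbb{B}_n$ given by $d(z,u)=\big||z|-|u|\big|+\left|1-\frac{z}{|z|}\cdot\frac{u}{|u|}\right|$ (with $d(z,u)=|z|+|u|$ if $z=0$ or $u=0$), and let $D=D(z,R)=\{u\in\mathbb{B}_n:d(z,u)<R\}$. The ball $D(z,R)$ is said to intersect $\partial\mathbb{B}_n$ if $R>1-|z|$. The Békollé–Bonami class $\mathrm{B}_{p,\gamma}$ is the class of weights $w$ on $\mathbb{B}_n$ for which $$\|w\|_{\mathrm{B}_{p,\gamma}}=\sup_D\left(\frac{1}{v_\gamma(D)}\int_Dw\,dv_\gamma\right)\left(\frac{1}{v_\gamma(D)}\int_Dw^{-\frac1{p-1}}\,dv_\gamma\right)^{p-1}<\infty,$$ the supremum being over all such balls $D$ that intersect $\partial\mathbb{B}_n$. *)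

theory Defs
  imports "HOL-Analysis.Analysis"
begin

text \<open>The space $C^n$ is \<^typ>\<open>complex^'n\<close> with \<open>n = CARD('n)\<close>; its \<^const>\<open>norm\<close> is the
  Euclidean one, so the unit ball is \<open>ball 0 1\<close>, and \<^const>\<open>lebesgue\<close> is Lebesgue measure on
  the underlying real space of dimension \<open>2 n\<close>. The inner product \<^const>\<open>inner\<close> of the library
  is only the real part of the Hermitian product below.\<close>

definition herm :: "complex^'n \<Rightarrow> complex^'n \<Rightarrow> complex" where
  "herm z u = (\<Sum>j\<in>UNIV. z $ j * cnj (u $ j))"

definition norm_const :: "'n::finite itself \<Rightarrow> real \<Rightarrow> real" where
  "norm_const _ \<gamma> = 1 / (LINT z|lebesgue_on (ball (0 :: complex^'n) 1). (1 - (norm z)\<^sup>2) powr \<gamma>)"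

definition vol :: "real \<Rightarrow> (complex^'n) measure" where
  "vol \<gamma> = density (lebesgue_on (ball 0 1))
     (\<lambda>z. ennreal (norm_const TYPE('n) \<gamma> * (1 - (norm z)\<^sup>2) powr \<gamma>))"

text \<open>Weights are total functions on \<open>C^n\<close>, of which only the restriction to the ball matters.\<close>

definition weight :: "(complex^'n \<Rightarrow> real) \<Rightarrow> bool" where
  "weight w \<longleftrightarrow> w \<in> borel_measurable (lebesgue_on (ball 0 1))
     \<and> (AE z in lebesgue_on (ball 0 1). 0 < w z)"

text \<open>The power of the complex number \<open>1 - herm u z\<close>, which has positive real part, is the
  principal one.\<close>

definition bergman_kernel :: "real \<Rightarrow> complex^'n \<Rightarrow> complex^'n \<Rightarrow> complex" where
  "bergman_kernel \<gamma> z u =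
     complex_of_real ((1 - (norm z)\<^sup>2) powr ((real CARD('n) + 1 + \<gamma>) / 2))
       / (1 - herm u z) powr complex_of_real (real CARD('n) + 1 + \<gamma>)"

text \<open>The Berezin transform of functions that are nonnegative almost everywhere; the value
  \<open>\<infinity>\<close> is allowed.\<close>

definition berezin :: "real \<Rightarrow> (complex^'n \<Rightarrow> real) \<Rightarrow> complex^'n \<Rightarrow> ennreal" where
  "berezin \<gamma> h z = (\<integral>\<^sup>+u. ennreal (h u * (cmod (bergman_kernel \<gamma> z u))\<^sup>2) \<partial>vol \<gamma>)"

definition pdist :: "complex^'n \<Rightarrow> complex^'n \<Rightarrow> real" where
  "pdist z u = (if z = 0 \<or> u = 0 then norm z + norm u
     else \<bar>norm z - norm u\<bar> + cmod (1 - herm (z /\<^sub>R norm z) (u /\<^sub>R norm u)))"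

definition pball :: "complex^'n \<Rightarrow> real \<Rightarrow> (complex^'n) set" where
  "pball z R = {u \<in> ball 0 1. pdist z u < R}"

text \<open>Real powers of extended nonnegative reals; used for exponents \<open>r > 0\<close> only.\<close>

definition epowr :: "ennreal \<Rightarrow> real \<Rightarrow> ennreal" where
  "epowr x r = (if x = \<infinity> then \<infinity> else ennreal (enn2real x powr r))"

definition avg :: "real \<Rightarrow> (complex^'n) set \<Rightarrow> (complex^'n \<Rightarrow> real) \<Rightarrow> ennreal" where
  "avg \<gamma> D f = (\<integral>\<^sup>+u\<in>D. ennreal (f u) \<partial>vol \<gamma>) / emeasure (vol \<gamma>) D"

text \<open>For a weight \<open>w\<close> neither factor of the products below is 0, so that the convention
  \<open>0 * \<infinity> = 0\<close> plays no role.\<close>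

definition bb_norm :: "real \<Rightarrow> real \<Rightarrow> (complex^'n \<Rightarrow> real) \<Rightarrow> ennreal" where
  "bb_norm p \<gamma> w = (SUP (z, R) \<in> {(z, R). z \<in> ball 0 1 \<and> R > 1 - norm z}.
     avg \<gamma> (pball z R) w
       * epowr (avg \<gamma> (pball z R) (\<lambda>u. w u powr (- 1 / (p - 1)))) (p - 1))"

definition bb_class :: "real \<Rightarrow> real \<Rightarrow> (complex^'n \<Rightarrow> real) set" where
  "bb_class p \<gamma> = {w. weight w \<and> bb_norm p \<gamma> w < \<infinity>}"

text \<open>The argument \<open>q\<close> is the conjugate exponent of \<open>p\<close>.\<close>

definition ber_norm :: "real \<Rightarrow> real \<Rightarrow> real \<Rightarrow> (complex^'n \<Rightarrow> real) \<Rightarrow> ennreal" where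
  "ber_norm p q \<gamma> w = (SUP z \<in> ball 0 1.
     berezin \<gamma> (\<lambda>u. w u * cmod (bergman_kernel \<gamma> z u powr complex_of_real (p - 2))) z
       * epowr (berezin \<gamma> (\<lambda>u. w u powr (- 1 / (p - 1))
           * cmod (bergman_kernel \<gamma> z u powr complex_of_real (q - 2))) z) (p - 1))"

end

(*
  Writing s = w^(-1/(p-1)) for the dual weight, the Berezin quantity at z is
  (int w |k_z|^p) (int s |k_z|^q)^(p-1).  With N = n + 1 + gamma the balls D(z,R) meeting the
  sphere have measure of order R^N.

  Lower bound: given such a ball D of radius R < 1 around z0, the point z = (1-R) z0/|z0| satisfies
  |k_z| >= c R^(-N/2) on D, and the powers of R cancel.

  Upper bound: cover the ball by concentric balls D_k = D(z, R_k) with geometrically growing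
  radii R_k >= R_0 comparable to 1-|z|.  There |k_z| is dominated by R_0^(N/2) R_k^(-N), so both
  integrals become sums over k.  Hoelder's inequality on D_(k+1) - D_k turns the Bekolle-Bonami
  condition into reverse doubling, w(D_k) <= (1 - c/M) w(D_(k+1)), and likewise for s with
  M^(q-1) instead of M.  Hence the product of the term with index k of the first sum and the one
  with index j of the second (raised to p-1) decays geometrically in |k-j| and in min k j, and
  the double sum is bounded by a power of M.
*)
theory Submission
  imports Defs
begin

text \<open>Applied ball by ball, the Bekolle-Bonami condition controls only the diagonal of the
  double sum. With mere monotonicity of the masses the off-diagonal terms would not decay in |k-j|,
  and the sum would grow with the number of balls, that is like log(1/(1-|z|)). Reverse doubling
  supplies the decay; its rate worsens as the norm \<open>M\<close> grows, and summing the slow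
  geometric series is what costs powers of \<open>M\<close> beyond the first. The ratio of
  consecutive radii is taken so large that the set between two balls carries at least half of the
  outer measure.

  The volume estimate has an obstacle of its own: for \<open>\<gamma> < 0\<close> the density is
  unbounded at the sphere, so the Euclidean volume R^(n+1) of a nonisotropic ball does not suffice.
  What is needed is that its layer of depth t has volume of order t R^n at most. Cones over
  spherical caps give this: a cone is stable under shrinking, so the share of each of its layers is
  explicit and only the volume of the whole cone has to be estimated. For the lower bound a piece at
  depth comparable to R is enough, where the density is harmless.\<close>

section \<open>Nonisotropic dilations\<close>

text \<open>By Vitali, an open set is up to a null set a disjoint union of balls, and isometries map
  balls to balls of the same volume.\<close>

lemma emeasure_orthogonal_image_open:
  fixes f :: "'a::euclidean_space \<Rightarrow> 'a"
  assumes f: "orthogonal_transformation f" and S: "open S"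
  shows "emeasure lborel (f ` S) = emeasure lborel S"
proof -
  \<comment> \<open>One inequality, for every orthogonal \<open>g\<close> and every open
    \<open>T\<close>, is enough: applied to \<open>inv f\<close> and the image of \<open>S\<close>
    it gives the converse.\<close>
  have le: "emeasure lborel T \<le> emeasure lborel (g ` T)"
    if g: "orthogonal_transformation g" and T: "open T" for g :: "'a \<Rightarrow> 'a" and T
  proof -
    obtain C :: "('a \<times> real) set" where C: "countable C" "C \<subseteq> {(a,r). 0 < r \<and> ball a r \<subseteq> T}"
      and disj: "pairwise (\<lambda>i j. disjnt (ball (fst i) (snd i)) (ball (fst j) (snd j))) C"
      and neg: "negligible (T - (\<Union>i\<in>C. ball (fst i) (snd i)))"
    proof (rule Vitali_covering_theorem_balls[of T "{(a,r). 0 < r \<and> ball a r \<subseteq> T}" fst snd])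
      fix x and d :: real assume "x \<in> T" "0 < d"
      then obtain e where "e > 0" "ball x e \<subseteq> T" using T open_contains_ball by blast
      with \<open>0 < d\<close> show "\<exists>i. i \<in> {(a,r). 0 < r \<and> ball a r \<subseteq> T} \<and> x \<in> ball (fst i) (snd i) \<and> snd i < d"
        by (intro exI[of _ "(x, min e (d/2))"]) auto
    qed
    have inj: "inj g" using g orthogonal_transformation_inj by blast
    have og: "open (g ` T)"
      using g T open_surjective_linear_image orthogonal_transformation_linear orthogonal_transformation_surj by blast
    let ?B = "\<lambda>i::'a\<times>real. ball (fst i) (snd i)"
    have d1: "disjoint_family_on ?B C"
      using disj unfolding disjoint_family_on_def pairwise_def disjnt_def by blast
    then have d2: "disjoint_family_on (\<lambda>i. g ` ?B i) C"
      unfolding disjoint_family_on_def image_Int[OF inj, symmetric] by simp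
    have "emeasure lborel T = emeasure lborel (\<Union>i\<in>C. ?B i)"
    proof (rule emeasure_eq_AE)
      have "AE x in lebesgue. x \<notin> T - (\<Union>i\<in>C. ?B i)"
        using neg by (intro AE_not_in) (simp add: negligible_iff_null_sets)
      then have "AE x in lborel. x \<notin> T - (\<Union>i\<in>C. ?B i)"
        by (simp add: AE_completion_iff)
      then show "AE x in lborel. (x \<in> T) = (x \<in> (\<Union>i\<in>C. ?B i))"
        by (rule AE_mp) (use C(2) in \<open>fastforce intro!: AE_I2\<close>)
      show "T \<in> sets lborel" using T by simp
      show "(\<Union>i\<in>C. ?B i) \<in> sets lborel"  by (simp add: open_UN borel_open)
    qed
    also have "\<dots> = (\<integral>\<^sup>+i. emeasure lborel (?B i) \<partial>count_space C)"
      using C(1) d1 by (intro emeasure_UN_countable) auto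
    also have "\<dots> = (\<integral>\<^sup>+i. emeasure lborel (g ` ?B i) \<partial>count_space C)"
    proof (rule nn_integral_cong)
      fix i assume "i \<in> space (count_space C)"
      then show "emeasure lborel (?B i) = emeasure lborel (g ` ?B i)"
        using C(2) by (auto simp: image_orthogonal_transformation_ball[OF g] emeasure_ball)
    qed
    also have "\<dots> = emeasure lborel (\<Union>i\<in>C. g ` ?B i)"
      using C(1) d2 by (intro emeasure_UN_countable[symmetric]) (auto simp: image_orthogonal_transformation_ball[OF g])
    also have "\<dots> \<le> emeasure lborel (g ` T)"
      using C(2) og by (intro emeasure_mono) fastforce+
    finally show ?thesis .
  qed
  have "inv f ` f ` S = S" using orthogonal_transformation_inj[OF f] by (simp add: image_inv_f_f)
  moreover have "open (f ` S)"
    using f S open_surjective_linear_image orthogonal_transformation_linear orthogonal_transformation_surj by blast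
  ultimately show ?thesis
    using le[OF f S] le[OF orthogonal_transformation_inv[OF f], of "f ` S"] by auto
qed

section \<open>Hermitian geometry and transitivity of the unitary group\<close>

lemma herm_add_left: "herm (x + y) z = herm x z + herm y z"
  by (simp add: herm_def distrib_right sum.distrib)
lemma herm_diff_left: "herm (x - y) z = herm x z - herm y z"
  by (simp add: herm_def left_diff_distrib sum_subtractf)
lemma herm_diff_right: "herm z (x - y) = herm z x - herm z y"
  by (simp add: herm_def right_diff_distrib sum_subtractf)
lemma herm_scale_left: "herm (c *s x) y = c * herm x y"
  by (simp add: herm_def sum_distrib_left mult.assoc)
lemma herm_scale_right: "herm x (c *s y) = cnj c * herm x y"
  by (simp add: herm_def sum_distrib_left mult_ac)
lemma herm_zero [simp]: "herm 0 x = 0" "herm x 0 = 0"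
  by (simp_all add: herm_def)
lemma cnj_herm: "cnj (herm x y) = herm y x"
  by (simp add: herm_def mult.commute)
lemma cmod_one_minus_herm_commute: "cmod (1 - herm x y) = cmod (1 - herm y x)"
  by (metis cnj_herm complex_cnj_diff complex_cnj_one complex_mod_cnj)
lemma scaleR_eq_scale: "r *\<^sub>R (x :: complex^'n) = complex_of_real r *s x"
  by (auto simp: vec_eq_iff intro: scaleR_conv_of_real)

lemma herm_self: "herm x x = complex_of_real ((norm x)\<^sup>2)"
proof -
  have "norm x ^ 2 = (\<Sum>i\<in>UNIV. (cmod (x $ i))\<^sup>2)"
    by (simp add: norm_vec_def L2_set_def sum_nonneg)
  then show ?thesis by (simp add: herm_def complex_norm_square del: of_real_power)
qed

lemmas herm_simps = herm_add_left herm_diff_left herm_diff_right herm_scale_left herm_scale_right herm_self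

text \<open>This couples the two scales of the dilation: the deficit of
  \<open>cmod (herm x \<zeta>)\<close> against \<open>norm x\<close> controls the square of the
  orthogonal part, not its norm.\<close>

lemma norm_pythagoras:
  assumes "norm \<zeta> = 1"
  shows "(norm x)\<^sup>2 = (cmod (herm x \<zeta>))\<^sup>2 + (norm (x - herm x \<zeta> *s \<zeta>))\<^sup>2"
proof -
  have "herm \<zeta> \<zeta> = 1" using assms by (simp add: herm_self)
  then have "herm (x - herm x \<zeta> *s \<zeta>) (x - herm x \<zeta> *s \<zeta>) = herm x x - herm x \<zeta> * cnj (herm x \<zeta>)"
    by (simp add: herm_diff_left herm_diff_right herm_scale_left herm_scale_right cnj_herm algebra_simps)
  then have "complex_of_real ((norm (x - herm x \<zeta> *s \<zeta>))\<^sup>2) = complex_of_real ((norm x)\<^sup>2 - (cmod (herm x \<zeta>))\<^sup>2)"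
    by (simp only: herm_self of_real_diff complex_norm_square)
  then show ?thesis unfolding of_real_eq_iff by simp
qed

text \<open>Cauchy-Schwarz for the complex-valued product: with \<open>y\<close> normalised to
  \<zeta>, \<open>herm x \<zeta>\<close> is one leg of the Pythagorean splitting of
  \<open>x\<close>.\<close>

lemma cmod_herm_le: "cmod (herm x y) \<le> norm x * norm y"
proof (cases "y = 0")
  case False
  define \<zeta> where "\<zeta> = y /\<^sub>R norm y"
  have \<zeta>: "norm \<zeta> = 1" "y = complex_of_real (norm y) *s \<zeta>" using False
    by (simp_all add: \<zeta>_def flip: scaleR_eq_scale)
  have "(cmod (herm x \<zeta>))\<^sup>2 \<le> (norm x)\<^sup>2" using norm_pythagoras[OF \<zeta>(1), of x] by simp
  then have "cmod (herm x \<zeta>) \<le> norm x" by (simp add: power2_le_iff_abs_le)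
  moreover have "cmod (herm x y) = norm y * cmod (herm x \<zeta>)"
    by (subst \<zeta>(2)) (simp add: herm_scale_right norm_mult)
  ultimately show ?thesis by (metis mult.commute mult_left_mono norm_ge_zero)
qed simp

lemma continuous_on_herm [continuous_intros]:
  assumes "continuous_on S f" "continuous_on S g"
  shows "continuous_on S (\<lambda>x. herm (f x) (g x))"
  unfolding herm_def by (intro continuous_intros assms)

lemma unitary_transitive:
  fixes e \<zeta> :: "complex^'n"
  assumes "norm e = 1" "norm \<zeta> = 1"
  obtains U :: "complex^'n \<Rightarrow> complex^'n" where "linear U" "\<And>c x. U (c *s x) = c *s U x"
    "\<And>x y. herm (U x) (U y) = herm x y" "U e = \<zeta>"
proof -
  \<comment> \<open>After a rotation by a phase that makes \<open>herm \<zeta> (\<theta> *s e)\<close> real, the Householder reflection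
    along \<open>\<theta> *s e - \<zeta>\<close> swaps the two unit vectors.\<close>
  define \<theta> where "\<theta> = (if herm \<zeta> e = 0 then 1 else sgn (herm \<zeta> e))"
  define a where "a = \<theta> *s e - \<zeta>"
  define N where "N = complex_of_real ((norm a)\<^sup>2)"
  define U where "U x = \<theta> *s x - (2 * herm (\<theta> *s x) a / N) *s a" for x
  have "cmod \<theta> = 1" by (simp add: \<theta>_def norm_sgn)
  then have \<theta>: "cnj \<theta> * \<theta> = 1" "\<theta> * cnj \<theta> = 1"
    using complex_norm_square[of \<theta>] by (simp_all add: mult.commute)
  have real: "cnj \<theta> * herm \<zeta> e = complex_of_real (cmod (herm \<zeta> e))"
    using complex_norm_square[of "herm \<zeta> e"]
    by (auto simp: \<theta>_def sgn_eq power2_eq_square mult.commute field_simps)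
  have real': "\<theta> * herm e \<zeta> = complex_of_real (cmod (herm \<zeta> e))"
    using arg_cong[OF real, of cnj] by (simp add: cnj_herm)
  have unit: "herm e e = 1" "herm \<zeta> \<zeta> = 1" using assms by (simp_all add: herm_self)
  have N: "N = herm a a" by (simp add: N_def herm_self)
  \<comment> \<open>Here the phase pays off: both mixed products are the same real number, so for
    \<open>a \<noteq> 0\<close> the coefficient \<open>2 * herm (\<theta> *s e) a / N\<close> is 1
    and the reflection sends \<open>\<theta> *s e\<close> to
    \<open>\<theta> *s e - a = \<zeta>\<close>.\<close>
  have Nval: "N = 2 * herm (\<theta> *s e) a"
  proof -
    have "N = \<theta> * cnj \<theta> * herm e e - \<theta> * herm e \<zeta> - cnj \<theta> * herm \<zeta> e + herm \<zeta> \<zeta>"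
      unfolding N a_def herm_diff_left herm_diff_right herm_scale_left herm_scale_right by algebra
    moreover have "herm (\<theta> *s e) a = \<theta> * cnj \<theta> * herm e e - \<theta> * herm e \<zeta>"
      unfolding a_def herm_diff_left herm_diff_right herm_scale_left herm_scale_right by algebra
    ultimately show ?thesis unfolding real real' unit \<theta> by simp
  qed
  have \<theta>_herm: "herm (\<theta> *s x) (\<theta> *s y) = herm x y" for x y
  proof -
    have "herm (\<theta> *s x) (\<theta> *s y) = \<theta> * cnj \<theta> * herm x y"
      by (simp only: herm_scale_left herm_scale_right mult.assoc mult.left_commute)
    then show ?thesis by (simp only: \<theta> mult_1_left)
  qed
  have "U e = \<zeta>"
  proof (cases "a = 0")
    case False
    then have "N \<noteq> 0" by (simp add: N_def)
    then have "U e = \<theta> *s e - a" by (simp add: U_def flip: Nval)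
    then show ?thesis by (simp add: a_def)
  qed (auto simp: U_def a_def)
  moreover have "U (c *s x) = c *s U x" for c x
    by (simp add: U_def herm_scale_left vec_eq_iff algebra_simps)
  moreover have "herm (U x) (U y) = herm x y" for x y
  proof (cases "a = 0")
    case True
    then show ?thesis by (simp add: U_def \<theta>_herm)
  next
    case False
    then have "N \<noteq> 0" "cnj N = N" by (simp_all add: N_def)
    define x' y' where "x' = \<theta> *s x" and "y' = \<theta> *s y"
    define \<alpha> \<beta> where "\<alpha> = 2 * herm x' a / N" and "\<beta> = 2 * herm y' a / N"
    have "\<alpha> * N = 2 * herm x' a" using \<open>N \<noteq> 0\<close> by (simp add: \<alpha>_def)
    moreover have "cnj \<beta> * N = 2 * herm a y'" using \<open>N \<noteq> 0\<close> \<open>cnj N = N\<close> by (simp add: \<beta>_def cnj_herm)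
    moreover have "herm (U x) (U y) = herm x' y' - cnj \<beta> * herm x' a - \<alpha> * herm a y' + \<alpha> * (cnj \<beta> * N)"
    proof -
      have "U x = x' - \<alpha> *s a" "U y = y' - \<beta> *s a" by (simp_all only: U_def x'_def y'_def \<alpha>_def \<beta>_def)
      then show ?thesis unfolding N
        by (simp only: herm_diff_left herm_diff_right herm_scale_left herm_scale_right) (simp add: algebra_simps)
    qed
    ultimately have "herm (U x) (U y) = herm x' y'" by algebra
    then show ?thesis by (simp add: x'_def y'_def \<theta>_herm)
  qed
  moreover have "U (x + y) = U x + U y" for x y
    by (simp add: U_def vector_add_ldistrib herm_add_left distrib_left add_divide_distrib vector_sadd_rdistrib)
  then have "linear U"
    using \<open>\<And>c x. U (c *s x) = c *s U x\<close> by (intro linearI) (simp_all add: scaleR_eq_scale)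
  ultimately show ?thesis using that by blast
qed

text \<open>The nonisotropic dilation: factor \<open>\<rho>\<close> on the complex line of \<open>\<zeta>\<close>, \<open>sqrt \<rho>\<close> on its
  orthogonal complement.\<close>

definition stretch :: "real \<Rightarrow> complex^'n \<Rightarrow> complex^'n \<Rightarrow> complex^'n" where
  "stretch \<rho> \<zeta> x = complex_of_real \<rho> *s (herm x \<zeta> *s \<zeta>)
     + complex_of_real (sqrt \<rho>) *s (x - herm x \<zeta> *s \<zeta>)"

lemma linear_stretch: "linear (stretch \<rho> \<zeta>)"
  by (rule linearI)
    (simp_all add: stretch_def scaleR_eq_scale vec_eq_iff herm_add_left herm_scale_left algebra_simps)

lemma stretch_stretch:
  assumes "norm \<zeta> = 1" "\<rho> > 0" "\<sigma> > 0"
  shows "stretch \<rho> \<zeta> (stretch \<sigma> \<zeta> x) = stretch (\<rho> * \<sigma>) \<zeta> x"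
proof -
  have "herm \<zeta> \<zeta> = 1" using assms by (simp add: herm_self)
  then have "herm (stretch \<sigma> \<zeta> x) \<zeta> = complex_of_real \<sigma> * herm x \<zeta>"
    by (simp add: stretch_def herm_simps(1-4))
  then show ?thesis using assms
    by (simp add: stretch_def vec_eq_iff real_sqrt_mult algebra_simps)
qed

lemma stretch_inverse:
  assumes "norm \<zeta> = 1" "\<rho> > 0"
  shows "stretch \<rho> \<zeta> (stretch (1 / \<rho>) \<zeta> x) = x"
  using stretch_stretch[of \<zeta> \<rho> "1 / \<rho>" x] assms by (simp add: stretch_def)

lemma open_stretch:
  assumes "norm \<zeta> = 1" "\<rho> > 0" "open S"
  shows "open (stretch \<rho> \<zeta> ` S)"
  using stretch_inverse[OF assms(1,2)] open_surjective_linear_image[OF assms(3) linear_stretch]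
  by (metis surjI)

text \<open>One complex coordinate is scaled by \<rho> and the other n - 1 by
  \<open>sqrt \<rho>\<close>. Each counts for two real dimensions, so the determinant is \<rho>^2
  times \<rho>^(n-1).\<close>

lemma emeasure_stretch_axis:
  fixes k :: "'n::finite"
  assumes \<rho>: "\<rho> > 0" and S: "open S"
  shows "emeasure lborel (stretch \<rho> (axis k 1) ` S) = ennreal (\<rho> ^ (CARD('n) + 1)) * emeasure lborel S"
proof -
  \<comment> \<open>A real basis vector \<open>j\<close> has the form \<open>axis i b\<close> with
    \<open>b \<noteq> 0\<close>, so \<open>j $ k = 0\<close> tests whether it belongs to a
    coordinate other than \<open>k\<close>.\<close>
  define c where "c j = (if j $ k = 0 then sqrt \<rho> else \<rho>)" for j :: "complex^'n"
  \<comment> \<open>The leading 0 is the translation part in the affine change of variables applied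
    to \<open>T\<close> below.\<close>
  define T where "T = (\<lambda>x::complex^'n. 0 + (\<Sum>j\<in>Basis. (c j * (x \<bullet> j)) *\<^sub>R j))"
  have herm_axis: "herm x (axis k 1) = x $ k" for x :: "complex^'n"
    by (simp add: herm_def axis_def if_distrib cong: if_cong)
  have T: "T = stretch \<rho> (axis k 1)"
  proof
    fix x show "T x = stretch \<rho> (axis k 1) x"
    proof (rule euclidean_eqI)
      fix j :: "complex^'n" assume j: "j \<in> Basis"
      then obtain i b where ib: "j = axis i b" "b \<in> Basis" by (auto simp: Basis_vec_def)
      then have "b \<noteq> 0" by auto
      have "stretch \<rho> (axis k 1) x $ i = (if i = k then \<rho> else sqrt \<rho>) *\<^sub>R x $ i"
        by (auto simp: stretch_def herm_axis scaleR_conv_of_real) (auto simp: axis_def)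
      moreover have "c j = (if i = k then \<rho> else sqrt \<rho>)"
        using \<open>b \<noteq> 0\<close> by (auto simp: c_def ib axis_def)
      moreover have "T x \<bullet> j = c j * (x \<bullet> j)" using j by (simp add: T_def)
      ultimately have "T x \<bullet> j = stretch \<rho> (axis k 1) x \<bullet> j" by (simp add: ib inner_axis)
      then show "T x \<bullet> j = stretch \<rho> (axis k 1) x \<bullet> j" .
    qed
  qed
  have B: "(Basis :: (complex^'n) set) = (\<lambda>(i,b). axis i b) ` (UNIV \<times> Basis)"
    by (auto simp: Basis_vec_def)
  have inj: "inj_on (\<lambda>(i,b). axis i b) (UNIV \<times> (Basis::complex set))"
    by (auto simp: inj_on_def axis_eq_axis)
  have "(\<Prod>j\<in>Basis. \<bar>c j\<bar>) = (\<Prod>(i,b)\<in>UNIV \<times> (Basis::complex set). if i = k then \<rho> else sqrt \<rho>)"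
    unfolding B using \<rho> by (subst prod.reindex[OF inj]) (auto simp: c_def axis_def intro!: prod.cong)
  also have "\<dots> = (\<Prod>i\<in>UNIV. \<Prod>b\<in>(Basis::complex set). if i = k then \<rho> else sqrt \<rho>)"
    by (rule prod.cartesian_product[symmetric])
  also have "\<dots> = (\<Prod>i\<in>UNIV. \<rho> * (if i = k then \<rho> else 1))"
    using \<rho> by (intro prod.cong) (auto simp: power2_eq_square[symmetric])
  also have "\<dots> = \<rho> ^ (CARD('n) + 1)" by (simp add: prod.distrib)
  finally have c: "(\<Prod>j\<in>Basis. \<bar>c j\<bar>) = \<rho> ^ (CARD('n) + 1)" .
  have "emeasure lborel (T ` S) = emeasure (density (distr lborel borel T) (\<lambda>_. (\<Prod>j\<in>Basis. \<bar>c j\<bar>))) (T ` S)"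
    unfolding T_def using \<rho> by (subst lborel_affine_euclidean[of c 0]) (auto simp: c_def)
  also have "\<dots> = ennreal (\<rho> ^ (CARD('n) + 1)) * emeasure lborel (T -` T ` S)"
  proof -
    have "open (T ` S)" unfolding T using open_stretch[OF _ \<rho> S] by (simp add: norm_axis_1)
    moreover have "T \<in> borel_measurable borel" by (simp add: T_def)
    ultimately show ?thesis unfolding c
      by (subst emeasure_density) (auto simp: nn_integral_cmult_indicator emeasure_distr)
  qed
  also have "T -` T ` S = S"
  proof (rule inj_vimage_image_eq)
    have "stretch (1 / \<rho>) (axis k 1) (stretch \<rho> (axis k 1) x) = x" for x :: "complex^'n"
      using stretch_inverse[of "axis k 1" "1 / \<rho>" x] \<rho> by simp
    then show "inj T" unfolding T by (metis injI)
  qed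
  finally show ?thesis by (simp add: T)
qed

text \<open>A unitary map carrying \<open>axis k 1\<close> to \<zeta> conjugates the dilation along
  the axis into the one along \<zeta> and fixes the centred ball. This reduces the claim to the
  diagonal case.\<close>

lemma emeasure_stretch_ball:
  fixes \<zeta> :: "complex^'n"
  assumes \<rho>: "\<rho> > 0" and \<zeta>: "norm \<zeta> = 1"
  shows "emeasure lborel (stretch \<rho> \<zeta> ` ball 0 r) = ennreal (\<rho> ^ (CARD('n) + 1)) * emeasure lborel (ball 0 r :: (complex^'n) set)"
proof -
  obtain k :: 'n where True by blast
  let ?e = "axis k 1 :: complex^'n"
  have e: "norm ?e = 1" by simp
  obtain U :: "complex^'n \<Rightarrow> complex^'n" where U: "linear U" "\<And>c x. U (c *s x) = c *s U x"
    "\<And>x y. herm (U x) (U y) = herm x y" "U ?e = \<zeta>"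
    using unitary_transitive[OF e \<zeta>] by blast
  have "norm (U x) = norm x" for x
  proof -
    have "(norm (U x))\<^sup>2 = (norm x)\<^sup>2"
      using U(3)[of x x] unfolding herm_self of_real_eq_iff .
    then show ?thesis by simp
  qed
  then have orth: "orthogonal_transformation U" using U(1) by (simp add: orthogonal_transformation)
  have "U (stretch \<rho> ?e x) = stretch \<rho> \<zeta> (U x)" for x
    using U(3)[of x ?e] by (simp add: stretch_def U(2,4) linear_add[OF U(1)] linear_diff[OF U(1)])
  then have "stretch \<rho> \<zeta> ` U ` ball 0 r = U ` stretch \<rho> ?e ` ball 0 r"
    by (force simp: image_image)
  moreover have "U ` ball 0 r = ball 0 r"
    using image_orthogonal_transformation_ball[OF orth, of 0 r] by (simp add: linear_0[OF U(1)])
  ultimately show ?thesis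
    using emeasure_orthogonal_image_open[OF orth open_stretch[OF e \<rho> open_ball, of 0 r]]
      emeasure_stretch_axis[OF \<rho> open_ball, of k 0 r] by simp
qed

lemma measure_stretch_ball:
  fixes c \<zeta> :: "complex^'n"  and r :: real
  assumes \<rho>: "\<rho> > 0" and \<zeta>: "norm \<zeta> = 1"
  defines "E \<equiv> (+) c ` stretch \<rho> \<zeta> ` ball 0 r"
  shows "open E" "E \<in> lmeasurable"
    "measure lebesgue E = \<rho> ^ (CARD('n) + 1) * measure lebesgue (ball 0 r :: (complex^'n) set)"
proof -
  have op: "open (stretch \<rho> \<zeta> ` ball 0 r)" by (rule open_stretch[OF \<zeta> \<rho> open_ball])
  then show oE: "open E" unfolding E_def by (rule open_translation)
  have bd: "bounded (stretch \<rho> \<zeta> ` ball 0 r)"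
    using bounded_linear_image[OF bounded_ball] linear_stretch linear_linear by blast
  then have "bounded E" unfolding E_def by (rule bounded_translation)
  then show "E \<in> lmeasurable" using oE lmeasurable_open by blast
  have "measure lebesgue E = measure lebesgue (stretch \<rho> \<zeta> ` ball 0 r)"
    unfolding E_def by (rule measure_translation)
  also have "\<dots> = measure lborel (stretch \<rho> \<zeta> ` ball 0 r)" using op by (simp add: measure_completion)
  also have "\<dots> = \<rho> ^ (CARD('n) + 1) * measure lborel (ball 0 r :: (complex^'n) set)"
    unfolding measure_def emeasure_stretch_ball[OF \<rho> \<zeta>] using \<rho> by (simp add: enn2real_mult)
  finally show "measure lebesgue E = \<rho> ^ (CARD('n) + 1) * measure lebesgue (ball 0 r :: (complex^'n) set)"
    by (simp add: measure_completion)
qed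

section \<open>Koranyi regions at the sphere and cones over spherical caps\<close>

lemma measure_Koranyi_le:
  fixes \<zeta> :: "complex^'n"
  assumes \<rho>: "\<rho> > 0" and \<zeta>: "norm \<zeta> = 1"
  defines "Q \<equiv> {u \<in> ball 0 1. cmod (1 - herm u \<zeta>) < \<rho>}"
  shows "Q \<in> lmeasurable" 
    "measure lebesgue Q \<le> \<rho> ^ (CARD('n) + 1) * measure lebesgue (ball 0 2 :: (complex^'n) set)"
proof -
  let ?E = "(+) \<zeta> ` stretch \<rho> \<zeta> ` ball 0 2"
  have "open Q" 
    unfolding Q_def Collect_conj_eq Collect_mem_eq
    by (intro open_Int open_ball open_Collect_less continuous_intros)
  moreover have "bounded Q" unfolding Q_def by (rule bounded_subset[OF bounded_ball[of 0 1]]) auto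
  ultimately show Q: "Q \<in> lmeasurable" by (rule lmeasurable_open[rotated])
  \<comment> \<open>Moved to the origin and rescaled by \<open>1 / \<rho>\<close>, the region
    becomes bounded. Its component along \<zeta> has modulus below 1. As \<open>norm u < 1\<close>
    and \<open>cmod (herm u \<zeta>)\<close> is at least \<open>1 - \<rho>\<close>, the orthogonal
    component has square norm at most \<open>2 * \<rho>\<close>, hence at most 2 after rescaling.
    The radius 2 comes from \<open>1 + 2 < 2\<^sup>2\<close>.\<close>
  have "Q \<subseteq> ?E"
  proof
    fix u assume "u \<in> Q"
    then have u: "norm u < 1" "cmod (1 - herm u \<zeta>) < \<rho>" by (auto simp: Q_def)
    define y where "y = u - \<zeta>"
    define x where "x = stretch (1 / \<rho>) \<zeta> y"
    have u\<zeta>: "herm \<zeta> \<zeta> = 1" using \<zeta> by (simp add: herm_self)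
    have hy: "herm y \<zeta> = herm u \<zeta> - 1" using u\<zeta> by (simp add: y_def herm_diff_left)
    have hx: "herm x \<zeta> = complex_of_real (1 / \<rho>) * (herm u \<zeta> - 1)"
      unfolding x_def stretch_def hy[symmetric] using u\<zeta> by (simp add: herm_simps(1-4))
    have px: "x - herm x \<zeta> *s \<zeta> = complex_of_real (sqrt (1 / \<rho>)) *s (u - herm u \<zeta> *s \<zeta>)"
      unfolding hx unfolding x_def stretch_def hy unfolding y_def by (simp add: vec_eq_iff algebra_simps)
    have "(cmod (herm x \<zeta>))\<^sup>2 < 1"
      unfolding hx using u(2) \<rho> by (simp add: norm_mult norm_divide norm_minus_commute power_divide power_strict_mono)
    moreover have "(norm (x - herm x \<zeta> *s \<zeta>))\<^sup>2 \<le> 2"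
    proof -
      have "1 - \<rho> \<le> cmod (herm u \<zeta>)" using u(2) norm_triangle_ineq2[of 1 "1 - herm u \<zeta>"] by simp
      have "1 - 2 * \<rho> \<le> (cmod (herm u \<zeta>))\<^sup>2"
      proof (cases "\<rho> \<le> 1")
        case True
        then have "(1 - \<rho>)\<^sup>2 \<le> (cmod (herm u \<zeta>))\<^sup>2"
          using \<open>1 - \<rho> \<le> cmod (herm u \<zeta>)\<close> by (intro power_mono) auto
        then show ?thesis by (simp add: power2_diff) (smt (verit) zero_le_power2)
      next
        case False then show ?thesis by (smt (verit) zero_le_power2)
      qed
      moreover have "(norm u)\<^sup>2 \<le> 1" using u(1) by (simp add: abs_square_le_1)
      ultimately have "(norm (u - herm u \<zeta> *s \<zeta>))\<^sup>2 \<le> 2 * \<rho>"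
        using norm_pythagoras[OF \<zeta>, of u] by linarith
      moreover have "(norm (x - herm x \<zeta> *s \<zeta>))\<^sup>2 = (norm (u - herm u \<zeta> *s \<zeta>))\<^sup>2 / \<rho>"
        unfolding px scaleR_eq_scale[symmetric] using \<rho> by (simp add: power_mult_distrib)
      ultimately show ?thesis using \<rho> by (simp add: divide_le_eq)
    qed
    ultimately have "(norm x)\<^sup>2 < 2\<^sup>2" using norm_pythagoras[OF \<zeta>, of x] by simp
    then have "norm x < 2" by (rule power_less_imp_less_base) simp
    moreover have "u = \<zeta> + stretch \<rho> \<zeta> x" using stretch_inverse[OF \<zeta> \<rho>, of y] by (simp add: x_def y_def)
    ultimately show "u \<in> ?E" by auto
  qed
  then show "measure lebesgue Q \<le> \<rho> ^ (CARD('n) + 1) * measure lebesgue (ball 0 2 :: (complex^'n) set)"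
    using measure_stretch_ball(2,3)[OF \<rho> \<zeta>, of \<zeta> 2] measure_mono_fmeasurable[of Q ?E lebesgue] Q
    by (simp add: fmeasurableD)
qed


text \<open>Only the direction of \<open>u\<close> is restricted, so the parts inside concentric
  balls are scaled copies with exactly known shares of the volume. The origin has no direction and
  is left out, which keeps the set open.\<close>

definition ray_cone :: "complex^'n \<Rightarrow> real \<Rightarrow> (complex^'n) set" where
  "ray_cone \<zeta> R = {u \<in> ball 0 1 - {0}. cmod (1 - herm (u /\<^sub>R norm u) \<zeta>) < R}"

lemma ray_cone_lmeasurable: "ray_cone \<zeta> R \<in> lmeasurable"
proof (rule lmeasurable_open)
  have "open ((ball 0 1 - {0}) \<inter> (\<lambda>u. cmod (1 - herm (u /\<^sub>R norm u) \<zeta>)) -` {..<R})"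
    by (rule continuous_open_preimage) (auto intro!: continuous_intros open_Diff)
  also have "(ball 0 1 - {0}) \<inter> (\<lambda>u. cmod (1 - herm (u /\<^sub>R norm u) \<zeta>)) -` {..<R} = ray_cone \<zeta> R"
    by (auto simp: ray_cone_def)
  finally show "open (ray_cone \<zeta> R)" .
  show "bounded (ray_cone \<zeta> R)" unfolding ray_cone_def by (rule bounded_subset[OF bounded_ball[of 0 1]]) auto
qed

lemma ray_cone_Int_ball:
  assumes c: "0 < c" "c < 1"
  shows "ray_cone \<zeta> R \<inter> ball 0 c = (*\<^sub>R) c ` ray_cone \<zeta> R"
proof (intro equalityI subsetI)
  fix u assume "u \<in> ray_cone \<zeta> R \<inter> ball 0 c"
  then have "u /\<^sub>R c \<in> ray_cone \<zeta> R" using c by (auto simp: ray_cone_def field_simps)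
  then show "u \<in> (*\<^sub>R) c ` ray_cone \<zeta> R" using c by (intro image_eqI[of _ _ "u /\<^sub>R c"]) auto
next
  fix u assume "u \<in> (*\<^sub>R) c ` ray_cone \<zeta> R"
  then obtain v where v: "u = c *\<^sub>R v" "v \<in> ray_cone \<zeta> R" by blast
  have "c * norm v < c * 1" using v c by (intro mult_strict_left_mono) (auto simp: ray_cone_def)
  moreover have "u /\<^sub>R norm u = v /\<^sub>R norm v" using c by (simp add: v field_simps)
  moreover have "norm u < c" "u \<noteq> 0" using v c \<open>c * norm v < c * 1\<close> by (auto simp: ray_cone_def)
  ultimately show "u \<in> ray_cone \<zeta> R \<inter> ball 0 c" using v(2) c(2) by (simp add: ray_cone_def)
qed

lemma measure_ray_cone_Int_ball:
  fixes \<zeta> :: "complex^'n"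
  assumes c: "0 < c" "c < 1"
  shows "measure lebesgue (ray_cone \<zeta> R \<inter> ball 0 c) = c ^ (2 * CARD('n)) * measure lebesgue (ray_cone \<zeta> R)"
  using measure_lebesgue_affine[of c 0 "ray_cone \<zeta> R"] c
  unfolding ray_cone_Int_ball[OF c] by (simp add: mult.commute)

lemma measure_ray_cone_diff_ball:
  fixes \<zeta> :: "complex^'n"
  assumes c: "0 < c" "c < 1"
  shows "measure lebesgue (ray_cone \<zeta> R - ball 0 c) = (1 - c ^ (2 * CARD('n))) * measure lebesgue (ray_cone \<zeta> R)"
proof -
  have "measure lebesgue (ray_cone \<zeta> R - ray_cone \<zeta> R \<inter> ball 0 c)
      = measure lebesgue (ray_cone \<zeta> R) - measure lebesgue (ray_cone \<zeta> R \<inter> ball 0 c)"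
    using ray_cone_lmeasurable by (intro measurable_measure_Diff) (auto intro: fmeasurableD)
  moreover have "ray_cone \<zeta> R - ray_cone \<zeta> R \<inter> ball 0 c = ray_cone \<zeta> R - ball 0 c" by blast
  ultimately show ?thesis unfolding measure_ray_cone_Int_ball[OF c] by (simp add: algebra_simps)
qed

text \<open>The outer layer of the cone lies in a nonisotropic ball of measure of order \<open>R ^ (n + 1)\<close>, and by
  homogeneity it carries at least the fraction \<open>R\<close> of the measure of the cone.\<close>

lemma measure_ray_cone_le:
  fixes \<zeta> :: "complex^'n"
  assumes R: "R > 0" and \<zeta>: "norm \<zeta> = 1"
  shows "measure lebesgue (ray_cone \<zeta> R) \<le> 2 ^ (CARD('n) + 1) * measure lebesgue (ball 0 2 :: (complex^'n) set) * R ^ CARD('n)"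
proof (cases "R < 1")
  case True
  let ?b = "measure lebesgue (ball 0 2 :: (complex^'n) set)"
  \<comment> \<open>Direction and depth each contribute at most \<open>R\<close> to
    \<open>cmod (1 - herm u \<zeta>)\<close>, hence the aperture \<open>2 * R\<close>.\<close>
  let ?Q = "{u \<in> ball 0 1. cmod (1 - herm u \<zeta>) < 2 * R}"
  have "ray_cone \<zeta> R - ball 0 (1 - R) \<subseteq> ?Q"
  proof
    fix u assume u: "u \<in> ray_cone \<zeta> R - ball 0 (1 - R)"
    define \<eta> where "\<eta> = u /\<^sub>R norm u"
    have "norm u \<ge> 1 - R" "norm u < 1" "u \<noteq> 0" "cmod (1 - herm \<eta> \<zeta>) < R" "norm \<eta> = 1"
      using u by (auto simp: ray_cone_def \<eta>_def)
    have "u = complex_of_real (norm u) *s \<eta>" using \<open>u \<noteq> 0\<close> by (simp add: \<eta>_def flip: scaleR_eq_scale)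
    then have "herm u \<zeta> = complex_of_real (norm u) * herm \<eta> \<zeta>" by (metis herm_scale_left)
    then have "1 - herm u \<zeta> = (1 - herm \<eta> \<zeta>) + complex_of_real (1 - norm u) * herm \<eta> \<zeta>"
      by (simp add: algebra_simps)
    then have "cmod (1 - herm u \<zeta>) \<le> cmod (1 - herm \<eta> \<zeta>) + (1 - norm u) * cmod (herm \<eta> \<zeta>)"
      using \<open>norm u < 1\<close> by (smt (verit) norm_triangle_ineq norm_mult norm_of_real)
    also have "(1 - norm u) * cmod (herm \<eta> \<zeta>) \<le> R * 1"
      using cmod_herm_le[of \<eta> \<zeta>] \<open>norm u \<ge> 1 - R\<close> \<open>norm u < 1\<close> \<open>norm \<eta> = 1\<close> \<zeta> by (intro mult_mono) auto
    finally show "u \<in> ?Q" using \<open>cmod (1 - herm \<eta> \<zeta>) < R\<close> \<open>norm u < 1\<close> by simp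
  qed
  then have "measure lebesgue (ray_cone \<zeta> R - ball 0 (1 - R)) \<le> measure lebesgue ?Q"
  proof (rule measure_mono_fmeasurable)
    show "ray_cone \<zeta> R - ball 0 (1 - R) \<in> sets lebesgue"
      by (intro sets.Diff fmeasurableD[OF ray_cone_lmeasurable]) simp
    show "?Q \<in> lmeasurable" by (rule measure_Koranyi_le(1)[OF _ \<zeta>]) (use R in simp)
  qed
  also have "\<dots> \<le> (2 * R) ^ (CARD('n) + 1) * ?b"
    using measure_Koranyi_le(2)[OF _ \<zeta>, of "2 * R"] R by simp
  finally have "(1 - (1 - R) ^ (2 * CARD('n))) * measure lebesgue (ray_cone \<zeta> R) \<le> (2 * R) ^ (CARD('n) + 1) * ?b"
    using measure_ray_cone_diff_ball[of "1 - R" \<zeta> R] R True by simp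
  moreover have "(1 - R) ^ (2 * CARD('n)) \<le> (1 - R) ^ 1"
    using R True by (intro power_decreasing) (auto simp: Suc_le_eq)
  then have "R * measure lebesgue (ray_cone \<zeta> R) \<le> (1 - (1 - R) ^ (2 * CARD('n))) * measure lebesgue (ray_cone \<zeta> R)"
    by (intro mult_right_mono) auto
  ultimately have "R * measure lebesgue (ray_cone \<zeta> R) \<le> R * (2 ^ (CARD('n) + 1) * ?b * R ^ CARD('n))"
    by (simp add: power_mult_distrib mult_ac)
  then show ?thesis using R by simp
next
  case False
  have "measure lebesgue (ray_cone \<zeta> R) \<le> measure lebesgue (ball 0 2 :: (complex^'n) set)"
    using ray_cone_lmeasurable by (intro measure_mono_fmeasurable) (auto simp: ray_cone_def intro: fmeasurableD)
  also have "\<dots> \<le> (2 ^ (CARD('n) + 1) * R ^ CARD('n)) * measure lebesgue (ball 0 2 :: (complex^'n) set)"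
  proof -
    have "1 \<le> 2 ^ (CARD('n) + 1) * R ^ CARD('n)"
      using False one_le_power[of "2::real" "CARD('n) + 1"] one_le_power[of R "CARD('n)"]
        mult_mono[of 1 "2 ^ (CARD('n) + 1)" 1 "R ^ CARD('n)"] by simp
    from mult_right_mono[OF this, of "measure lebesgue (ball 0 2 :: (complex^'n) set)"] show ?thesis by simp
  qed
  finally show ?thesis by (simp add: mult_ac)
qed

text \<open>Bernoulli's inequality linearises the exact share 1 - (1 - t)^(2n) of the layer. The
  resulting factor \<open>t\<close> is what compensates a density that blows up at the
  sphere.\<close>

lemma measure_ray_cone_layer_le:
  fixes \<zeta> :: "complex^'n"
  assumes t: "t > 0"
  shows "measure lebesgue (ray_cone \<zeta> R - ball 0 (1 - t)) \<le> 2 * real CARD('n) * t * measure lebesgue (ray_cone \<zeta> R)"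
proof (cases "t < 1")
  case True
  have "1 + real (2 * CARD('n)) * (- t) \<le> (1 + (- t)) ^ (2 * CARD('n))"
    using True by (intro Bernoulli_inequality) auto
  then have "1 - (1 - t) ^ (2 * CARD('n)) \<le> 2 * real CARD('n) * t" by simp
  then show ?thesis using measure_ray_cone_diff_ball[of "1 - t" \<zeta> R] t True
    by (simp add: mult_right_mono del: mult_le_cancel_right)
next
  case False
  have "1 * 1 \<le> (2 * real CARD('n)) * t"
    using False one_le_card_finite[where 'a='n] by (intro mult_mono) linarith+
  from mult_right_mono[OF this, of "measure lebesgue (ray_cone \<zeta> R)"]
  have "measure lebesgue (ray_cone \<zeta> R) \<le> 2 * real CARD('n) * t * measure lebesgue (ray_cone \<zeta> R)" by simp
  moreover have "ray_cone \<zeta> R - ball 0 (1 - t) = ray_cone \<zeta> R"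
    using False by (subst ball_empty) auto
  ultimately show ?thesis by simp
qed

section \<open>Volume of the balls\<close>

text \<open>A bound on \<open>\<bar>ln x\<bar>\<close> treats both signs of the exponent at
  once.\<close>

lemma powr_between:
  fixes x c \<gamma> :: real
  assumes "c > 0" "1 / c \<le> x" "x \<le> c"
  shows "c powr (- \<bar>\<gamma>\<bar>) \<le> x powr \<gamma>" "x powr \<gamma> \<le> c powr \<bar>\<gamma>\<bar>"
proof -
  have x: "x > 0" using assms by (smt (verit) divide_pos_pos)
  have "ln (1 / c) \<le> ln x" "ln x \<le> ln c" using assms x by (subst ln_le_cancel_iff; simp)+
  then have "\<bar>ln x\<bar> \<le> ln c" using assms by (simp add: ln_div)
  then have "\<bar>\<gamma> * ln x\<bar> \<le> \<bar>\<gamma>\<bar> * ln c" by (simp add: abs_mult mult_left_mono)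
  then show "c powr (- \<bar>\<gamma>\<bar>) \<le> x powr \<gamma>" "x powr \<gamma> \<le> c powr \<bar>\<gamma>\<bar>"
    using assms x by (auto simp: powr_def)
qed

text \<open>The bound on twice the depth, \<open>2 * (1 - norm u)\<close>, is there because
  \<open>1 - (norm u)\<^sup>2\<close> lies between the depth and its double.\<close>

lemma weight_between:
  fixes u :: "'a::real_normed_vector"
  assumes "norm u < 1" "t > 0" "t / c \<le> 1 - norm u" "2 * (1 - norm u) \<le> c * t" "c > 0"
  shows "c powr (- \<bar>\<gamma>\<bar>) * t powr \<gamma> \<le> (1 - (norm u)\<^sup>2) powr \<gamma>" (is ?A)
    and "(1 - (norm u)\<^sup>2) powr \<gamma> \<le> c powr \<bar>\<gamma>\<bar> * t powr \<gamma>" (is ?B)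
proof -
  define y where "y = 1 - (norm u)\<^sup>2"
  have "y = (1 - norm u) * (1 + norm u)" by (simp add: y_def power2_eq_square algebra_simps)
  then have "1 - norm u \<le> y" "y \<le> 2 * (1 - norm u)"
    using mult_left_mono[of 1 "1 + norm u" "1 - norm u"] mult_left_mono[of "1 + norm u" 2 "1 - norm u"] assms(1)
    by (simp_all add: mult.commute)
  then have "t / c \<le> y" "y \<le> c * t" using assms by linarith+
  then have "1 / c \<le> y / t" "y / t \<le> c" using assms(2,5) by (simp_all add: field_simps)
  moreover have "y powr \<gamma> = (y / t) powr \<gamma> * t powr \<gamma>"
    using assms(2) \<open>t / c \<le> y\<close> assms(5) by (smt (verit) divide_pos_pos nonzero_eq_divide_eq powr_mult)
  ultimately show ?A ?B using powr_between[of c "y / t" \<gamma>] assms(5)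
    by (simp_all add: y_def[symmetric] mult_right_mono)
qed

lemma dyadic_layer:
  fixes s T :: real
  assumes "0 < s" "s < T"
  obtains i where "T / 2 ^ i / 2 \<le> s" "s < T / 2 ^ i"
proof -
  have "\<exists>i. T / 2 ^ i / 2 \<le> s"
  proof -
    obtain i where "(1/2) ^ i < s / T" using real_arch_pow_inv[of "s / T" "1/2"] assms by auto
    then have "T / 2 ^ i / 2 \<le> s" using assms by (simp add: field_simps power_divide)
    then show ?thesis ..
  qed
  define i where "i = (LEAST i. T / 2 ^ i / 2 \<le> s)"
  have "T / 2 ^ i / 2 \<le> s" unfolding i_def by (rule LeastI_ex) fact
  moreover have "s < T / 2 ^ i"
  proof (cases i)
    case 0 then show ?thesis using assms by simp
  next
    case (Suc j)
    then have "\<not> T / 2 ^ j / 2 \<le> s" using not_less_Least[of j "\<lambda>i. T / 2 ^ i / 2 \<le> s"] by (simp add: i_def)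
    then show ?thesis by (simp add: Suc field_simps)
  qed
  ultimately show ?thesis using that by blast
qed

text \<open>The cone is cut into layers of depth about \<open>2 * R / 2 ^ i\<close>. On such a layer
  of depth t the density is of order t^\<gamma> and the volume at most of order t R^n, so the
  contributions form a geometric series of ratio 2^(-(\<gamma>+1)); it converges because
  \<open>\<gamma> > -1\<close>.\<close>

lemma nn_integral_cone_le:
  fixes \<gamma> :: real
  assumes \<gamma>: "\<gamma> > -1"
  shows "\<exists>C>0. \<forall>(\<zeta>::complex^'n) R. norm \<zeta> = 1 \<and> R > 0 \<longrightarrow>
    (\<integral>\<^sup>+u. ennreal ((1 - (norm u)\<^sup>2) powr \<gamma>) * indicator (ray_cone \<zeta> R \<inter> {u. 1 - norm u < 2 * R}) u \<partial>lebesgue)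
      \<le> ennreal (C * R powr (real CARD('n) + 1 + \<gamma>))"
proof -
  define b where "b = 2 ^ (CARD('n) + 1) * measure lebesgue (ball 0 2 :: (complex^'n) set)"
  have b: "b > 0" by (simp add: b_def measure_completion)
  define a where "a = 2 powr (-(\<gamma> + 1))"
  have a: "0 < a" "a < 1" using \<gamma> by (auto simp: a_def powr_less_one)
  \<comment> \<open>The factors come from the comparison of the density with its value at depth
    \<open>t i\<close>, from the share of a layer in the cone, from the volume of the cone, from the
    outermost depth \<open>2 * R\<close>, and from the geometric series.\<close>
  define C where "C = 4 powr \<bar>\<gamma>\<bar> * (2 * real CARD('n) * b) * 2 powr (\<gamma> + 1) / (1 - a)"
  have "C > 0" using a b by (simp add: C_def)
  moreover have "(\<integral>\<^sup>+u. ennreal ((1 - (norm u)\<^sup>2) powr \<gamma>) * indicator (ray_cone \<zeta> R \<inter> {u. 1 - norm u < 2 * R}) u \<partial>lebesgue)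
      \<le> ennreal (C * R powr (real CARD('n) + 1 + \<gamma>))"
    if \<zeta>: "norm \<zeta> = 1" and R: "R > 0" for \<zeta> :: "complex^'n" and R
  proof -
    define t where "t i = 2 * R / 2 ^ i" for i :: nat
    have t: "t i > 0" for i using R by (simp add: t_def)
    define L where "L i = ray_cone \<zeta> R - ball 0 (1 - t i)" for i
    have L: "L i \<in> lmeasurable" for i
      unfolding L_def using ray_cone_lmeasurable by (intro fmeasurable.Diff) auto
    define d where "d i = 4 powr \<bar>\<gamma>\<bar> * t i powr \<gamma>" for i
    have "(\<integral>\<^sup>+u. ennreal ((1 - (norm u)\<^sup>2) powr \<gamma>) * indicator (ray_cone \<zeta> R \<inter> {u. 1 - norm u < 2 * R}) u \<partial>lebesgue)
       \<le> (\<integral>\<^sup>+u. (\<Sum>i. ennreal (d i) * indicator (L i) u) \<partial>lebesgue)"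
    proof (rule nn_integral_mono)
      fix u :: "complex^'n"
      show "ennreal ((1 - (norm u)\<^sup>2) powr \<gamma>) * indicator (ray_cone \<zeta> R \<inter> {u. 1 - norm u < 2 * R}) u
        \<le> (\<Sum>i. ennreal (d i) * indicator (L i) u)"
      proof (cases "u \<in> ray_cone \<zeta> R \<inter> {u. 1 - norm u < 2 * R}")
        case True
        then have u: "norm u < 1" "1 - norm u < 2 * R" "u \<in> ray_cone \<zeta> R" by (auto simp: ray_cone_def)
        then obtain i where i: "t i / 2 \<le> 1 - norm u" "1 - norm u < t i"
          unfolding t_def using dyadic_layer[of "1 - norm u" "2 * R"] by auto
        have "(1 - (norm u)\<^sup>2) powr \<gamma> \<le> d i"
          unfolding d_def using u i t[of i] by (intro weight_between) auto
        moreover have "u \<in> L i" using i u by (auto simp: L_def)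
        ultimately have "ennreal ((1 - (norm u)\<^sup>2) powr \<gamma>) \<le> ennreal (d i) * indicator (L i) u"
          by (simp add: ennreal_leI)
        also have "\<dots> \<le> (\<Sum>i. ennreal (d i) * indicator (L i) u)"
        proof -
          define F where "F i = ennreal (d i) * indicator (L i) u" for i
          show ?thesis using sum_le_suminf[of F "{i}"] by (simp add: F_def[symmetric])
        qed
        finally show ?thesis using True by simp
      qed simp
    qed
    also have "\<dots> = (\<Sum>i. ennreal (d i) * emeasure lebesgue (L i))"
      using L by (subst nn_integral_suminf) (auto simp: nn_integral_cmult_indicator fmeasurableD)
    also have "\<dots> \<le> (\<Sum>i. ennreal (C * (1 - a) * R powr (real CARD('n) + 1 + \<gamma>) * a ^ i))"
    proof (rule suminf_le)
      fix i
      have "measure lebesgue (L i) \<le> 2 * real CARD('n) * t i * measure lebesgue (ray_cone \<zeta> R)"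
        unfolding L_def by (rule measure_ray_cone_layer_le[OF t])
      also have "\<dots> \<le> 2 * real CARD('n) * t i * (b * R ^ CARD('n))"
        using measure_ray_cone_le[OF R \<zeta>] t[of i] unfolding b_def by (intro mult_left_mono) auto
      finally have "d i * measure lebesgue (L i) \<le> d i * (2 * real CARD('n) * t i * (b * R ^ CARD('n)))"
        by (intro mult_left_mono) (auto simp: d_def)
      also have "\<dots> = 4 powr \<bar>\<gamma>\<bar> * (2 * real CARD('n) * b) * (t i powr \<gamma> * t i) * R ^ CARD('n)"
        by (simp add: d_def)
      also have "t i powr \<gamma> * t i = t i powr (\<gamma> + 1)"
        using t[of i] by (simp add: powr_add)
      also have "t i powr (\<gamma> + 1) = 2 powr (\<gamma> + 1) * R powr (\<gamma> + 1) * a ^ i"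
      proof -
        have "a ^ i = inverse ((2 powr (\<gamma> + 1)) ^ i)" unfolding a_def powr_minus by (simp add: power_inverse)
        also have "(2 powr (\<gamma> + 1)) ^ i = ((2::real) ^ i) powr (\<gamma> + 1)"
          by (simp add: powr_power powr_powr mult.commute flip: powr_realpow)
        finally show ?thesis using R by (simp add: t_def powr_divide powr_mult) (simp add: divide_inverse)
      qed
      finally have "d i * measure lebesgue (L i) \<le> C * (1 - a) * (R powr (\<gamma> + 1) * R ^ CARD('n)) * a ^ i"
        using a by (simp add: C_def mult_ac)
      also have "R powr (\<gamma> + 1) * R ^ CARD('n) = R powr (real CARD('n) + 1 + \<gamma>)"
        using R by (simp add: powr_add powr_realpow mult_ac)
      finally have "ennreal (d i * measure lebesgue (L i)) \<le> ennreal (C * (1 - a) * R powr (real CARD('n) + 1 + \<gamma>) * a ^ i)"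
        by (rule ennreal_leI)
      then show "ennreal (d i) * emeasure lebesgue (L i) \<le> ennreal (C * (1 - a) * R powr (real CARD('n) + 1 + \<gamma>) * a ^ i)"
        using L[of i] by (simp add: emeasure_eq_measure2 ennreal_mult d_def)
    qed auto
    also have "\<dots> = ennreal (C * R powr (real CARD('n) + 1 + \<gamma>))"
    proof (rule suminf_ennreal_eq)
      show "0 \<le> C * (1 - a) * R powr (real CARD('n) + 1 + \<gamma>) * a ^ i" for i
        using a \<open>C > 0\<close> by simp
      show "(\<lambda>i. C * (1 - a) * R powr (real CARD('n) + 1 + \<gamma>) * a ^ i) sums (C * R powr (real CARD('n) + 1 + \<gamma>))"
        using sums_mult[OF geometric_sums[of a], of "C * (1 - a) * R powr (real CARD('n) + 1 + \<gamma>)"] a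
        by simp
    qed
    finally show ?thesis .
  qed
  ultimately show ?thesis by blast
qed

text \<open>The centre has distance \<open>3 R / 8\<close> to the sphere, so that the set fits into every ball
  \<open>pball z R\<close> that meets the sphere with \<open>z\<close> in direction \<open>\<zeta>\<close>, even if \<open>1 - norm z\<close> is almost \<open>R\<close>.\<close>

definition inner_set :: "complex^'n \<Rightarrow> real \<Rightarrow> (complex^'n) set" where
  "inner_set \<zeta> R = (+) ((1 - 3 * R / 8) *\<^sub>R \<zeta>) ` stretch R \<zeta> ` ball 0 (1 / 20)"

text \<open>The centre has depth \<open>3 * R / 8\<close>, with \<open>R / 8\<close> to spare on
  both sides. A displacement along \<zeta> is at most \<open>R / 20\<close>. An orthogonal one can
  be as large as \<open>sqrt R / 20\<close>, but it enters the norm only through its square and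
  shifts it by at most \<open>R / 400\<close>.\<close>

lemma inner_set_bounds:
  fixes \<zeta> :: "complex^'n"
  assumes \<zeta>: "norm \<zeta> = 1" and R: "0 < R" "R \<le> 1" and u: "u \<in> inner_set \<zeta> R"
  shows "R / 4 \<le> 1 - norm u" "1 - norm u \<le> R / 2" "cmod (1 - herm (u /\<^sub>R norm u) \<zeta>) < R / 4"
proof -
  obtain x where x: "norm x < 1 / 20" "u = (1 - 3 * R / 8) *\<^sub>R \<zeta> + stretch R \<zeta> x"
    using u by (auto simp: inner_set_def)
  define h where "h = herm x \<zeta>"
  define \<beta> where "\<beta> = 1 - 3 * R / 8"
  define v where "v = sqrt R *\<^sub>R (x - h *s \<zeta>)"
  define \<alpha> where "\<alpha> = cmod (herm u \<zeta>)"
  have h: "cmod h < 1 / 20" using cmod_herm_le[of x \<zeta>] \<zeta> x by (simp add: h_def)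
  have \<zeta>\<zeta>: "herm \<zeta> \<zeta> = 1" using \<zeta> by (simp add: herm_self)
  have hu: "herm u \<zeta> = complex_of_real \<beta> + complex_of_real R * h"
    unfolding x(2) h_def stretch_def scaleR_eq_scale \<beta>_def using \<zeta>\<zeta> by (simp add: herm_simps(1-4))
  have uv: "u - herm u \<zeta> *s \<zeta> = v"
  proof -
    have "u = complex_of_real \<beta> *s \<zeta> + (complex_of_real R *s (h *s \<zeta>) + v)"
      by (simp only: x(2) h_def stretch_def scaleR_eq_scale \<beta>_def v_def)
    then show ?thesis unfolding hu by (simp add: vector_sadd_rdistrib)
  qed
  have "(norm v)\<^sup>2 \<le> R * (norm x)\<^sup>2"
    using norm_pythagoras[OF \<zeta>, of x] R by (simp add: v_def h_def power_mult_distrib)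
  also have "\<dots> \<le> R * (1 / 20)\<^sup>2" using x R by (intro mult_left_mono power_mono) auto
  finally have v: "(norm v)\<^sup>2 \<le> R / 400" by (simp add: power2_eq_square)
  have Rh: "cmod (complex_of_real R * h) \<le> R / 20" using h R by (simp add: norm_mult)
  have \<beta>: "cmod (complex_of_real \<beta>) = \<beta>" using R by (subst norm_of_real) (simp add: \<beta>_def)
  have \<alpha>1: "\<beta> - R / 20 \<le> \<alpha>" "\<alpha> \<le> \<beta> + R / 20"
    unfolding \<alpha>_def hu using Rh \<beta> norm_triangle_ineq[of "complex_of_real \<beta>" "complex_of_real R * h"]
      norm_diff_ineq[of "complex_of_real \<beta>" "complex_of_real R * h"] by linarith+
  have \<alpha>2: "\<alpha> \<ge> 1 / 2" using \<alpha>1 R unfolding \<beta>_def by linarith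
  have py: "(norm u)\<^sup>2 = \<alpha>\<^sup>2 + (norm v)\<^sup>2" using norm_pythagoras[OF \<zeta>, of u] by (simp add: uv \<alpha>_def)
  have lo: "\<alpha> \<le> norm u"
    by (rule power2_le_imp_le) (simp_all add: py)
  have "(norm u)\<^sup>2 \<le> (\<alpha> + R / 400)\<^sup>2"
  proof -
    have "1 * (R / 400) \<le> (2 * \<alpha>) * (R / 400)" using \<alpha>2 R by (intro mult_right_mono) auto
    then have "R / 400 \<le> 2 * \<alpha> * (R / 400) + (R / 400)\<^sup>2" using zero_le_power2[of "R / 400"] by linarith
    then show ?thesis unfolding py using v by (simp add: power2_sum)
  qed
  then have hi: "norm u \<le> \<alpha> + R / 400"
    by (rule power2_le_imp_le) (use \<alpha>2 R in linarith)
  show "R / 4 \<le> 1 - norm u" "1 - norm u \<le> R / 2"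
    using lo hi \<alpha>1 R unfolding \<beta>_def by linarith+
  have n: "norm u \<ge> 1 / 2" using lo \<alpha>2 by linarith
  have "cmod (complex_of_real (norm u) - herm u \<zeta>) \<le> \<bar>norm u - \<beta>\<bar> + R / 20"
  proof -
    have "complex_of_real (norm u) - herm u \<zeta> = complex_of_real (norm u - \<beta>) - complex_of_real R * h"
      by (simp add: hu)
    then show ?thesis
      using norm_triangle_ineq4[of "complex_of_real (norm u - \<beta>)" "complex_of_real R * h"] Rh
      by (simp only: norm_of_real)
  qed
  \<comment> \<open>The radial error is at most \<open>R / 20 + R / 400\<close> and the displacement
    along \<zeta> adds another \<open>R / 20\<close>. Division by \<open>norm u \<ge> 1 / 2\<close>
    leaves \<open>82 * R / 400\<close>, still below \<open>R / 4\<close>.\<close>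
  also have "\<dots> \<le> 41 * R / 400" using lo hi \<alpha>1 R by linarith
  finally have "cmod (complex_of_real (norm u) - herm u \<zeta>) \<le> 41 * R / 400" .
  moreover have "u \<noteq> 0" using n by auto
  then have "1 - herm (u /\<^sub>R norm u) \<zeta> = (complex_of_real (norm u) - herm u \<zeta>) / complex_of_real (norm u)"
    unfolding scaleR_eq_scale herm_scale_left by (simp add: divide_inverse mult.commute[of _ "inverse _"] right_diff_distrib)
  then have "cmod (1 - herm (u /\<^sub>R norm u) \<zeta>) = cmod (complex_of_real (norm u) - herm u \<zeta>) / norm u"
    using n by (simp add: norm_divide)
  moreover have "41 * R / 400 < R / 4 * norm u"
  proof -
    have "R / 4 * (1 / 2) \<le> R / 4 * norm u" using n R by (intro mult_left_mono) auto
    then show ?thesis using R by linarith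
  qed
  moreover have "norm u > 0" using n by linarith
  ultimately show "cmod (1 - herm (u /\<^sub>R norm u) \<zeta>) < R / 4"
    by (simp only: pos_divide_less_eq)
qed

lemma nn_integral_inner_set_ge:
  fixes \<gamma> :: real
  shows "\<exists>c>0. \<forall>(\<zeta>::complex^'n) R. norm \<zeta> = 1 \<and> 0 < R \<and> R \<le> 1 \<longrightarrow>
    ennreal (c * R powr (real CARD('n) + 1 + \<gamma>)) \<le>
    (\<integral>\<^sup>+u. ennreal ((1 - (norm u)\<^sup>2) powr \<gamma>) * indicator (inner_set \<zeta> R) u \<partial>lebesgue)"
proof -
  define c where "c = 4 powr (- \<bar>\<gamma>\<bar>) * measure lebesgue (ball 0 (1 / 20) :: (complex^'n) set)"
  have "c > 0" by (simp add: c_def measure_completion)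
  moreover have "ennreal (c * R powr (real CARD('n) + 1 + \<gamma>)) \<le>
    (\<integral>\<^sup>+u. ennreal ((1 - (norm u)\<^sup>2) powr \<gamma>) * indicator (inner_set \<zeta> R) u \<partial>lebesgue)"
    if \<zeta>: "norm \<zeta> = 1" and R: "0 < R" "R \<le> 1" for \<zeta> :: "complex^'n" and R
  proof -
    have E: "inner_set \<zeta> R \<in> lmeasurable"
      "measure lebesgue (inner_set \<zeta> R) = R ^ (CARD('n) + 1) * measure lebesgue (ball 0 (1/20) :: (complex^'n) set)"
      unfolding inner_set_def using measure_stretch_ball[OF R(1) \<zeta>] by blast+
    have "R powr (real CARD('n) + 1 + \<gamma>) = R powr \<gamma> * R ^ (CARD('n) + 1)"
      using R by (simp add: powr_add powr_realpow mult_ac)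
    then have "c * R powr (real CARD('n) + 1 + \<gamma>) = (4 powr (- \<bar>\<gamma>\<bar>) * R powr \<gamma>) * measure lebesgue (inner_set \<zeta> R)"
      unfolding E(2) c_def by (simp only: mult_ac)
    then have "ennreal (c * R powr (real CARD('n) + 1 + \<gamma>)) = ennreal (4 powr (- \<bar>\<gamma>\<bar>) * R powr \<gamma>) * ennreal (measure lebesgue (inner_set \<zeta> R))"
      by (simp only:) (rule ennreal_mult', simp)
    also have "\<dots> = ennreal (4 powr (- \<bar>\<gamma>\<bar>) * R powr \<gamma>) * emeasure lebesgue (inner_set \<zeta> R)"
      using emeasure_eq_measure2[OF E(1)] by simp
    also have "\<dots> = (\<integral>\<^sup>+u. ennreal (4 powr (- \<bar>\<gamma>\<bar>) * R powr \<gamma>) * indicator (inner_set \<zeta> R) u \<partial>lebesgue)"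
      by (rule nn_integral_cmult_indicator[symmetric]) (rule fmeasurableD[OF E(1)])
    also have "\<dots> \<le> (\<integral>\<^sup>+u. ennreal ((1 - (norm u)\<^sup>2) powr \<gamma>) * indicator (inner_set \<zeta> R) u \<partial>lebesgue)"
    proof (intro nn_integral_mono)
      fix u show "ennreal (4 powr (- \<bar>\<gamma>\<bar>) * R powr \<gamma>) * indicator (inner_set \<zeta> R) u
          \<le> ennreal ((1 - (norm u)\<^sup>2) powr \<gamma>) * indicator (inner_set \<zeta> R) u"
      proof (cases "u \<in> inner_set \<zeta> R")
        case True
        from inner_set_bounds(1,2)[OF \<zeta> R True] R
        have "4 powr (- \<bar>\<gamma>\<bar>) * R powr \<gamma> \<le> (1 - (norm u)\<^sup>2) powr \<gamma>"
          by (intro weight_between) auto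
        then show ?thesis by (simp add: True ennreal_leI)
      qed simp
    qed
    finally show ?thesis .
  qed
  ultimately show ?thesis by blast
qed

section \<open>Bergman kernel and pseudo-metric\<close>

lemma cmod_powr_of_real:
  "w \<noteq> 0 \<Longrightarrow> cmod (w powr complex_of_real a) = cmod w powr a"
  by (simp add: powr_def norm_exp_eq_Re)

text \<open>By Cauchy-Schwarz \<open>k = cmod (1 - herm u z)\<close> dominates the depths of both
  points and \<open>1 - r\<close> with \<open>r = norm u * norm z\<close>. Splitting off the radial
  factor therefore costs at most another \<open>k\<close>, and the angular part \<open>m\<close>
  satisfies \<open>r * m \<le> 2 * k\<close>. The constant 9 is 8 for the angular and 1 for the
  radial part of the pseudo-metric.\<close>

lemma cmod_one_minus_herm_ge:
  assumes "norm z < 1" "norm u < 1"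
  shows "1 - norm z \<le> cmod (1 - herm u z)" "pdist z u \<le> 9 * cmod (1 - herm u z)" "herm u z \<noteq> 1"
proof -
  define k where "k = cmod (1 - herm u z)"
  have "1 - norm u * norm z \<le> k"
    using cmod_herm_le[of u z] norm_triangle_ineq2[of 1 "herm u z"] by (simp add: k_def)
  moreover have "norm u * norm z \<le> 1 * norm z" "norm u * norm z \<le> norm u * 1"
    using assms by (intro mult_right_mono mult_left_mono; simp)+
  ultimately have k: "1 - norm z \<le> k" "1 - norm u \<le> k" "1 - norm u * norm z \<le> k" by linarith+
  then show "1 - norm z \<le> cmod (1 - herm u z)" by (simp add: k_def)
  show "herm u z \<noteq> 1" using k(1) assms(1) by (auto simp: k_def)
  show "pdist z u \<le> 9 * cmod (1 - herm u z)"
  proof (cases "z = 0 \<or> u = 0")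
    case True
    then have "cmod (1 - herm u z) = 1" by auto
    then show ?thesis using assms True by (auto simp: pdist_def)
  next
    case False
    define \<zeta> \<eta> where "\<zeta> = z /\<^sub>R norm z" and "\<eta> = u /\<^sub>R norm u"
    define r where "r = norm u * norm z"
    define m where "m = cmod (1 - herm \<zeta> \<eta>)"
    have z: "z = complex_of_real (norm z) *s \<zeta>" and u: "u = complex_of_real (norm u) *s \<eta>"
      using False by (simp_all add: \<zeta>_def \<eta>_def flip: scaleR_eq_scale)
    have "norm \<zeta> = 1" "norm \<eta> = 1" using False by (simp_all add: \<zeta>_def \<eta>_def)
    then have m2: "m \<le> 2" using cmod_herm_le[of \<zeta> \<eta>] norm_triangle_ineq4[of 1 "herm \<zeta> \<eta>"] by (simp add: m_def)
    have "herm u z = complex_of_real r * herm \<eta> \<zeta>"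
      by (subst z, subst u) (simp add: herm_scale_left herm_scale_right r_def mult_ac)
    then have "complex_of_real r * (1 - herm \<eta> \<zeta>) = (1 - herm u z) - complex_of_real (1 - r)"
      by (simp add: algebra_simps)
    then have "cmod (complex_of_real r * (1 - herm \<eta> \<zeta>)) \<le> k + \<bar>1 - r\<bar>"
      by (metis norm_triangle_ineq4 norm_of_real k_def)
    moreover have "cmod (1 - herm \<eta> \<zeta>) = m"
      unfolding m_def by (rule cmod_one_minus_herm_commute)
    moreover have r: "0 \<le> r" "r \<le> 1" using assms by (auto simp: r_def intro: mult_le_one)
    ultimately have rm: "r * m \<le> 2 * k" using k(3) by (simp add: norm_mult r_def)
    \<comment> \<open>For \<open>r \<ge> 1 / 4\<close> one divides by \<open>r\<close>. Otherwise
      \<open>k\<close> is at least \<open>3 / 4\<close>, and the trivial bound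
      \<open>m \<le> 2\<close> suffices.\<close>
    have "m \<le> 8 * k"
    proof (cases "r \<ge> 1 / 4")
      case True
      then have "1 / 4 * m \<le> r * m" by (intro mult_right_mono) (auto simp: m_def)
      then show ?thesis using rm by linarith
    next
      case False
      then show ?thesis using m2 k(3) by (simp add: r_def)
    qed
    moreover have "\<bar>norm z - norm u\<bar> \<le> k" using k assms by linarith
    ultimately show ?thesis using False by (simp add: pdist_def m_def k_def \<zeta>_def \<eta>_def)
  qed
qed

lemma cmod_bergman_kernel:
  fixes z :: "complex^'n"
  assumes "norm z < 1" "norm u < 1"
  shows "cmod (bergman_kernel \<gamma> z u) = (1 - (norm z)\<^sup>2) powr ((real CARD('n) + 1 + \<gamma>) / 2)
     / cmod (1 - herm u z) powr (real CARD('n) + 1 + \<gamma>)"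
    and "bergman_kernel \<gamma> z u \<noteq> 0"
proof -
  have nz: "1 - herm u z \<noteq> 0" using cmod_one_minus_herm_ge(3)[OF assms] by simp
  show *: "cmod (bergman_kernel \<gamma> z u) = (1 - (norm z)\<^sup>2) powr ((real CARD('n) + 1 + \<gamma>) / 2)
     / cmod (1 - herm u z) powr (real CARD('n) + 1 + \<gamma>)"
    unfolding bergman_kernel_def norm_divide norm_of_real cmod_powr_of_real[OF nz]
    by (simp only: abs_of_nonneg[OF powr_ge_zero])
  have "1 - (norm z)\<^sup>2 \<noteq> 0" using assms(1) by (simp add: power2_eq_1_iff) (smt (verit) norm_ge_zero)
  then have "cmod (bergman_kernel \<gamma> z u) \<noteq> 0" unfolding * using nz by simp
  then show "bergman_kernel \<gamma> z u \<noteq> 0" by simp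
qed

text \<open>The maximum serves a chain of concentric balls: in the innermost ball the radius
  \<open>r\<close> is compared with the depth of \<open>z\<close>, further out with
  \<open>pdist z u\<close>, which is large because \<open>u\<close> misses the preceding
  ball.\<close>

lemma cmod_bergman_kernel_le:
  fixes z :: "complex^'n"
  assumes z: "norm z < 1" and u: "norm u < 1" and N: "real CARD('n) + 1 + \<gamma> = N" "N > 0"
    and r: "0 < r" "r \<le> c * max (1 - norm z) (pdist z u / 9)" and c: "c > 0"
    and R0: "1 - norm z \<le> R0"
  shows "cmod (bergman_kernel \<gamma> z u) \<le> 2 powr (N / 2) * c powr N * (R0 powr (N / 2) * r powr (- N))"
proof -
  define k where "k = cmod (1 - herm u z)"
  have "max (1 - norm z) (pdist z u / 9) \<le> k"
    using cmod_one_minus_herm_ge[OF z u] by (simp add: k_def)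
  then have "c * max (1 - norm z) (pdist z u / 9) \<le> c * k" using c by (intro mult_left_mono) auto
  with r(2) have "r \<le> c * k" by (rule order_trans)
  then have k: "r / c \<le> k" using c by (simp add: divide_le_eq mult.commute)
  have "1 - (norm z)\<^sup>2 \<le> 2 * (1 - norm z)"
    using zero_le_power2[of "1 - norm z"] by (simp add: power2_eq_square algebra_simps)
  also have "\<dots> \<le> 2 * R0" using R0 by simp
  finally have le: "1 - (norm z)\<^sup>2 \<le> 2 * R0" .
  have "0 \<le> 1 - (norm z)\<^sup>2" using z by (simp add: abs_square_le_1)
  with le have "(1 - (norm z)\<^sup>2) powr (N / 2) \<le> (2 * R0) powr (N / 2)"
    using N by (intro powr_mono2) auto
  moreover have "(r / c) powr N \<le> k powr N" using k r c N by (intro powr_mono2) auto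
  moreover have "(r / c) powr N > 0" using r c by simp
  ultimately have "(1 - (norm z)\<^sup>2) powr (N / 2) / k powr N \<le> (2 * R0) powr (N / 2) / (r / c) powr N"
    by (intro frac_le) auto
  also have "\<dots> = 2 powr (N / 2) * c powr N * (R0 powr (N / 2) * r powr (- N))"
    using r c R0 z by (simp add: powr_mult powr_divide powr_minus field_simps)
  finally show ?thesis unfolding cmod_bergman_kernel(1)[OF z u] N(1) k_def .
qed

text \<open>A ball that meets the sphere has a centre of depth less than \<open>R\<close>, and the
  radial part of the metric changes the depth by less than \<open>R\<close>.\<close>

lemma pball_near:
  assumes z: "norm z < 1" "z \<noteq> 0" and R: "R > 1 - norm z" and u: "u \<in> pball z R" "u \<noteq> 0"
  shows "1 - norm u < 2 * R" "cmod (1 - herm (u /\<^sub>R norm u) (z /\<^sub>R norm z)) < R"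
proof -
  have eq: "cmod (1 - herm (u /\<^sub>R norm u) (z /\<^sub>R norm z)) = cmod (1 - herm (z /\<^sub>R norm z) (u /\<^sub>R norm u))"
    by (rule cmod_one_minus_herm_commute)
  have "\<bar>norm z - norm u\<bar> + cmod (1 - herm (u /\<^sub>R norm u) (z /\<^sub>R norm z)) < R"
    unfolding eq using z u by (simp add: pball_def pdist_def)
  moreover have "0 \<le> cmod (1 - herm (u /\<^sub>R norm u) (z /\<^sub>R norm z))" by simp
  ultimately show "1 - norm u < 2 * R" "cmod (1 - herm (u /\<^sub>R norm u) (z /\<^sub>R norm z)) < R"
    using R by linarith+
qed

text \<open>Radii beyond 1 occur as well; capping them moves the test point to the origin, where the
  kernel is constantly 1, while the estimate still covers the uncapped ball. A centre
  \<open>z0 = 0\<close> forces \<open>R > 1\<close> and also gives \<open>z = 0\<close>.\<close>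

lemma cmod_bergman_kernel_ge:
  fixes z0 :: "complex^'n"
  assumes z0: "norm z0 < 1" and R: "R > 1 - norm z0" and N: "real CARD('n) + 1 + \<gamma> = N" "N > 0"
  defines "R' \<equiv> min R 1"
  defines "z \<equiv> ((1 - R') / norm z0) *\<^sub>R z0"
  shows "norm z < 1"
    and "u \<in> pball z0 R \<Longrightarrow> 4 powr (- N) * R' powr (- N / 2) \<le> cmod (bergman_kernel \<gamma> z u)"
proof -
  have R': "0 < R'" "R' \<le> 1" using z0 R by (auto simp: R'_def)
  have nz: "norm z = 1 - R'"
  proof (cases "z0 = 0")
    case True
    then show ?thesis using R by (simp add: z_def R'_def)
  next
    case False
    then show ?thesis using R' by (simp add: z_def)
  qed
  then show z: "norm z < 1" using R' by simp
  assume u: "u \<in> pball z0 R"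
  have nu: "norm u < 1" using u by (simp add: pball_def)
  \<comment> \<open>In the main case the depth of \<open>u\<close> is below \<open>2 * R\<close>,
    that of \<open>z\<close> equals \<open>R\<close>, and the angular part is below
    \<open>R\<close>.\<close>
  have up: "cmod (1 - herm u z) \<le> 4 * R'"
  proof (cases "z = 0 \<or> u = 0")
    case True
    then have "cmod (1 - herm u z) = 1" by auto
    moreover have "1 \<le> 4 * R'"
    proof (cases "z = 0")
      case True then show ?thesis using nz by simp
    next
      case False
      \<comment> \<open>The origin lies in the ball, so \<open>R\<close> exceeds both
        \<open>norm z0\<close> and \<open>1 - norm z0\<close>, hence \<open>1 / 2\<close>.\<close>
      then have "u = 0" "z0 \<noteq> 0" using True by (auto simp: z_def)
      then have "norm z0 < R" using u by (simp add: pball_def pdist_def)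
      then show ?thesis using R by (auto simp: R'_def)
    qed
    ultimately show ?thesis by simp
  next
    case False
    then have z00: "z0 \<noteq> 0" and "R < 1" using nz R' by (auto simp: z_def R'_def min_def split: if_splits)
    then have R'R: "R' = R" by (simp add: R'_def)
    define \<zeta> \<eta> where "\<zeta> = z0 /\<^sub>R norm z0" and "\<eta> = u /\<^sub>R norm u"
    note near = pball_near[OF z0 z00 R u, folded \<zeta>_def \<eta>_def]
    define r where "r = norm u * norm z"
    have "z = (1 - R') *\<^sub>R \<zeta>" by (simp add: z_def \<zeta>_def divide_inverse)
    then have z': "z = complex_of_real (norm z) *s \<zeta>" unfolding nz by (simp only: scaleR_eq_scale)
    have u': "u = complex_of_real (norm u) *s \<eta>"
      using False by (simp add: \<eta>_def flip: scaleR_eq_scale)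
    have "herm u z = complex_of_real r * herm \<eta> \<zeta>"
      by (subst z', subst u') (simp add: herm_scale_left herm_scale_right r_def mult_ac)
    then have eq: "1 - herm u z = complex_of_real (1 - r) + complex_of_real r * (1 - herm \<eta> \<zeta>)"
      by (simp add: algebra_simps)
    have r: "0 \<le> r" "r \<le> 1" using nu z by (auto simp: r_def intro: mult_le_one)
    have "cmod (1 - herm u z) \<le> cmod (complex_of_real (1 - r)) + cmod (complex_of_real r * (1 - herm \<eta> \<zeta>))"
      unfolding eq by (rule norm_triangle_ineq)
    also have "\<dots> = (1 - r) + r * cmod (1 - herm \<eta> \<zeta>)"
      using r by (simp only: norm_mult norm_of_real abs_of_nonneg diff_ge_0_iff_ge)
    also have "\<dots> \<le> (1 - r) + 1 * R" using r near False by (intro add_left_mono mult_mono) auto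
    also have "1 - r \<le> (1 - norm u) + (1 - norm z)"
    proof -
      have "0 \<le> (1 - norm u) * (1 - norm z)" using nu z by simp
      then show ?thesis by (simp add: r_def algebra_simps)
    qed
    finally show ?thesis using near False nz R'R by simp
  qed
  have pos: "cmod (1 - herm u z) > 0" using cmod_one_minus_herm_ge(3)[OF z nu] by simp
  have "R' * 1 \<le> R' * (2 - R')" using R' by (intro mult_left_mono) auto
  then have "R' \<le> 1 - (norm z)\<^sup>2" by (simp add: nz power2_eq_square algebra_simps)
  then have "R' powr (N / 2) \<le> (1 - (norm z)\<^sup>2) powr (N / 2)" using R' N by (intro powr_mono2) auto
  moreover have "cmod (1 - herm u z) powr N \<le> (4 * R') powr N" using up N by (intro powr_mono2) auto
  ultimately have "R' powr (N / 2) / (4 * R') powr N \<le> (1 - (norm z)\<^sup>2) powr (N / 2) / cmod (1 - herm u z) powr N"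
    using pos by (intro frac_le) auto
  moreover have "R' powr (N / 2) / (4 * R') powr N = 4 powr (- N) * R' powr (- N / 2)"
  proof -
    have "R' powr (N / 2) = R' powr N * R' powr (- N / 2)"
      by (simp flip: powr_add)
    then show ?thesis using R' by (simp add: powr_mult powr_minus field_simps)
  qed
  ultimately show "4 powr (- N) * R' powr (- N / 2) \<le> cmod (bergman_kernel \<gamma> z u)"
    unfolding cmod_bergman_kernel(1)[OF z nu] N(1) by simp
qed

section \<open>Measure of the pseudo-metric balls\<close>

lemma pball_mono: "R \<le> S \<Longrightarrow> pball z R \<subseteq> pball z S"
  by (auto simp: pball_def)

text \<open>For \<open>z \<noteq> 0\<close> the metric is discontinuous at the origin, where the
  direction is undefined; this point is adjoined separately to an open set.\<close>

lemma pball_borel: "pball z R \<in> sets borel"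
proof (cases "z = 0")
  case True
  then have "pball z R = ball 0 1 \<inter> ball 0 R" by (auto simp: pball_def pdist_def)
  then show ?thesis by simp
next
  case False
  define f where "f u = \<bar>norm z - norm u\<bar> + cmod (1 - herm (z /\<^sub>R norm z) (u /\<^sub>R norm u))" for u
  have "open ((ball 0 1 - {0}) \<inter> f -` {..<R})"
    unfolding f_def by (rule continuous_open_preimage) (auto intro!: continuous_intros open_Diff)
  moreover have "pball z R = ((ball 0 1 - {0}) \<inter> f -` {..<R}) \<union> (if norm z < R then {0} else {})"
    using False by (auto simp: pball_def pdist_def f_def)
  ultimately show ?thesis by simp
qed

text \<open>The radial part is below 1 and the angular part at most 2. The radius 3 is where every
  chain of balls stops.\<close>

lemma pball_3: "norm z < 1 \<Longrightarrow> pball z 3 = ball 0 1"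
proof -
  assume z: "norm z < 1"
  have "pdist z u < 3" if "norm u < 1" for u
  proof (cases "z = 0 \<or> u = 0")
    case True
    then show ?thesis using z that by (auto simp: pdist_def)
  next
    case False
    have "cmod (1 - herm (z /\<^sub>R norm z) (u /\<^sub>R norm u)) \<le> 1 + 1"
      using cmod_herm_le[of "z /\<^sub>R norm z" "u /\<^sub>R norm u"] False
        norm_triangle_ineq4[of 1 "herm (z /\<^sub>R norm z) (u /\<^sub>R norm u)"] by simp
    moreover have "\<bar>norm z - norm u\<bar> < 1" using z that norm_ge_zero[of z] norm_ge_zero[of u] by linarith
    ultimately show ?thesis using False by (simp add: pdist_def)
  qed
  then show ?thesis by (auto simp: pball_def)
qed

lemma inner_set_subset_pball:
  fixes z :: "complex^'n"
  assumes z: "norm z < 1" and R: "R > 1 - norm z"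
  obtains \<zeta> :: "complex^'n" where "norm \<zeta> = 1" "inner_set \<zeta> (min R 1) \<subseteq> pball z R"
proof -
  define \<zeta> where "\<zeta> = (if z = 0 then axis undefined 1 else z /\<^sub>R norm z)"
  have \<zeta>: "norm \<zeta> = 1" by (simp add: \<zeta>_def)
  have R': "0 < min R 1" "min R 1 \<le> 1" using R z by auto
  have "u \<in> pball z R" if "u \<in> inner_set \<zeta> (min R 1)" for u
  proof -
    note b = inner_set_bounds[OF \<zeta> R' that]
    have "norm u < 1" "u \<noteq> 0" using b R' by (auto simp: min_def split: if_splits)
    show ?thesis
    proof (cases "z = 0")
      case True
      then show ?thesis using R \<open>norm u < 1\<close> by (simp add: pball_def pdist_def)
    next
      case False
      have eq: "cmod (1 - herm (u /\<^sub>R norm u) (z /\<^sub>R norm z)) = cmod (1 - herm (z /\<^sub>R norm z) (u /\<^sub>R norm u))"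
        by (rule cmod_one_minus_herm_commute)
      \<comment> \<open>With r = \<open>min R 1\<close>, the depth of \<open>u\<close> lies between
        r/4 and r/2 and that of \<open>z\<close> between 0 and r. The remaining r/4 is left for the
        angular part.\<close>
      have "\<bar>norm z - norm u\<bar> \<le> 3 / 4 * min R 1" using b(1,2) R z norm_ge_zero[of z] unfolding min_def 
        by (cases "R \<le> 1"; simp only: if_True if_False; linarith)
      then have "pdist z u < R"
        using b(3) False \<open>u \<noteq> 0\<close> R' by (simp add: pdist_def \<zeta>_def eq) (auto simp: min_def split: if_splits)
      then show ?thesis using \<open>norm u < 1\<close> by (simp add: pball_def)
    qed
  qed
  then show ?thesis using that \<zeta> by blast
qed

text \<open>From below the ball contains an inner set, whose size is capped at 1; for radii up to 3
  this costs \<open>3 powr (- N)\<close>. From above, apart from the origin, it lies in the outer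
  part of a cone of comparable aperture.\<close>

lemma nn_integral_pball_bounds:
  fixes \<gamma> :: real
  assumes \<gamma>: "\<gamma> > -1"
  shows "\<exists>c1>0. \<exists>c2>0. \<forall>(z::complex^'n) R. norm z < 1 \<and> 1 - norm z < R \<and> R \<le> 3 \<longrightarrow>
    ennreal (c1 * R powr (real CARD('n) + 1 + \<gamma>))
      \<le> (\<integral>\<^sup>+u. ennreal ((1 - (norm u)\<^sup>2) powr \<gamma>) * indicator (pball z R) u \<partial>lebesgue) \<and>
    (\<integral>\<^sup>+u. ennreal ((1 - (norm u)\<^sup>2) powr \<gamma>) * indicator (pball z R) u \<partial>lebesgue)
      \<le> ennreal (c2 * R powr (real CARD('n) + 1 + \<gamma>))"
proof -
  define N where "N = real CARD('n) + 1 + \<gamma>"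
  have N: "N > 0" using \<gamma> by (simp add: N_def)
  obtain c where c: "c > 0" and lo: "\<And>(\<zeta>::complex^'n) R. norm \<zeta> = 1 \<Longrightarrow> 0 < R \<Longrightarrow> R \<le> 1 \<Longrightarrow>
     ennreal (c * R powr N) \<le> (\<integral>\<^sup>+u. ennreal ((1 - (norm u)\<^sup>2) powr \<gamma>) * indicator (inner_set \<zeta> R) u \<partial>lebesgue)"
    using nn_integral_inner_set_ge[where \<gamma>=\<gamma> and 'n='n] unfolding N_def by blast
  obtain C where C: "C > 0" and up: "\<And>(\<zeta>::complex^'n) R. norm \<zeta> = 1 \<Longrightarrow> 0 < R \<Longrightarrow>
     (\<integral>\<^sup>+u. ennreal ((1 - (norm u)\<^sup>2) powr \<gamma>) * indicator (ray_cone \<zeta> R \<inter> {u. 1 - norm u < 2 * R}) u \<partial>lebesgue)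
       \<le> ennreal (C * R powr N)"
    using nn_integral_cone_le[OF \<gamma>, where 'n='n] unfolding N_def by blast
  have "ennreal (c * 3 powr (- N) * R powr N)
      \<le> (\<integral>\<^sup>+u. ennreal ((1 - (norm u)\<^sup>2) powr \<gamma>) * indicator (pball z R) u \<partial>lebesgue)"
    and "(\<integral>\<^sup>+u. ennreal ((1 - (norm u)\<^sup>2) powr \<gamma>) * indicator (pball z R) u \<partial>lebesgue)
      \<le> ennreal (C * 3 powr N * R powr N)"
    if z: "norm z < 1" "1 - norm z < R" "R \<le> 3" for z :: "complex^'n" and R
  proof -
    have R: "R > 0" using z by linarith
    obtain \<zeta> :: "complex^'n" where \<zeta>: "norm \<zeta> = 1" "inner_set \<zeta> (min R 1) \<subseteq> pball z R"
      using inner_set_subset_pball[OF z(1,2)] by blast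
    have "3 powr (- N) * R powr N = (R / 3) powr N" using R by (simp add: powr_divide powr_minus field_simps)
    also have "\<dots> \<le> (min R 1) powr N" using R z N by (intro powr_mono2) auto
    finally have "ennreal (c * 3 powr (- N) * R powr N) \<le> ennreal (c * (min R 1) powr N)"
      using c by (intro ennreal_leI) (simp add: mult.assoc)
    also have "\<dots> \<le> (\<integral>\<^sup>+u. ennreal ((1 - (norm u)\<^sup>2) powr \<gamma>) * indicator (inner_set \<zeta> (min R 1)) u \<partial>lebesgue)"
      using \<zeta> R by (intro lo) auto
    also have "\<dots> \<le> (\<integral>\<^sup>+u. ennreal ((1 - (norm u)\<^sup>2) powr \<gamma>) * indicator (pball z R) u \<partial>lebesgue)"
      using \<zeta>(2) by (intro nn_integral_mono mult_left_mono) (auto split: split_indicator)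
    finally show "ennreal (c * 3 powr (- N) * R powr N)
      \<le> (\<integral>\<^sup>+u. ennreal ((1 - (norm u)\<^sup>2) powr \<gamma>) * indicator (pball z R) u \<partial>lebesgue)" .
    obtain \<zeta>' :: "complex^'n" and S where S: "norm \<zeta>' = 1" "S > 0" "S powr N \<le> 3 powr N * R powr N"
      "pball z R - {0} \<subseteq> ray_cone \<zeta>' S \<inter> {u. 1 - norm u < 2 * S}"
    proof (cases "z = 0")
      case True
      \<comment> \<open>Around the origin no direction is distinguished, but there
        \<open>R > 1\<close>. The cone of aperture 3 is the whole punctured ball, and it costs only
        the factor \<open>3 powr N\<close>.\<close>
      have "1 powr N \<le> R powr N" using True z N by (intro powr_mono2) auto
      moreover have "pball z R - {0} \<subseteq> ray_cone \<zeta> 3 \<inter> {u. 1 - norm u < 2 * 3}"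
      proof
        fix u assume u: "u \<in> pball z R - {0}"
        have "cmod (1 - herm (u /\<^sub>R norm u) \<zeta>) \<le> 1 + 1"
          using cmod_herm_le[of "u /\<^sub>R norm u" \<zeta>] norm_triangle_ineq4[of 1 "herm (u /\<^sub>R norm u) \<zeta>"] u \<zeta>
          by simp
        moreover have "norm u < 1" using u by (simp add: pball_def)
        moreover have "1 - norm u < 2 * 3" using norm_ge_zero[of u] by linarith
        ultimately show "u \<in> ray_cone \<zeta> 3 \<inter> {u. 1 - norm u < 2 * 3}"
          using u by (simp add: ray_cone_def)
      qed
      ultimately show ?thesis using that[of \<zeta> 3] \<zeta> by simp
    next
      case False
      have "1 \<le> (3::real) powr N" using N by (simp add: ge_one_powr_ge_zero)
      then have "R powr N \<le> 3 powr N * R powr N" using mult_right_mono[of 1 "3 powr N" "R powr N"] by simp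
      moreover have "pball z R - {0} \<subseteq> ray_cone (z /\<^sub>R norm z) R \<inter> {u. 1 - norm u < 2 * R}"
        using pball_near[OF z(1) False z(2)] by (auto simp: ray_cone_def pball_def)
      ultimately show ?thesis using that[of "z /\<^sub>R norm z" R] False R by simp
    qed
    \<comment> \<open>The origin is not in the cone and is discarded as a null set.\<close>
    have "AE u in lebesgue. u \<noteq> (0 :: complex^'n)"
      using AE_not_in[of "{0}" "lebesgue :: (complex^'n) measure"] by simp
    then have "(\<integral>\<^sup>+u. ennreal ((1 - (norm u)\<^sup>2) powr \<gamma>) * indicator (pball z R) u \<partial>lebesgue)
       \<le> (\<integral>\<^sup>+u. ennreal ((1 - (norm u)\<^sup>2) powr \<gamma>) * indicator (ray_cone \<zeta>' S \<inter> {u. 1 - norm u < 2 * S}) u \<partial>lebesgue)"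
      using S(4) by (intro nn_integral_mono_AE) (elim AE_mp, auto intro!: AE_I2 mult_left_mono split: split_indicator)
    also have "\<dots> \<le> ennreal (C * S powr N)" by (rule up[OF S(1,2)])
    also have "\<dots> \<le> ennreal (C * 3 powr N * R powr N)"
      using S(3) C by (intro ennreal_leI) (simp add: mult.assoc)
    finally show "(\<integral>\<^sup>+u. ennreal ((1 - (norm u)\<^sup>2) powr \<gamma>) * indicator (pball z R) u \<partial>lebesgue)
      \<le> ennreal (C * 3 powr N * R powr N)" .
  qed
  moreover have "c * 3 powr (- N) > 0" "C * 3 powr N > 0" using c C by auto
  ultimately show ?thesis unfolding N_def by blast
qed

section \<open>The normalised weighted measure\<close>

lemma borel_measurable_radial_weight:
  "(\<lambda>u::'a::euclidean_space. (1 - (norm u)\<^sup>2) powr \<gamma>) \<in> borel_measurable (lebesgue_on (ball 0 1))"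
  by (intro measurable_restrict_space1 measurable_completion) simp

text \<open>A nonintegrable density would have integral 0 by convention and normalising constant 1/0
  = 0. The volume bounds for the ball of radius 3, which is everything, give finiteness and
  positivity of the mass.\<close>

lemma norm_const_pos:
  assumes \<gamma>: "\<gamma> > -1"
  shows "norm_const TYPE('n::finite) \<gamma> > 0"
proof -
  let ?g = "\<lambda>u::complex^'n. (1 - (norm u)\<^sup>2) powr \<gamma>"
  obtain c1 c2 where c: "c1 > 0" "c2 > 0" and b: "\<And>(z::complex^'n) R. norm z < 1 \<Longrightarrow> 1 - norm z < R \<Longrightarrow> R \<le> 3 \<Longrightarrow>
    ennreal (c1 * R powr (real CARD('n) + 1 + \<gamma>)) \<le> (\<integral>\<^sup>+u. ennreal (?g u) * indicator (pball z R) u \<partial>lebesgue) \<and>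
    (\<integral>\<^sup>+u. ennreal (?g u) * indicator (pball z R) u \<partial>lebesgue) \<le> ennreal (c2 * R powr (real CARD('n) + 1 + \<gamma>))"
    using nn_integral_pball_bounds[OF \<gamma>, where 'n='n] by blast
  define J where "J = (\<integral>\<^sup>+u. ennreal (?g u) \<partial>lebesgue_on (ball 0 1))"
  have J: "J = (\<integral>\<^sup>+u. ennreal (?g u) * indicator (pball 0 3) u \<partial>lebesgue)"
    unfolding J_def by (subst nn_integral_restrict_space) (auto simp: pball_3)
  have "J \<ge> ennreal (c1 * 3 powr (real CARD('n) + 1 + \<gamma>))" "J \<le> ennreal (c2 * 3 powr (real CARD('n) + 1 + \<gamma>))"
    using b[of 0 3] unfolding J by simp_all
  moreover have "ennreal (c1 * 3 powr (real CARD('n) + 1 + \<gamma>)) > 0" using c by simp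
  ultimately have "0 < J" "J < \<infinity>"
    by (blast intro: less_le_trans) (metis \<open>J \<le> _\<close> ennreal_less_top infinity_ennreal_def le_less_trans)
  moreover have "(LINT u|lebesgue_on (ball 0 1). ?g u) = enn2real J"
    unfolding J_def by (rule integral_eq_nn_integral) (auto intro: borel_measurable_radial_weight)
  ultimately show ?thesis by (simp add: norm_const_def enn2real_positive_iff)
qed

lemma sets_vol [simp]: "sets (vol \<gamma> :: (complex^'n) measure) = sets (lebesgue_on (ball 0 1))"
  by (simp add: vol_def)
lemma space_vol [simp]: "space (vol \<gamma> :: (complex^'n) measure) = ball 0 1"
  by (simp add: vol_def)
lemma measurable_vol: "measurable (vol \<gamma> :: (complex^'n) measure) M = measurable (lebesgue_on (ball 0 1)) M"
  by (rule measurable_cong_sets) simp_all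

lemma sets_vol_borel: "A \<in> sets borel \<Longrightarrow> A \<subseteq> ball 0 1 \<Longrightarrow> A \<in> sets (vol \<gamma>)"
  by (simp add: sets_restrict_space_iff)

lemma pball_sets_vol: "pball z R \<in> sets (vol \<gamma>)"
  by (rule sets_vol_borel[OF pball_borel]) (auto simp: pball_def)

lemma emeasure_vol:
  fixes A :: "(complex^'n) set"
  assumes "A \<in> sets borel" "A \<subseteq> ball 0 1" "\<gamma> > -1"
  shows "emeasure (vol \<gamma>) A = ennreal (norm_const TYPE('n) \<gamma>)
    * (\<integral>\<^sup>+u. ennreal ((1 - (norm u)\<^sup>2) powr \<gamma>) * indicator A u \<partial>lebesgue)"
proof -
  note [measurable] = borel_measurable_radial_weight[of \<gamma>, where 'a="complex^'n"]
  have "emeasure (vol \<gamma>) A = (\<integral>\<^sup>+u. ennreal (norm_const TYPE('n) \<gamma> * (1 - (norm u)\<^sup>2) powr \<gamma>) * indicator A u \<partial>lebesgue_on (ball 0 1))"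
    using sets_vol_borel[OF assms(1,2), of \<gamma>] unfolding vol_def by (subst emeasure_density) auto
  also have "\<dots> = (\<integral>\<^sup>+u. ennreal (norm_const TYPE('n) \<gamma> * (1 - (norm u)\<^sup>2) powr \<gamma>) * indicator A u * indicator (ball 0 1) u \<partial>lebesgue)"
    by (subst nn_integral_restrict_space) auto
  also have "\<dots> = (\<integral>\<^sup>+u. ennreal (norm_const TYPE('n) \<gamma>) * (ennreal ((1 - (norm u)\<^sup>2) powr \<gamma>) * indicator A u) \<partial>lebesgue)"
    using assms(2) norm_const_pos[OF assms(3), where 'n='n]
    by (intro nn_integral_cong) (auto simp: ennreal_mult' split: split_indicator)
  also have "\<dots> = ennreal (norm_const TYPE('n) \<gamma>) * (\<integral>\<^sup>+u. ennreal ((1 - (norm u)\<^sup>2) powr \<gamma>) * indicator A u \<partial>lebesgue)"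
  proof (rule nn_integral_cmult)
    have "(\<lambda>u. ennreal ((1 - (norm u)\<^sup>2) powr \<gamma>) * indicator A u) \<in> borel_measurable borel" using assms(1) by simp
    then show "(\<lambda>u. ennreal ((1 - (norm u)\<^sup>2) powr \<gamma>) * indicator A u) \<in> borel_measurable lebesgue"
      by (intro measurable_completion) simp
  qed
  finally show ?thesis .
qed

lemma emeasure_vol_pball:
  assumes \<gamma>: "\<gamma> > -1" 
  shows "\<exists>c1>0. \<exists>c2>0. \<forall>(z::complex^'n) R. norm z < 1 \<and> 1 - norm z < R \<and> R \<le> 3 \<longrightarrow>
    ennreal (c1 * R powr (real CARD('n) + 1 + \<gamma>)) \<le> emeasure (vol \<gamma>) (pball z R) \<and>
    emeasure (vol \<gamma>) (pball z R) \<le> ennreal (c2 * R powr (real CARD('n) + 1 + \<gamma>))"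
proof -
  let ?g = "\<lambda>u::complex^'n. (1 - (norm u)\<^sup>2) powr \<gamma>"
  define c where "c = norm_const TYPE('n) \<gamma>"
  have c: "c > 0" using norm_const_pos[OF \<gamma>] by (simp add: c_def)
  obtain c1 c2 where cc: "c1 > 0" "c2 > 0" and b: "\<And>(z::complex^'n) R. norm z < 1 \<Longrightarrow> 1 - norm z < R \<Longrightarrow> R \<le> 3 \<Longrightarrow>
    ennreal (c1 * R powr (real CARD('n) + 1 + \<gamma>)) \<le> (\<integral>\<^sup>+u. ennreal (?g u) * indicator (pball z R) u \<partial>lebesgue) \<and>
    (\<integral>\<^sup>+u. ennreal (?g u) * indicator (pball z R) u \<partial>lebesgue) \<le> ennreal (c2 * R powr (real CARD('n) + 1 + \<gamma>))"
    using nn_integral_pball_bounds[OF \<gamma>, where 'n='n] by blast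
  have "ennreal (c * c1 * R powr (real CARD('n) + 1 + \<gamma>)) \<le> emeasure (vol \<gamma>) (pball z R)"
    "emeasure (vol \<gamma>) (pball z R) \<le> ennreal (c * c2 * R powr (real CARD('n) + 1 + \<gamma>))"
    if "norm z < 1" "1 - norm z < R" "R \<le> 3" for z :: "complex^'n" and R
  proof -
    have "emeasure (vol \<gamma>) (pball z R) = ennreal c * (\<integral>\<^sup>+u. ennreal (?g u) * indicator (pball z R) u \<partial>lebesgue)"
      unfolding c_def by (rule emeasure_vol[OF pball_borel _ \<gamma>]) (auto simp: pball_def)
    moreover have "ennreal (c * d * x) = ennreal c * ennreal (d * x)" for d x
      using c by (simp only: mult.assoc) (rule ennreal_mult', simp)
    ultimately show "ennreal (c * c1 * R powr (real CARD('n) + 1 + \<gamma>)) \<le> emeasure (vol \<gamma>) (pball z R)"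
      "emeasure (vol \<gamma>) (pball z R) \<le> ennreal (c * c2 * R powr (real CARD('n) + 1 + \<gamma>))"
      using b[OF that] by (simp_all add: mult_left_mono)
  qed
  moreover have "c * c1 > 0" "c * c2 > 0" using c cc by auto
  ultimately show ?thesis by blast
qed

section \<open>Sums with two-sided geometric decay\<close>

text \<open>After division by the sum both parts lie between 0 and 1, where
  \<open>t \<le> t powr e\<close>.\<close>

lemma powr_add_le_add_powr:
  fixes x y e :: real
  assumes "0 \<le> x" "0 \<le> y" "0 < e" "e \<le> 1"
  shows "(x + y) powr e \<le> x powr e + y powr e"
proof (cases "x + y = 0")
  case False
  define s where "s = x + y"
  have s: "s > 0" using False assms by (simp add: s_def)
  have le: "z / s \<le> (z / s) powr e" if "0 \<le> z" "z \<le> s" for z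
    using powr_mono'[of e 1 "z / s"] that s assms by simp
  have "1 = x / s + y / s" using s by (simp add: s_def flip: add_divide_distrib)
  also have "\<dots> \<le> (x / s) powr e + (y / s) powr e"
    using assms by (intro add_mono le) (auto simp: s_def)
  also have "\<dots> = (x powr e + y powr e) / s powr e"
    using s assms by (simp add: powr_divide add_divide_distrib)
  finally show ?thesis using s by (simp add: s_def field_simps)
qed (use assms in auto)

lemma powr_sum_le_sum_powr:
  fixes f :: "'a \<Rightarrow> real"
  assumes "finite I" "\<And>i. i \<in> I \<Longrightarrow> 0 \<le> f i" "0 < e" "e \<le> 1"
  shows "(\<Sum>i\<in>I. f i) powr e \<le> (\<Sum>i\<in>I. f i powr e)"
  using assms(1,2)
proof (induction I rule: finite_induct)
  case (insert i I)
  have "(\<Sum>i\<in>insert i I. f i) powr e \<le> f i powr e + (\<Sum>i\<in>I. f i) powr e"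
    using insert assms by (simp add: powr_add_le_add_powr sum_nonneg)
  then show ?case using insert by fastforce
qed simp

lemma sum_geometric_shift_le:
  fixes s :: real
  assumes "0 \<le> s" "s < 1"
  shows "(\<Sum>k\<le>K. if j \<le> k then s ^ (k - j) else 0) \<le> 1 / (1 - s)"
proof -
  have "(\<Sum>k\<le>K. if j \<le> k then s ^ (k - j) else 0) = (\<Sum>k\<in>{j..K}. s ^ (k - j))"
    by (intro sum.mono_neutral_cong_right) auto
  also have "\<dots> = (\<Sum>i\<in>(\<lambda>k. k - j) ` {j..K}. s ^ i)"
    by (subst sum.reindex) (auto simp: inj_on_def)
  also have "\<dots> \<le> (\<Sum>i. s ^ i)"
    using assms by (intro sum_le_suminf) (auto simp: summable_geometric)
  finally show ?thesis using assms by (simp add: suminf_geometric)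
qed

lemma sum_triangle_geometric_le:
  fixes x s :: real
  assumes x: "0 \<le> x" "x < 1" and s: "0 \<le> s" "s < 1"
  shows "(\<Sum>j\<le>K. \<Sum>k\<le>K. if j \<le> k then x ^ j * s ^ (k - j) else 0) \<le> 1 / (1 - x) * (1 / (1 - s))"
proof -
  have "(\<Sum>j\<le>K. \<Sum>k\<le>K. if j \<le> k then x ^ j * s ^ (k - j) else 0)
      = (\<Sum>j\<le>K. x ^ j * (\<Sum>k\<le>K. if j \<le> k then s ^ (k - j) else 0))"
    unfolding sum_distrib_left by (intro sum.cong refl) auto
  also have "\<dots> \<le> (\<Sum>j\<le>K. x ^ j * (1 / (1 - s)))"
    using x by (intro sum_mono mult_left_mono sum_geometric_shift_le s) auto
  also have "\<dots> = (\<Sum>j\<le>K. x ^ j) * (1 / (1 - s))" by (simp only: sum_distrib_right)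
  also have "\<dots> \<le> 1 / (1 - x) * (1 / (1 - s))"
    using sum_geometric_shift_le[OF x, where j=0 and K=K] s by (intro mult_right_mono) auto
  finally show ?thesis .
qed

lemma sum_two_sided_geometric_le:
  fixes x s r :: real
  assumes x: "0 \<le> x" "x < 1" and s: "0 \<le> s" "s < 1" and r: "0 \<le> r" "r < 1"
  shows "(\<Sum>k\<le>K. \<Sum>j\<le>K. if j \<le> k then x ^ j * s ^ (k - j) else x ^ k * r ^ (j - k))
    \<le> 1 / (1 - x) * (1 / (1 - s) + 1 / (1 - r))"
proof -
  \<comment> \<open>Both triangles get the diagonal, so that they have the same shape up to
    exchanging the indices.\<close>
  have "(\<Sum>k\<le>K. \<Sum>j\<le>K. if j \<le> k then x ^ j * s ^ (k - j) else x ^ k * r ^ (j - k))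
    \<le> (\<Sum>k\<le>K. \<Sum>j\<le>K. (if j \<le> k then x ^ j * s ^ (k - j) else 0) + (if k \<le> j then x ^ k * r ^ (j - k) else 0))"
    using x r by (intro sum_mono) auto
  also have "\<dots> = (\<Sum>k\<le>K. \<Sum>j\<le>K. if j \<le> k then x ^ j * s ^ (k - j) else 0)
      + (\<Sum>k\<le>K. \<Sum>j\<le>K. if k \<le> j then x ^ k * r ^ (j - k) else 0)"
    by (simp only: sum.distrib)
  also have "(\<Sum>k\<le>K. \<Sum>j\<le>K. if j \<le> k then x ^ j * s ^ (k - j) else 0)
      = (\<Sum>j\<le>K. \<Sum>k\<le>K. if j \<le> k then x ^ j * s ^ (k - j) else 0)"
    by (rule sum.swap)
  finally show ?thesis
    using sum_triangle_geometric_le[OF x s, of K] sum_triangle_geometric_le[OF x r, of K]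
    unfolding distrib_left by linarith
qed

text \<open>Weighted arithmetic-geometric mean of \<open>1 - t\<close> and 1.\<close>

lemma powr_one_minus_le:
  fixes t a :: real
  assumes "0 \<le> t" "t < 1" "0 \<le> a" "a \<le> 1"
  shows "(1 - t) powr a \<le> 1 - a * t"
  using Youngs_inequality_0[of a "1 - a" "1 - t" 1] assms by (simp add: algebra_simps)

text \<open>Hence a geometric series whose ratio is a power of \<open>1 - t\<close> costs only one
  factor \<open>1 / t\<close>; for \<open>t\<close> of order \<open>1 / M\<close> this is a single
  power of \<open>M\<close>.\<close>

lemma inverse_one_minus_powr_le:
  fixes t a :: real
  assumes "0 < t" "t < 1" "0 < a" "a \<le> 1"
  shows "1 / (1 - (1 - t) powr a) \<le> 1 / (a * t)" "(1 - t) powr a < 1"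
proof -
  have "a * t > 0" using assms by simp
  moreover have le: "(1 - t) powr a \<le> 1 - a * t" using powr_one_minus_le assms by simp
  ultimately show "1 / (1 - (1 - t) powr a) \<le> 1 / (a * t)" by (intro frac_le) auto
  show "(1 - t) powr a < 1" using le \<open>a * t > 0\<close> by linarith
qed

lemma conjugate_exponent:
  fixes p q :: real
  assumes "1 < p" "1 / p + 1 / q = 1"
  shows "q > 1" "q * (p - 1) = p" "(p - 1) * (q - 1) = 1" "p * (q - 1) = q"
proof -
  have "q \<noteq> 0" using assms by auto
  with assms have "q + p = p * q" by (simp add: field_simps)
  then show "q * (p - 1) = p" "(p - 1) * (q - 1) = 1" "p * (q - 1) = q" by (simp_all add: algebra_simps)
  then show "q > 1" using assms(1) zero_less_mult_pos[of "p - 1" "q - 1"] by simp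
qed

text \<open>Here \<open>y * g ^ k\<close> stands for R_k^N, and \<open>W k\<close>,
  \<open>S k\<close> for the masses of the weight and its dual on the ball D_k. In a mixed term the
  mass on the smaller ball is moved to the larger one, which produces the geometric factor in |k-j|.
  Both masses then belong to the same ball, the hypothesis on \<open>W k * S k powr (p - 1)\<close>
  cancels the power of the larger radius, and that of the smaller one remains and decays in min k j.
  The constant is fixed before \<open>M\<close>, \<open>y\<close> and \<open>K\<close>.\<close>

lemma dyadic_product_le:
  fixes p q g \<delta>1 \<delta>2 A :: real
  assumes p: "1 < p" and pq: "1 / p + 1 / q = 1" and g: "g > 1" and A: "A > 0"
    and \<delta>: "0 < \<delta>1" "\<delta>1 < 1" "0 < \<delta>2" "\<delta>2 < 1"
  shows "\<exists>C>0. \<forall>(W :: nat \<Rightarrow> real) (S :: nat \<Rightarrow> real) K y M.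
    M \<ge> 1 \<and> y > 0 \<and> (\<forall>k\<le>K. W k > 0 \<and> S k > 0) \<and>
    (\<forall>k\<le>K. W k * S k powr (p - 1) \<le> A * M * (y * g ^ k) powr p) \<and>
    (\<forall>i j. i \<le> j \<and> j \<le> K \<longrightarrow> W i \<le> (1 - \<delta>1 / M) ^ (j - i) * W j) \<and>
    (\<forall>i j. i \<le> j \<and> j \<le> K \<longrightarrow> S i \<le> (1 - \<delta>2 * M powr (1 - q)) ^ (j - i) * S j)
    \<longrightarrow> y powr p * (\<Sum>k\<le>K. (y * g ^ k) powr (- p) * W k)
        * (\<Sum>k\<le>K. (y * g ^ k) powr (- q) * S k) powr (p - 1)
      \<le> C * M powr max (p + 1) (q + 1)"
proof -
  note qp = conjugate_exponent[OF p pq]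
  \<comment> \<open>\<open>t powr e\<close> and \<open>t powr ((p - 1) * e)\<close> are both subadditive in \<open>t\<close>; this choice of \<open>e\<close> gives the
    exponent \<open>max p q\<close> of \<open>M\<close>, even better than the one stated.\<close>
  define e where "e = min 1 (q - 1)"
  have e: "0 < e" "e \<le> 1" using qp by (auto simp: e_def)
  have e': "0 < (p - 1) * e" "(p - 1) * e \<le> 1"
    using e p mult_left_mono[of e "q - 1" "p - 1"] by (auto simp: qp(3)) (simp add: e_def)
  \<comment> \<open>The two geometric series cost the factors \<open>M\<close> and
    \<open>M powr (q - 1)\<close>, and \<open>m\<close> is the larger exponent. Undoing the power
    \<open>e\<close> turns it into \<open>m / e\<close>, and the diagonal estimate adds 1.\<close>
  define m where "m = max 1 (q - 1)"
  have m: "1 + m / e \<le> max (p + 1) (q + 1)"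
  proof (cases "q \<le> 2")
    case True
    then have "m = 1" "e = q - 1" by (auto simp: m_def e_def)
    moreover have "1 / (q - 1) = p - 1" using qp by (simp add: field_simps)
    ultimately show ?thesis by simp
  next
    case False
    then have "m = q - 1" "e = 1" by (auto simp: m_def e_def)
    then show ?thesis by simp
  qed
  define x where "x = g powr (- p * e)"
  have x: "0 < x" "x < 1" using g p e by (auto simp: x_def powr_less_one)
  define D where "D = 1 / (1 - x) * (1 / ((p - 1) * e * \<delta>2) + 1 / (e * \<delta>1))"
  have D: "D > 0"
    unfolding D_def by (intro mult_pos_pos divide_pos_pos add_pos_pos) (use x e p \<delta> in auto)
  define C where "C = A * D powr (1 / e)"
  have "C > 0" using A D by (simp add: C_def)
  moreover have "y powr p * (\<Sum>k\<le>K. (y * g ^ k) powr (- p) * W k)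
        * (\<Sum>k\<le>K. (y * g ^ k) powr (- q) * S k) powr (p - 1)
      \<le> C * M powr max (p + 1) (q + 1)"
    if M: "M \<ge> 1" and y: "y > 0" and W: "\<And>k. k \<le> K \<Longrightarrow> W k > 0" and S: "\<And>k. k \<le> K \<Longrightarrow> S k > 0"
    and WS: "\<And>k. k \<le> K \<Longrightarrow> W k * S k powr (p - 1) \<le> A * M * (y * g ^ k) powr p"
    and Wd: "\<And>i j. i \<le> j \<Longrightarrow> j \<le> K \<Longrightarrow> W i \<le> (1 - \<delta>1 / M) ^ (j - i) * W j"
    and Sd: "\<And>i j. i \<le> j \<Longrightarrow> j \<le> K \<Longrightarrow> S i \<le> (1 - \<delta>2 * M powr (1 - q)) ^ (j - i) * S j"
    for W S :: "nat \<Rightarrow> real" and K and y M :: real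
  proof -
    define z where "z k = y * g ^ k" for k
    have z: "z k > 0" for k using y g by (simp add: z_def)
    define a where "a k = z k powr (- p) * W k" for k
    define b where "b k = z k powr (- q) * S k" for k
    have ab: "a k > 0" "b k > 0" if "k \<le> K" for k using z[of k] W S that by (auto simp: a_def b_def)
    have bp: "b k powr (p - 1) = z k powr (- p) * S k powr (p - 1)" if "k \<le> K" for k
    proof -
      have "b k powr (p - 1) = z k powr (- (q * (p - 1))) * S k powr (p - 1)"
        using S[OF that] by (simp add: b_def powr_mult powr_powr)
      then show ?thesis by (simp only: qp)
    qed
    define t1 t2 where "t1 = \<delta>1 / M" and "t2 = \<delta>2 * M powr (1 - q)"
    have t1: "0 < t1" "t1 < 1" using M \<delta> by (auto simp: t1_def field_simps)
    have "M powr (1 - q) \<le> M powr 0" using M qp by (intro powr_mono) auto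
    then have "\<delta>2 * M powr (1 - q) \<le> \<delta>2" using \<delta> M by simp
    then have "\<delta>2 * M powr (1 - q) < 1" using \<delta> by linarith
    then have t2: "0 < t2" "t2 < 1" using M \<delta> by (auto simp: t2_def)
    define s r where "s = (1 - t2) powr ((p - 1) * e)" and "r = (1 - t1) powr e"
    have s: "0 \<le> s" "s < 1" "1 / (1 - s) \<le> 1 / ((p - 1) * e * t2)"
      unfolding s_def using inverse_one_minus_powr_le[OF t2 e'] by auto
    have r: "0 \<le> r" "r < 1" "1 / (1 - r) \<le> 1 / (e * t1)"
      unfolding r_def using inverse_one_minus_powr_le[OF t1 e] by auto
    have zpe: "z k powr (- p * e) = y powr (- p * e) * x ^ k" for k
    proof -
      have "(g ^ k) powr (- p * e) = x ^ k"
        using g by (simp add: x_def powr_power powr_powr mult.commute flip: powr_realpow)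
      then show ?thesis using y g by (simp add: z_def powr_mult)
    qed
    have lower: "(a k * b j powr (p - 1)) powr e \<le> (A * M) powr e * y powr (- p * e) * (x ^ j * s ^ (k - j))"
      if "j \<le> k" "k \<le> K" for j k
    proof -
      have "S j powr (p - 1) \<le> ((1 - t2) ^ (k - j) * S k) powr (p - 1)"
        using Sd[OF that] S[of j] that p by (intro powr_mono2) (auto simp: t2_def)
      also have "\<dots> = (1 - t2) powr ((p - 1) * real (k - j)) * S k powr (p - 1)"
        using t2 S[OF that(2)] by (simp add: powr_mult powr_powr mult.commute flip: powr_realpow)
      finally have Sj: "S j powr (p - 1) \<le> (1 - t2) powr ((p - 1) * real (k - j)) * S k powr (p - 1)" .
      have "a k * b j powr (p - 1) = (z k powr (- p) * z j powr (- p)) * (W k * S j powr (p - 1))"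
        using that by (simp add: bp a_def)
      also have "\<dots> \<le> (z k powr (- p) * z j powr (- p)) * (W k * ((1 - t2) powr ((p - 1) * real (k - j)) * S k powr (p - 1)))"
        using Sj W[OF that(2)] by (intro mult_left_mono) auto
      also have "\<dots> = (z k powr (- p) * z j powr (- p) * (1 - t2) powr ((p - 1) * real (k - j))) * (W k * S k powr (p - 1))"
        by (simp only: mult_ac)
      also have "\<dots> \<le> (z k powr (- p) * z j powr (- p) * (1 - t2) powr ((p - 1) * real (k - j))) * (A * M * z k powr p)"
        using WS[OF that(2)] by (intro mult_left_mono) (auto simp: z_def)
      also have "\<dots> = A * M * (z j powr (- p) * (1 - t2) powr ((p - 1) * real (k - j)))"
        using z[of k] by (simp add: powr_minus)
      finally have "(a k * b j powr (p - 1)) powr e \<le> (A * M * (z j powr (- p) * (1 - t2) powr ((p - 1) * real (k - j)))) powr e"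
        using e ab[of k] that by (intro powr_mono2) auto
      also have "\<dots> = (A * M) powr e * (z j powr (- p * e) * (1 - t2) powr ((p - 1) * real (k - j) * e))"
        using A M by (simp add: powr_mult powr_powr)
      also have "(1 - t2) powr ((p - 1) * real (k - j) * e) = s ^ (k - j)"
      proof -
        have "(1 - t2) powr ((p - 1) * real (k - j) * e) = ((1 - t2) powr ((p - 1) * e)) powr real (k - j)"
          unfolding powr_powr by (simp only: mult_ac)
        then show ?thesis using t2 by (simp add: s_def powr_realpow)
      qed
      finally show ?thesis unfolding zpe by (simp only: mult_ac)
    qed
    have upper: "(a k * b j powr (p - 1)) powr e \<le> (A * M) powr e * y powr (- p * e) * (x ^ k * r ^ (j - k))"
      if "k \<le> j" "j \<le> K" for j k
    proof -
      have Wk: "W k \<le> (1 - t1) ^ (j - k) * W j" using Wd[OF that] by (simp add: t1_def)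
      have "a k * b j powr (p - 1) = (z k powr (- p) * z j powr (- p) * S j powr (p - 1)) * W k"
        using that by (simp add: bp a_def)
      also have "\<dots> \<le> (z k powr (- p) * z j powr (- p) * S j powr (p - 1)) * ((1 - t1) ^ (j - k) * W j)"
        using Wk by (intro mult_left_mono) auto
      also have "\<dots> = (z k powr (- p) * z j powr (- p) * (1 - t1) ^ (j - k)) * (W j * S j powr (p - 1))"
        by (simp only: mult_ac)
      also have "\<dots> \<le> (z k powr (- p) * z j powr (- p) * (1 - t1) ^ (j - k)) * (A * M * z j powr p)"
        using WS[OF that(2)] t1 by (intro mult_left_mono) (auto simp: z_def)
      also have "\<dots> = A * M * (z k powr (- p) * (1 - t1) ^ (j - k))"
        using z[of j] by (simp add: powr_minus)
      finally have "(a k * b j powr (p - 1)) powr e \<le> (A * M * (z k powr (- p) * (1 - t1) ^ (j - k))) powr e"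
        using e ab[of k] that by (intro powr_mono2) auto
      also have "\<dots> = (A * M) powr e * (z k powr (- p * e) * ((1 - t1) ^ (j - k)) powr e)"
        using A M t1 by (simp add: powr_mult powr_powr)
      also have "((1 - t1) ^ (j - k)) powr e = r ^ (j - k)"
        using t1 by (simp add: r_def powr_powr mult.commute flip: powr_realpow)
      finally show ?thesis unfolding zpe by (simp only: mult_ac)
    qed
    define X where "X = (\<Sum>k\<le>K. a k) * (\<Sum>k\<le>K. b k) powr (p - 1)"
    have X: "X \<ge> 0"
      unfolding X_def by (intro mult_nonneg_nonneg sum_nonneg) (use ab in \<open>auto intro: less_imp_le\<close>)
    have Mm: "M powr (q - 1) \<le> M powr m" "M \<le> M powr m"
      using M powr_mono[of "q - 1" m M] powr_mono[of 1 m M] by (auto simp: m_def)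
    \<comment> \<open>Both outer exponents are at most 1, so they pass inside the sums, and the
      product becomes a double sum over the pairs estimated in \<open>lower\<close> and
      \<open>upper\<close>.\<close>
    have "X powr e = (\<Sum>k\<le>K. a k) powr e * (\<Sum>k\<le>K. b k) powr ((p - 1) * e)"
      using ab by (simp add: X_def powr_mult powr_powr sum_nonneg less_imp_le)
    also have "\<dots> \<le> (\<Sum>k\<le>K. a k powr e) * (\<Sum>k\<le>K. b k powr ((p - 1) * e))"
      using ab e e' by (intro mult_mono powr_sum_le_sum_powr sum_nonneg) (auto intro: less_imp_le)
    also have "\<dots> = (\<Sum>k\<le>K. \<Sum>j\<le>K. (a k * b j powr (p - 1)) powr e)"
      unfolding sum_product using ab by (intro sum.cong refl) (simp add: powr_mult powr_powr less_imp_le)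
    also have "\<dots> \<le> (\<Sum>k\<le>K. \<Sum>j\<le>K. (A * M) powr e * y powr (- p * e) *
        (if j \<le> k then x ^ j * s ^ (k - j) else x ^ k * r ^ (j - k)))"
      using lower upper by (intro sum_mono) auto
    also have "\<dots> = (A * M) powr e * y powr (- p * e) *
        (\<Sum>k\<le>K. \<Sum>j\<le>K. if j \<le> k then x ^ j * s ^ (k - j) else x ^ k * r ^ (j - k))"
      by (simp only: sum_distrib_left)
    also have "\<dots> \<le> (A * M) powr e * y powr (- p * e) * (1 / (1 - x) * (1 / (1 - s) + 1 / (1 - r)))"
      using x s r by (intro mult_left_mono sum_two_sided_geometric_le) auto
    also have "\<dots> \<le> (A * M) powr e * y powr (- p * e) * (D * M powr m)"
    proof (rule mult_left_mono)
      have "1 / (1 - s) \<le> 1 / ((p - 1) * e * \<delta>2) * M powr (q - 1)"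
        using s(3) M unfolding t2_def by (simp add: powr_diff field_simps)
      also have "\<dots> \<le> 1 / ((p - 1) * e * \<delta>2) * M powr m"
        using Mm(1) p e \<delta> by (intro mult_left_mono) auto
      finally have 1: "1 / (1 - s) \<le> 1 / ((p - 1) * e * \<delta>2) * M powr m" .
      have "1 / (1 - r) \<le> 1 / (e * \<delta>1) * M"
        using r(3) M unfolding t1_def by (simp add: field_simps)
      also have "\<dots> \<le> 1 / (e * \<delta>1) * M powr m"
        using Mm(2) p e \<delta> by (intro mult_left_mono) auto
      finally have "1 / (1 - s) + 1 / (1 - r) \<le> (1 / ((p - 1) * e * \<delta>2) + 1 / (e * \<delta>1)) * M powr m"
        using 1 unfolding distrib_right by linarith
      then have "1 / (1 - x) * (1 / (1 - s) + 1 / (1 - r)) \<le> 1 / (1 - x) * ((1 / ((p - 1) * e * \<delta>2) + 1 / (e * \<delta>1)) * M powr m)"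
        using x by (intro mult_left_mono) auto
      then show "1 / (1 - x) * (1 / (1 - s) + 1 / (1 - r)) \<le> D * M powr m"
        unfolding D_def by (simp only: mult.assoc)
    qed simp
    finally have "(X powr e) powr (1 / e) \<le> ((A * M) powr e * y powr (- p * e) * (D * M powr m)) powr (1 / e)"
      using e by (intro powr_mono2) auto
    also have "\<dots> = A * M * y powr (- p) * (D powr (1 / e) * M powr (m / e))"
      using A M D e y by (simp add: powr_mult powr_powr)
    also have "(X powr e) powr (1 / e) = X" using X e by (simp add: powr_powr)
    finally have "y powr p * X \<le> y powr p * (A * M * y powr (- p) * (D powr (1 / e) * M powr (m / e)))"
      by (intro mult_left_mono) auto
    also have "\<dots> = C * M powr (1 + m / e)"
      using y M by (simp add: C_def powr_minus powr_add)
    also have "\<dots> \<le> C * M powr max (p + 1) (q + 1)"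
      using m M \<open>C > 0\<close> by (intro mult_left_mono powr_mono) auto
    finally show ?thesis by (simp add: X_def a_def b_def z_def mult.assoc)
  qed
  ultimately show ?thesis by (intro exI[of _ C]) auto
qed

section \<open>Reverse doubling\<close>

lemma epowr_ennreal: "0 \<le> x \<Longrightarrow> epowr (ennreal x) r = ennreal (x powr r)"
  by (simp add: epowr_def)

lemma epowr_mono:
  assumes "x \<le> y" "0 \<le> r"
  shows "epowr x r \<le> epowr y r"
proof (cases "y = \<infinity>")
  case False
  then have "x < \<infinity>" "y < \<infinity>" using assms(1) by (auto simp: less_top top_unique)
  then show ?thesis using assms by (auto simp: epowr_def intro!: ennreal_leI powr_mono2 enn2real_mono)
qed (simp add: epowr_def)

lemma epowr_cmult:
  assumes "0 < c"
  shows "epowr (ennreal c * x) r = ennreal (c powr r) * epowr x r"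
proof (cases "x = \<infinity>")
  case True
  then show ?thesis using assms by (simp add: epowr_def ennreal_mult_top)
next
  case False
  then obtain y where y: "x = ennreal y" "0 \<le> y" by (cases x) auto
  then have "ennreal c * x = ennreal (c * y)" using assms by (simp add: ennreal_mult)
  then have "epowr (ennreal c * x) r = ennreal ((c * y) powr r)" using assms y by (simp add: epowr_ennreal)
  also have "\<dots> = ennreal (c powr r) * ennreal (y powr r)" using assms y by (simp add: powr_mult ennreal_mult)
  finally show ?thesis using y by (simp add: epowr_ennreal)
qed

lemma epowr_pos: "x > 0 \<Longrightarrow> epowr x r > 0"
  by (cases x) (auto simp: epowr_def ennreal_less_zero_iff)

text \<open>Hoelder's inequality for \<open>1 = w powr (1 / p) * w powr (- 1 / p)\<close>, where the
  second factor is the power \<open>1 / q\<close> of the dual weight. It is obtained by integrating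
  Young's inequality for rescaled weights.\<close>

lemma holder_dual_weight:
  fixes p q :: real
  assumes p: "1 < p" and pq: "1 / p + 1 / q = 1"
    and w[measurable]: "w \<in> borel_measurable M" and pos: "AE u in M. 0 < w u" and E[measurable]: "E \<in> sets M"
    and W: "(\<integral>\<^sup>+u\<in>E. ennreal (w u) \<partial>M) = ennreal W" "W > 0"
    and S: "(\<integral>\<^sup>+u\<in>E. ennreal (w u powr (- 1 / (p - 1))) \<partial>M) = ennreal S" "S > 0"
    and V: "emeasure M E = ennreal V" "V \<ge> 0"
  shows "V powr p \<le> W * S powr (p - 1)"
proof -
  note qp = conjugate_exponent(2)[OF p pq]
  have q: "q > 0" using conjugate_exponent(1)[OF p pq] by simp
  \<comment> \<open>The scalings keep the product in Young's inequality equal to 1 and balance the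
    two integrals: \<open>t * W\<close> and \<open>t' * S\<close> are both
    \<open>W powr (1 / p) * S powr (1 / q)\<close>.\<close>
  define t where "t = (S / W) powr (1 / q)"
  define t' where "t' = (S / W) powr (- 1 / p)"
  have t: "t > 0" "t' > 0" using W S by (simp_all add: t_def t'_def)
  have tt: "t powr (1 / p) * t' powr (1 / q) = 1"
    using W S by (simp add: t_def t'_def powr_powr flip: powr_add)
  define \<sigma> where "\<sigma> u = w u powr (- 1 / (p - 1))" for u
  have [measurable]: "\<sigma> \<in> borel_measurable M" unfolding \<sigma>_def by measurable
  have pt: "1 \<le> t / p * w u + t' / q * \<sigma> u" if "0 < w u" for u
  proof -
    have "(t * w u) powr (1 / p) * (t' * \<sigma> u) powr (1 / q) \<le> 1 / p * (t * w u) + 1 / q * (t' * \<sigma> u)"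
      using p q pq that t by (intro Youngs_inequality_0) (auto simp: \<sigma>_def)
    moreover have "(t * w u) powr (1 / p) * (t' * \<sigma> u) powr (1 / q) = (t powr (1 / p) * t' powr (1 / q)) * (w u powr (1 / p) * \<sigma> u powr (1 / q))"
      using that t by (simp add: powr_mult \<sigma>_def)
    moreover have "w u powr (1 / p) * \<sigma> u powr (1 / q) = 1"
    proof -
      have "(- 1 / (p - 1)) * (1 / q) = - (1 / p)" using qp p q by (simp add: field_simps)
      then show ?thesis using that unfolding \<sigma>_def powr_powr by (simp flip: powr_add)
    qed
    ultimately show ?thesis by (simp add: tt)
  qed
  have lin: "ennreal (a * x + b * y) = ennreal a * ennreal x + ennreal b * ennreal y"
    if "0 \<le> a" "0 \<le> b" "0 \<le> x" "0 \<le> y" for a b x y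
    using that by (simp add: ennreal_mult)
  have "ennreal V = (\<integral>\<^sup>+u. indicator E u \<partial>M)" using V(1) by simp
  also have "\<dots> \<le> (\<integral>\<^sup>+u. ennreal (t / p) * (ennreal (w u) * indicator E u) + ennreal (t' / q) * (ennreal (\<sigma> u) * indicator E u) \<partial>M)"
  proof (rule nn_integral_mono_AE, use pos in eventually_elim)
    case (elim u)
    have "ennreal 1 \<le> ennreal (t / p * w u + t' / q * \<sigma> u)" using pt[OF elim] by (rule ennreal_leI)
    also have "\<dots> = ennreal (t / p) * ennreal (w u) + ennreal (t' / q) * ennreal (\<sigma> u)"
      using elim t p q by (intro lin) (auto simp: \<sigma>_def)
    finally show ?case by (auto split: split_indicator)
  qed
  also have "\<dots> = ennreal (t / p) * ennreal W + ennreal (t' / q) * ennreal S"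
    using W(1) S(1) by (subst nn_integral_add) (auto simp: nn_integral_cmult \<sigma>_def)
  also have "\<dots> = ennreal (t / p * W + t' / q * S)"
    using t p q W S by (intro lin[symmetric]) auto
  finally have "ennreal V \<le> ennreal (t / p * W + t' / q * S)" .
  moreover have "0 \<le> t / p * W + t' / q * S" using t p q W S by simp
  ultimately have "V \<le> t / p * W + t' / q * S" by (simp only: ennreal_le_iff)
  also have "t * W = W powr (1 / p) * S powr (1 / q)"
  proof -
    have "W = W powr (1 / p + 1 / q)" using pq W by simp
    also have "\<dots> = W powr (1 / p) * W powr (1 / q)" by (rule powr_add)
    finally show ?thesis using W S by (simp add: t_def powr_divide field_simps)
  qed
  then have "t / p * W = 1 / p * (W powr (1 / p) * S powr (1 / q))" by (metis times_divide_eq_left mult_1)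
  also have "t' * S = W powr (1 / p) * S powr (1 / q)"
  proof -
    have "S = S powr (1 / p + 1 / q)" using pq S by simp
    also have "\<dots> = S powr (1 / p) * S powr (1 / q)" by (rule powr_add)
    finally show ?thesis using W S by (simp add: t'_def powr_divide powr_minus field_simps)
  qed
  then have "t' / q * S = 1 / q * (W powr (1 / p) * S powr (1 / q))" by (metis times_divide_eq_left mult_1)
  finally have "V \<le> (1 / p + 1 / q) * (W powr (1 / p) * S powr (1 / q))" by (simp only: distrib_right)
  then have le: "V \<le> W powr (1 / p) * S powr (1 / q)" by (simp add: pq)
  show ?thesis
  proof (cases "V > 0")
    case True
    then have "V powr p \<le> (W powr (1 / p) * S powr (1 / q)) powr p" using le p by (intro powr_mono2) auto
    also have "\<dots> = W * S powr (p / q)" using W S p by (simp add: powr_mult powr_powr)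
    also have "p / q = p - 1" using qp q by (simp add: field_simps)
    finally show ?thesis .
  next
    case False
    then show ?thesis using V(2) W by simp
  qed
qed

lemma nn_integral_set_pos:
  assumes f[measurable]: "f \<in> borel_measurable M" and "AE u in M. 0 < f u" and E[measurable]: "E \<in> sets M" and "emeasure M E > 0"
  shows "(\<integral>\<^sup>+u\<in>E. ennreal (f u) \<partial>M) > 0"
proof (rule ccontr)
  assume "\<not> ?thesis"
  then have "(\<integral>\<^sup>+u\<in>E. ennreal (f u) \<partial>M) = 0" by simp
  then have "AE u in M. ennreal (f u) * indicator E u = 0"
    by (subst (asm) nn_integral_0_iff_AE) auto
  with assms(2) have "AE u in M. u \<notin> E"
    by eventually_elim (auto split: split_indicator_asm)
  then have "emeasure M E = 0" using AE_iff_measurable[OF E, of "\<lambda>u. u \<notin> E"] sets.sets_into_space[OF E] by auto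
  then show False using assms(4) by simp
qed

lemma weightD:
  assumes "weight w"
  shows "w \<in> borel_measurable (vol \<gamma>)" "AE u in vol \<gamma>. 0 < w u"
proof -
  show "w \<in> borel_measurable (vol \<gamma>)" using assms by (simp add: weight_def measurable_vol)
  have "AE u in lebesgue_on (ball 0 1). 0 < w u" using assms by (simp add: weight_def)
  then show "AE u in vol \<gamma>. 0 < w u"
    unfolding vol_def using borel_measurable_radial_weight[of \<gamma>, where 'a="complex^'a"]
    by (subst AE_density) (auto elim: AE_mp)
qed

lemma dual_weightD:
  assumes "weight w"
  shows "(\<lambda>u. w u powr a) \<in> borel_measurable (vol \<gamma>)" "AE u in vol \<gamma>. 0 < w u powr a"
  using weightD[OF assms, of \<gamma>] by (auto elim: AE_mp)

text \<open>\<open>V\<close>, \<open>W\<close>, \<open>S\<close> belong to the outer ball and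
  \<open>VE\<close>, \<open>WE\<close>, \<open>SE\<close> to the set between the balls. Comparing
  the norm condition outside with Hoelder's inequality on the difference gives \<open>W * S powr (p
  - 1) \<le> M * 2 powr p * (WE * SE powr (p - 1))\<close>. Enlarging \<open>SE\<close> to
  \<open>S\<close> isolates the weight; enlarging \<open>WE\<close> to \<open>W\<close> isolates the
  dual weight, where the power \<open>q - 1\<close> needed to remove \<open>p - 1\<close> also falls
  on \<open>M\<close>.\<close>

lemma reverse_doubling_step:
  fixes p q :: real
  assumes p: "1 < p" and pq: "1 / p + 1 / q = 1" and M: "M > 0"
    and D: "V > 0" "W > 0" "S > 0" "W * S powr (p - 1) \<le> M * V powr p"
    and E: "V / 2 \<le> VE" "0 < WE" "WE \<le> W" "0 < SE" "SE \<le> S" "VE powr p \<le> WE * SE powr (p - 1)"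
  shows "W - WE \<le> (1 - 2 powr (- p) / M) * W" "S - SE \<le> (1 - 2 powr (- q) * M powr (1 - q)) * S"
proof -
  note qp = conjugate_exponent[OF p pq]
  have q1: "q - 1 > 0" using qp by simp
  have "(V / 2) powr p \<le> VE powr p" using D E p by (intro powr_mono2) auto
  then have "V powr p \<le> 2 powr p * VE powr p" using D by (simp add: powr_divide field_simps)
  also have "\<dots> \<le> 2 powr p * (WE * SE powr (p - 1))" using E(6) by (intro mult_left_mono) auto
  finally have "V powr p \<le> 2 powr p * (WE * SE powr (p - 1))" .
  then have "M * V powr p \<le> M * (2 powr p * (WE * SE powr (p - 1)))" using M by (intro mult_left_mono) auto
  then have main: "W * S powr (p - 1) \<le> M * 2 powr p * (WE * SE powr (p - 1))" using D(4) by (simp add: mult.assoc)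
  have "WE * SE powr (p - 1) \<le> WE * S powr (p - 1)" using E p by (intro mult_left_mono powr_mono2) auto
  then have "M * 2 powr p * (WE * SE powr (p - 1)) \<le> M * 2 powr p * (WE * S powr (p - 1))" by (rule mult_left_mono) (use M in simp)
  then have "W * S powr (p - 1) \<le> (M * 2 powr p * WE) * S powr (p - 1)" using main by (simp add: mult_ac)
  then have "W \<le> M * 2 powr p * WE" using D by simp
  then have "2 powr (- p) / M * W \<le> WE" using M by (simp add: powr_minus field_simps)
  then show "W - WE \<le> (1 - 2 powr (- p) / M) * W" by (simp add: algebra_simps)
  have "WE * SE powr (p - 1) \<le> W * SE powr (p - 1)" using E by (intro mult_right_mono) auto
  then have "M * 2 powr p * (WE * SE powr (p - 1)) \<le> M * 2 powr p * (W * SE powr (p - 1))" by (rule mult_left_mono) (use M in simp)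
  then have "W * S powr (p - 1) \<le> W * (M * 2 powr p * SE powr (p - 1))" using main by (simp add: mult_ac)
  then have "S powr (p - 1) \<le> M * 2 powr p * SE powr (p - 1)" using D by simp
  then have "(S powr (p - 1)) powr (q - 1) \<le> (M * 2 powr p * SE powr (p - 1)) powr (q - 1)"
    using q1 by (intro powr_mono2) auto
  then have "S \<le> M powr (q - 1) * 2 powr q * SE"
    using D E M qp by (simp add: powr_mult powr_powr)
  then have "2 powr (- q) * M powr (1 - q) * S \<le> SE"
    using M by (simp add: powr_minus powr_diff field_simps)
  then show "S - SE \<le> (1 - 2 powr (- q) * M powr (1 - q)) * S" by (simp add: algebra_simps)
qed

lemma geometric_decay:
  fixes f :: "nat \<Rightarrow> real"
  assumes "\<And>k. k < K \<Longrightarrow> f k \<le> r * f (Suc k)" "0 \<le> r" "i \<le> j" "j \<le> K"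
  shows "f i \<le> r ^ (j - i) * f j"
  using assms(3,4)
proof (induction j rule: dec_induct)
  case (step j)
  then have "f i \<le> r ^ (j - i) * f j" by simp
  also have "\<dots> \<le> r ^ (j - i) * (r * f (Suc j))" using step assms by (intro mult_left_mono) auto
  finally show ?case using step by (simp add: Suc_diff_le mult_ac)
qed simp

text \<open>Both averages are positive, so a finite product forces each of them to be finite and the
  condition becomes one between real numbers. The reverse inequality is Hoelder's on the same ball;
  together they show that the norm is at least 1.\<close>

lemma bb_norm_pball:
  fixes w :: "complex^'n \<Rightarrow> real"
  assumes p: "1 < p" and pq: "1 / p + 1 / q = 1" and w: "weight w"
    and M: "bb_norm p \<gamma> w \<le> ennreal M" "M \<ge> 0"
    and z: "norm z < 1" "1 - norm z < R" and V: "emeasure (vol \<gamma>) (pball z R) = ennreal V" "V > 0"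
  obtains W S where "W > 0" "S > 0" "(\<integral>\<^sup>+u\<in>pball z R. ennreal (w u) \<partial>vol \<gamma>) = ennreal W"
    "(\<integral>\<^sup>+u\<in>pball z R. ennreal (w u powr (- 1 / (p - 1))) \<partial>vol \<gamma>) = ennreal S"
    "W * S powr (p - 1) \<le> M * V powr p" "V powr p \<le> W * S powr (p - 1)"
proof -
  define I where "I = (\<integral>\<^sup>+u\<in>pball z R. ennreal (w u) \<partial>vol \<gamma>)"
  define J where "J = (\<integral>\<^sup>+u\<in>pball z R. ennreal (w u powr (- 1 / (p - 1))) \<partial>vol \<gamma>)"
  have pos: "I > 0" "J > 0"
    unfolding I_def J_def using V
    by (auto intro!: nn_integral_set_pos weightD[OF w] dual_weightD[OF w] pball_sets_vol)
  have "avg \<gamma> (pball z R) w * epowr (avg \<gamma> (pball z R) (\<lambda>u. w u powr (- 1 / (p - 1)))) (p - 1) \<le> bb_norm p \<gamma> w"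
    unfolding bb_norm_def using z by (intro SUP_upper2[of "(z, R)"]) auto
  then have le: "(I / ennreal V) * epowr (J / ennreal V) (p - 1) \<le> ennreal M"
    using M(1) by (simp add: avg_def I_def J_def V)
  have "I / ennreal V > 0" "J / ennreal V > 0"
    using pos by (simp_all add: zero_less_iff_neq_zero ennreal_divide_eq_0_iff)
  then have posV: "I / ennreal V > 0" "epowr (J / ennreal V) (p - 1) > 0" by (simp_all add: epowr_pos)
  have "I \<noteq> \<infinity>"
  proof
    assume "I = \<infinity>"
    then have "I / ennreal V = top" using V by (simp add: ennreal_top_divide)
    then show False using le posV(2) by (simp add: ennreal_top_mult top_unique split: if_splits)
  qed
  moreover have "J \<noteq> \<infinity>"
  proof
    assume "J = \<infinity>"
    then have "epowr (J / ennreal V) (p - 1) = top" using V by (simp add: ennreal_top_divide epowr_def)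
    then show False using le posV(1) by (simp add: ennreal_mult_top top_unique split: if_splits)
  qed
  ultimately obtain W S where WS: "I = ennreal W" "J = ennreal S" "W > 0" "S > 0"
    using pos by (cases I; cases J) auto
  have "ennreal (W / V * (S / V) powr (p - 1)) = ennreal (W / V) * ennreal ((S / V) powr (p - 1))"
    by (rule ennreal_mult) (use WS V in auto)
  also have "\<dots> = (I / ennreal V) * epowr (J / ennreal V) (p - 1)"
    using WS V by (simp add: divide_ennreal epowr_ennreal)
  finally have "ennreal (W / V * (S / V) powr (p - 1)) \<le> ennreal M" using le by simp
  then have "W / V * (S / V) powr (p - 1) \<le> M" using M by simp
  moreover have "W / V * (S / V) powr (p - 1) = W * S powr (p - 1) / V powr p"
  proof -
    have "V powr p = V * V powr (p - 1)" using V by (simp add: powr_diff)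
    then show ?thesis using WS V by (simp add: powr_divide)
  qed
  ultimately have "W * S powr (p - 1) / V powr p \<le> M" by (simp only:)
  then have "W * S powr (p - 1) \<le> M * V powr p" using V by (simp add: pos_divide_le_eq)
  moreover have "V powr p \<le> W * S powr (p - 1)"
    using WS V by (intro holder_dual_weight[OF p pq weightD[OF w] pball_sets_vol]) (auto simp: I_def J_def)
  ultimately show ?thesis using that WS by (simp add: I_def J_def)
qed

text \<open>The kernel has no zeros, so a negative \<open>s - 2\<close> does no harm, and the
  argument of a complex number does not enter the modulus of its real powers.\<close>

lemma norm_bergman_kernel_power:
  assumes "norm z < 1" "norm u < 1"
  shows "cmod (bergman_kernel \<gamma> z u powr complex_of_real (s - 2)) * (cmod (bergman_kernel \<gamma> z u))\<^sup>2
    = cmod (bergman_kernel \<gamma> z u) powr s"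
  using cmod_bergman_kernel(2)[OF assms]
  by (simp add: cmod_powr_of_real powr_diff field_simps del: of_real_diff)

lemma berezin_power_eq:
  "berezin \<gamma> (\<lambda>u. f u * cmod (bergman_kernel \<gamma> z u powr complex_of_real (s - 2))) z
    = (\<integral>\<^sup>+u. ennreal (f u * cmod (bergman_kernel \<gamma> z u) powr s) \<partial>vol \<gamma>)" if "norm z < 1"
  unfolding berezin_def
  by (intro nn_integral_cong) (use that in \<open>simp add: mult.assoc norm_bergman_kernel_power del: of_real_diff\<close>)

section \<open>Comparison of the norms\<close>

lemma nn_integral_kernel_le_sum:
  fixes z :: "complex^'n" and f :: "complex^'n \<Rightarrow> real"
  assumes z: "norm z < 1" and N: "real CARD('n) + 1 + \<gamma> = N" "N > 0" and s: "s > 0"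
    and \<tau>: "\<tau> > 1" and R0: "1 - norm z < R0" "R0 \<le> \<tau> * (1 - norm z)" "R0 * \<tau> ^ K = 3"
    and f: "f \<in> borel_measurable (vol \<gamma>)"
    and I: "\<And>k. k \<le> K \<Longrightarrow> (\<integral>\<^sup>+u\<in>pball z (R0 * \<tau> ^ k). ennreal (f u) \<partial>vol \<gamma>) = ennreal (W k)" "\<And>k. k \<le> K \<Longrightarrow> W k \<ge> 0"
  shows "(\<integral>\<^sup>+u. ennreal (f u * cmod (bergman_kernel \<gamma> z u) powr s) \<partial>vol \<gamma>)
     \<le> ennreal ((2 powr (N / 2) * (9 * \<tau>) powr N) powr s * R0 powr (N * s / 2) * (\<Sum>k\<le>K. (R0 * \<tau> ^ k) powr (- N * s) * W k))"
proof -
  note f[measurable]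
  define G where "G = 2 powr (N / 2) * (9 * \<tau>) powr N"
  define R where "R k = R0 * \<tau> ^ k" for k
  have R0': "R0 > 0" using R0 z by linarith
  have R: "R k > 0" for k using R0' \<tau> by (simp add: R_def)
  define c where "c k = G powr s * R0 powr (N * s / 2) * R k powr (- N * s)" for k
  have c: "c k \<ge> 0" for k by (simp add: c_def)
  \<comment> \<open>Each point is charged to the first ball that contains it: missing the preceding
    one gives \<open>pdist z u \<ge> R k / \<tau>\<close>, and in the innermost ball
    \<open>1 - norm z \<ge> R0 / \<tau>\<close> takes over. Summing over full balls instead of the
    differences only enlarges the bound.\<close>
  have pt: "\<exists>k\<le>K. u \<in> pball z (R k) \<and> cmod (bergman_kernel \<gamma> z u) powr s \<le> c k" if u: "norm u < 1" for u
  proof -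
    have "u \<in> pball z (R K)" using pball_3[OF z] u R0(3) by (simp add: R_def)
    then have ex: "\<exists>k. u \<in> pball z (R k)" by blast
    define k where "k = (LEAST k. u \<in> pball z (R k))"
    have k: "u \<in> pball z (R k)" unfolding k_def using ex by (rule LeastI_ex)
    have "k \<le> K" unfolding k_def by (rule Least_le) fact
    have "R k \<le> 9 * \<tau> * max (1 - norm z) (pdist z u / 9)"
    proof (cases k)
      case 0
      have "\<tau> * (1 - norm z) \<le> 9 * \<tau> * (1 - norm z)" using \<tau> z by simp
      then have "R k \<le> 9 * \<tau> * (1 - norm z)" using 0 R0 by (simp add: R_def)
      also have "\<dots> \<le> 9 * \<tau> * max (1 - norm z) (pdist z u / 9)" using \<tau> by (intro mult_left_mono) auto
      finally show ?thesis .
    next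
      case (Suc j)
      then have "u \<notin> pball z (R j)" using not_less_Least[of j "\<lambda>k. u \<in> pball z (R k)"] by (simp add: k_def)
      then have "R j \<le> pdist z u" using u by (simp add: pball_def)
      then have "\<tau> * R j \<le> \<tau> * pdist z u" using \<tau> by (intro mult_left_mono) auto
      also have "\<dots> = 9 * \<tau> * (pdist z u / 9)" by simp
      also have "\<dots> \<le> 9 * \<tau> * max (1 - norm z) (pdist z u / 9)" using \<tau> by (intro mult_left_mono) auto
      finally show ?thesis by (simp add: Suc R_def mult_ac)
    qed
    then have "cmod (bergman_kernel \<gamma> z u) \<le> G * (R0 powr (N / 2) * R k powr (- N))"
      unfolding G_def using \<tau> R0(1) R[of k] by (intro cmod_bergman_kernel_le[OF z u N]) auto
    then have "cmod (bergman_kernel \<gamma> z u) powr s \<le> (G * (R0 powr (N / 2) * R k powr (- N))) powr s"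
      using s by (intro powr_mono2) auto
    also have "\<dots> = c k"
      using R0' R[of k] \<tau> by (simp add: c_def powr_mult powr_powr G_def)
    finally show ?thesis using k \<open>k \<le> K\<close> by blast
  qed
  have [measurable]: "pball z (R k) \<in> sets (vol \<gamma>)" for k by (rule pball_sets_vol)
  have "(\<integral>\<^sup>+u. ennreal (f u * cmod (bergman_kernel \<gamma> z u) powr s) \<partial>vol \<gamma>)
     \<le> (\<integral>\<^sup>+u. (\<Sum>k\<le>K. ennreal (c k) * (ennreal (f u) * indicator (pball z (R k)) u)) \<partial>vol \<gamma>)"
  proof (rule nn_integral_mono)
    fix u :: "complex^'n" assume "u \<in> space (vol \<gamma>)"
    then obtain k where k: "k \<le> K" "u \<in> pball z (R k)" "cmod (bergman_kernel \<gamma> z u) powr s \<le> c k"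
      using pt[of u] by auto
    have "ennreal (f u * cmod (bergman_kernel \<gamma> z u) powr s) = ennreal (f u) * ennreal (cmod (bergman_kernel \<gamma> z u) powr s)"
      by (rule ennreal_mult'') simp
    also have "\<dots> \<le> ennreal (f u) * ennreal (c k)" using k(3) by (intro mult_left_mono ennreal_leI) auto
    also have "\<dots> = ennreal (c k) * (ennreal (f u) * indicator (pball z (R k)) u)" using k by (simp add: mult.commute)
    also have "\<dots> \<le> (\<Sum>k\<le>K. ennreal (c k) * (ennreal (f u) * indicator (pball z (R k)) u))"
      using k(1) by (intro member_le_sum) auto
    finally show "ennreal (f u * cmod (bergman_kernel \<gamma> z u) powr s)
       \<le> (\<Sum>k\<le>K. ennreal (c k) * (ennreal (f u) * indicator (pball z (R k)) u))" .
  qed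
  also have "\<dots> = (\<Sum>k\<le>K. ennreal (c k) * (\<integral>\<^sup>+u\<in>pball z (R k). ennreal (f u) \<partial>vol \<gamma>))"
    by (subst nn_integral_sum) (auto simp: nn_integral_cmult)
  also have "\<dots> = (\<Sum>k\<le>K. ennreal (c k * W k))"
    using I c by (intro sum.cong refl) (simp add: R_def ennreal_mult)
  also have "\<dots> = ennreal (\<Sum>k\<le>K. c k * W k)" using c I(2) by (intro sum_ennreal) auto
  also have "(\<Sum>k\<le>K. c k * W k) = G powr s * R0 powr (N * s / 2) * (\<Sum>k\<le>K. R k powr (- N * s) * W k)"
    by (simp only: c_def sum_distrib_left mult.assoc)
  finally show ?thesis by (simp only: G_def R_def)
qed

text \<open>The chain is built downwards from 3, so that it ends exactly with the whole ball. It
  stops one step before the radius would drop to \<open>d\<close> or below, hence all its balls meet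
  the sphere and the smallest radius is comparable to \<open>d\<close>.\<close>

lemma dyadic_start:
  fixes \<tau> d :: real
  assumes "\<tau> > 1" "0 < d" "d \<le> 1"
  obtains R0 K where "d < R0" "R0 \<le> \<tau> * d" "R0 * \<tau> ^ K = 3"
proof -
  obtain n where "3 / d < \<tau> ^ n" using real_arch_pow[OF assms(1)] by blast
  then have ex: "\<exists>n. 3 / \<tau> ^ n \<le> d" using assms by (intro exI[of _ n]) (simp add: field_simps)
  define n where "n = (LEAST n. 3 / \<tau> ^ n \<le> d)"
  have n: "3 / \<tau> ^ n \<le> d" unfolding n_def using ex by (rule LeastI_ex)
  then have "n \<noteq> 0" using assms by (cases n) auto
  then obtain K where K: "n = Suc K" by (cases n) auto
  then have "\<not> 3 / \<tau> ^ K \<le> d" using not_less_Least[of K "\<lambda>n. 3 / \<tau> ^ n \<le> d"] by (simp add: n_def)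
  moreover have "3 / \<tau> ^ K \<le> \<tau> * d" using n assms by (simp add: K field_simps)
  moreover have "3 / \<tau> ^ K * \<tau> ^ K = 3" using assms by simp
  ultimately show ?thesis using that[of "3 / \<tau> ^ K" K] by simp
qed

lemma ber_norm_upper:
  fixes \<gamma> p q :: real
  assumes \<gamma>: "\<gamma> > -1" and p: "1 < p" and pq: "1 / p + 1 / q = 1"
  shows "\<exists>C>0. \<forall>w :: complex^'n \<Rightarrow> real. weight w \<longrightarrow>
    ber_norm p q \<gamma> w \<le> ennreal C * epowr (bb_norm p \<gamma> w) (max (p + 1) (q + 1))"
proof -
  define N where "N = real CARD('n) + 1 + \<gamma>"
  have N: "N > 0" using \<gamma> by (simp add: N_def)
  note N' = N_def[symmetric]
  note qp = conjugate_exponent[OF p pq]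
  obtain c1 c2 where c: "c1 > 0" "c2 > 0" and vb: "\<And>(z::complex^'n) R. norm z < 1 \<Longrightarrow> 1 - norm z < R \<Longrightarrow> R \<le> 3 \<Longrightarrow>
    ennreal (c1 * R powr N) \<le> emeasure (vol \<gamma>) (pball z R) \<and> emeasure (vol \<gamma>) (pball z R) \<le> ennreal (c2 * R powr N)"
    using emeasure_vol_pball[OF \<gamma>, where 'n='n] unfolding N' by blast
  \<comment> \<open>With this ratio of the radii each ball fills at most half of the next one.\<close>
  define \<tau> where "\<tau> = max 2 ((2 * c2 / c1) powr (1 / N))"
  have \<tau>: "\<tau> > 1" "2 * c2 / c1 \<le> \<tau> powr N"
  proof -
    have "2 * c2 / c1 = ((2 * c2 / c1) powr (1 / N)) powr N" using c N by (simp add: powr_powr)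
    also have "\<dots> \<le> \<tau> powr N" using N by (intro powr_mono2) (auto simp: \<tau>_def)
    finally show "2 * c2 / c1 \<le> \<tau> powr N" .
  qed (simp add: \<tau>_def)
  define g where "g = \<tau> powr N"
  have g: "g > 1" using \<tau> N by (simp add: g_def gr_one_powr)
  define A where "A = c2 powr p"
  define \<delta>1 \<delta>2 :: real where "\<delta>1 = 2 powr (- p)" and "\<delta>2 = 2 powr (- q)"
  have \<delta>: "0 < \<delta>1" "\<delta>1 < 1" "0 < \<delta>2" "\<delta>2 < 1"
    using p qp by (auto simp: \<delta>1_def \<delta>2_def powr_less_one)
  have A: "A > 0" using c by (simp add: A_def)
  obtain C where C: "C > 0" and dp: "\<And>(W :: nat \<Rightarrow> real) (S :: nat \<Rightarrow> real) K y M.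
    M \<ge> 1 \<and> y > 0 \<and> (\<forall>k\<le>K. W k > 0 \<and> S k > 0) \<and>
    (\<forall>k\<le>K. W k * S k powr (p - 1) \<le> A * M * (y * g ^ k) powr p) \<and>
    (\<forall>i j. i \<le> j \<and> j \<le> K \<longrightarrow> W i \<le> (1 - \<delta>1 / M) ^ (j - i) * W j) \<and>
    (\<forall>i j. i \<le> j \<and> j \<le> K \<longrightarrow> S i \<le> (1 - \<delta>2 * M powr (1 - q)) ^ (j - i) * S j) \<Longrightarrow>
    y powr p * (\<Sum>k\<le>K. (y * g ^ k) powr (- p) * W k)
        * (\<Sum>k\<le>K. (y * g ^ k) powr (- q) * S k) powr (p - 1)
      \<le> C * M powr max (p + 1) (q + 1)"
    using dyadic_product_le[OF p pq g A \<delta>] by blast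
  define G where "G = 2 powr (N / 2) * (9 * \<tau>) powr N"
  have G: "G > 0" using \<tau> by (simp add: G_def)
  have "ber_norm p q \<gamma> w \<le> ennreal (G powr (2 * p) * C) * epowr (bb_norm p \<gamma> w) (max (p + 1) (q + 1))"
    if w: "weight w" for w :: "complex^'n \<Rightarrow> real"
  proof (cases "bb_norm p \<gamma> w = \<infinity>")
    case True
    then show ?thesis using G C by (simp add: epowr_def ennreal_mult_top)
  next
    case False
    then obtain M where M: "bb_norm p \<gamma> w = ennreal M" "M \<ge> 0" by (cases "bb_norm p \<gamma> w") auto
    define \<sigma> where "\<sigma> u = w u powr (- 1 / (p - 1))" for u
    have meas: "w \<in> borel_measurable (vol \<gamma>)" "\<sigma> \<in> borel_measurable (vol \<gamma>)"
      unfolding \<sigma>_def using weightD[OF w] dual_weightD[OF w] by auto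
    note [measurable] = meas
    have AEpos: "AE u in vol \<gamma>. 0 < w u" "AE u in vol \<gamma>. 0 < \<sigma> u"
      unfolding \<sigma>_def using weightD[OF w] dual_weightD[OF w] by auto
    have "berezin \<gamma> (\<lambda>u. w u * cmod (bergman_kernel \<gamma> z u powr complex_of_real (p - 2))) z
       * epowr (berezin \<gamma> (\<lambda>u. \<sigma> u * cmod (bergman_kernel \<gamma> z u powr complex_of_real (q - 2))) z) (p - 1)
      \<le> ennreal (G powr (2 * p) * C * M powr (max (p + 1) (q + 1)))" if z: "z \<in> ball 0 1" for z :: "complex^'n"
    proof -
      have z1: "norm z < 1" using z by simp
      obtain R0 K where R0: "1 - norm z < R0" "R0 \<le> \<tau> * (1 - norm z)" "R0 * \<tau> ^ K = 3"
        using dyadic_start[OF \<tau>(1), of "1 - norm z"] z1 by auto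
      have R0': "R0 > 0" using R0 z1 by linarith
      define R where "R k = R0 * \<tau> ^ k" for k
      have R: "R k > 0" "1 - norm z < R k" for k
      proof -
        have "R0 * 1 \<le> R0 * \<tau> ^ k" using R0' \<tau> by (intro mult_left_mono) (auto intro: one_le_power)
        then have "R0 \<le> R k" by (simp only: R_def mult_1_right)
        then show "R k > 0" "1 - norm z < R k" using R0 R0' by linarith+
      qed
      have R3: "R k \<le> 3" if "k \<le> K" for k
      proof -
        have "R0 * \<tau> ^ k \<le> R0 * \<tau> ^ K" using R0' \<tau> that by (intro mult_left_mono power_increasing) auto
        then show ?thesis using R0 by (simp add: R_def)
      qed
      define V where "V k = measure (vol \<gamma>) (pball z (R k))" for k
      have V: "emeasure (vol \<gamma>) (pball z (R k)) = ennreal (V k)" "c1 * R k powr N \<le> V k" "V k \<le> c2 * R k powr N" "V k > 0"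
        if "k \<le> K" for k
      proof -
        note b = vb[OF z1 R(2) R3[OF that]]
        have "emeasure (vol \<gamma>) (pball z (R k)) \<noteq> \<infinity>" using b by (auto simp: top_unique)
        then show *: "emeasure (vol \<gamma>) (pball z (R k)) = ennreal (V k)"
          by (simp add: V_def emeasure_eq_ennreal_measure)
        have "V k \<ge> 0" by (simp add: V_def)
        moreover have "c2 * R k powr N \<ge> 0" using c by simp
        ultimately show 1: "c1 * R k powr N \<le> V k" "V k \<le> c2 * R k powr N"
          using b unfolding * by (simp_all only: ennreal_le_iff)
        have "c1 * R k powr N > 0" using c R(1)[of k] by simp
        then show "V k > 0" using 1 by linarith
      qed
      define I J where "I k = (\<integral>\<^sup>+u\<in>pball z (R k). ennreal (w u) \<partial>vol \<gamma>)"
        and "J k = (\<integral>\<^sup>+u\<in>pball z (R k). ennreal (\<sigma> u) \<partial>vol \<gamma>)" for k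
      define W S where "W k = enn2real (I k)" and "S k = enn2real (J k)" for k
      have WS: "I k = ennreal (W k)" "J k = ennreal (S k)" "W k > 0" "S k > 0"
         "W k * S k powr (p - 1) \<le> M * V k powr p" "V k powr p \<le> W k * S k powr (p - 1)" if kK: "k \<le> K" for k
      proof -
        obtain W' S' where "W' > 0" "S' > 0" "I k = ennreal W'" "J k = ennreal S'"
          "W' * S' powr (p - 1) \<le> M * V k powr p" "V k powr p \<le> W' * S' powr (p - 1)"
          unfolding I_def J_def \<sigma>_def
          using bb_norm_pball[OF p pq w eq_refl[OF M(1)] M(2) z1 R(2) V(1)[OF kK] V(4)[OF kK]] by blast
        then show "I k = ennreal (W k)" "J k = ennreal (S k)" "W k > 0" "S k > 0"
         "W k * S k powr (p - 1) \<le> M * V k powr p" "V k powr p \<le> W k * S k powr (p - 1)"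
          by (simp_all add: W_def S_def)
      qed
      \<comment> \<open>Hoelder's inequality on any single ball bounds the norm from below; negative
        powers of \<open>M\<close> are then at most 1.\<close>
      have M1: "M \<ge> 1"
      proof -
        have "1 * V 0 powr p \<le> M * V 0 powr p" using WS(5,6)[of 0] by simp
        then show ?thesis using V(4)[of 0] by simp
      qed
      have step: "W k \<le> (1 - \<delta>1 / M) * W (Suc k)" "S k \<le> (1 - \<delta>2 * M powr (1 - q)) * S (Suc k)" if k: "k < K" for k
      proof -
        let ?D = "pball z (R k)" and ?D' = "pball z (R (Suc k))"
        have k': "k \<le> K" "Suc k \<le> K" using k by auto
        have Rs: "R (Suc k) = R k * \<tau>" by (simp add: R_def)
        have "R k * 1 \<le> R k * \<tau>" using R(1)[of k] \<tau> by (intro mult_left_mono) auto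
        then have "R k \<le> R (Suc k)" by (simp only: Rs mult_1_right)
        then have sub: "?D \<subseteq> ?D'" by (rule pball_mono)
        have [measurable]: "?D \<in> sets (vol \<gamma>)" "?D' \<in> sets (vol \<gamma>)" by (rule pball_sets_vol)+
        define E where "E = ?D' - ?D"
        have E[measurable]: "E \<in> sets (vol \<gamma>)" unfolding E_def by measurable
        have D': "?D' = ?D \<union> E" "?D \<inter> E = {}" using sub by (auto simp: E_def)
        define VE where "VE = V (Suc k) - V k"
        have "emeasure (vol \<gamma>) E = ennreal (V (Suc k)) - ennreal (V k)"
          unfolding E_def using V[OF k'(1)] V[OF k'(2)] sub
          by (subst emeasure_Diff) (auto simp del: sets_vol intro: pball_sets_vol)
        also have "\<dots> = ennreal VE" using V(4)[OF k'(1)] by (simp add: VE_def ennreal_minus)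
        finally have VE: "emeasure (vol \<gamma>) E = ennreal VE" .
        have half: "V (Suc k) / 2 \<le> VE"
        proof -
          have "R (Suc k) powr N = R k powr N * \<tau> powr N"
            unfolding Rs by (rule powr_mult)
          moreover have "c1 * (R k powr N * (2 * c2 / c1)) \<le> c1 * (R k powr N * \<tau> powr N)"
            using c \<tau> by (intro mult_left_mono) auto
          ultimately have "2 * (c2 * R k powr N) \<le> c1 * R (Suc k) powr N"
            using c by (simp only: times_divide_eq_right) (simp add: mult_ac)
          then show ?thesis using V(3)[OF k'(1)] V(2)[OF k'(2)] by (simp add: VE_def)
        qed
        have VE0: "VE > 0" using half V(4)[OF k'(2)] by linarith
        have split: "(\<integral>\<^sup>+u\<in>?D'. ennreal (f u) \<partial>vol \<gamma>) = (\<integral>\<^sup>+u\<in>?D. ennreal (f u) \<partial>vol \<gamma>) + (\<integral>\<^sup>+u\<in>E. ennreal (f u) \<partial>vol \<gamma>)"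
          if [measurable]: "f \<in> borel_measurable (vol \<gamma>)" for f :: "complex^'n \<Rightarrow> real"
        proof -
          have "ennreal (f u) * indicator ?D' u = ennreal (f u) * indicator ?D u + ennreal (f u) * indicator E u" for u
            using D' by (auto split: split_indicator)
          then show ?thesis by (simp add: nn_integral_add)
        qed
        \<comment> \<open>As the mass of the larger ball is finite, the mass of the difference set
          may be computed by subtraction of reals.\<close>
        have part: "\<exists>FE>0. (\<integral>\<^sup>+u\<in>E. ennreal (f u) \<partial>vol \<gamma>) = ennreal FE \<and> F = F' - FE \<and> FE \<le> F'"
          if f: "f \<in> borel_measurable (vol \<gamma>)" "AE u in vol \<gamma>. 0 < f u"
           and F: "(\<integral>\<^sup>+u\<in>?D. ennreal (f u) \<partial>vol \<gamma>) = ennreal F" "(\<integral>\<^sup>+u\<in>?D'. ennreal (f u) \<partial>vol \<gamma>) = ennreal F'" "F > 0" "F' > 0"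
          for f :: "complex^'n \<Rightarrow> real" and F F'
        proof -
          have "(\<integral>\<^sup>+u\<in>E. ennreal (f u) \<partial>vol \<gamma>) > 0"
            using VE VE0 by (intro nn_integral_set_pos[OF f E]) simp
          moreover have "ennreal F' = ennreal F + (\<integral>\<^sup>+u\<in>E. ennreal (f u) \<partial>vol \<gamma>)"
            using split[OF f(1)] F by simp
          moreover have "(\<integral>\<^sup>+u\<in>E. ennreal (f u) \<partial>vol \<gamma>) \<noteq> top" using calculation(2) by auto
          ultimately obtain FE where "FE > 0" "(\<integral>\<^sup>+u\<in>E. ennreal (f u) \<partial>vol \<gamma>) = ennreal FE" "ennreal F' = ennreal F + ennreal FE"
            by (cases "\<integral>\<^sup>+u\<in>E. ennreal (f u) \<partial>vol \<gamma>") auto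
          moreover from this F have "F' = F + FE" by (simp flip: ennreal_plus)
          ultimately show ?thesis using F by auto
        qed
        obtain WE where WE: "WE > 0" "(\<integral>\<^sup>+u\<in>E. ennreal (w u) \<partial>vol \<gamma>) = ennreal WE" "W k = W (Suc k) - WE" "WE \<le> W (Suc k)"
          using part[OF meas(1) AEpos(1)] WS[OF k'(1)] WS[OF k'(2)] unfolding I_def by blast
        obtain SE where SE: "SE > 0" "(\<integral>\<^sup>+u\<in>E. ennreal (\<sigma> u) \<partial>vol \<gamma>) = ennreal SE" "S k = S (Suc k) - SE" "SE \<le> S (Suc k)"
          using part[OF meas(2) AEpos(2)] WS[OF k'(1)] WS[OF k'(2)] unfolding J_def by blast
        have "VE powr p \<le> WE * SE powr (p - 1)"
          using holder_dual_weight[OF p pq meas(1) AEpos(1) E WE(2,1) SE(2)[unfolded \<sigma>_def] SE(1) VE] VE0 by simp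
        from reverse_doubling_step[OF p pq _ V(4)[OF k'(2)] WS(3,4,5)[OF k'(2)] half WE(1,4) SE(1,4) this]
        show "W k \<le> (1 - \<delta>1 / M) * W (Suc k)" "S k \<le> (1 - \<delta>2 * M powr (1 - q)) * S (Suc k)"
          using M1 by (simp_all add: WE(3) SE(3) \<delta>1_def \<delta>2_def)
      qed
      \<comment> \<open>In terms of the N-th powers of the radii, which have the order of the
        measures, dimension and \<gamma> disappear from the sums.\<close>
      define y where "y = R0 powr N"
      have y: "y > 0" using R0' by (simp add: y_def)
      have yg: "y * g ^ k = R k powr N" for k
        using R0' \<tau> by (simp add: y_def g_def R_def powr_mult powr_power powr_powr mult.commute flip: powr_realpow)
      define X Y where "X = (\<Sum>k\<le>K. (y * g ^ k) powr (- p) * W k)" and "Y = (\<Sum>k\<le>K. (y * g ^ k) powr (- q) * S k)"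
      have XY: "y powr p * X * Y powr (p - 1) \<le> C * M powr max (p + 1) (q + 1)"
        unfolding X_def Y_def
      proof (rule dp, intro conjI allI impI)
        fix k assume k: "k \<le> K"
        show "W k > 0" "S k > 0" using WS[OF k] by auto
        have "V k powr p \<le> (c2 * R k powr N) powr p" using V[OF k] p by (intro powr_mono2) auto
        also have "\<dots> = A * (y * g ^ k) powr p" using c by (simp add: A_def yg powr_mult)
        finally have "M * V k powr p \<le> M * (A * (y * g ^ k) powr p)" using M by (intro mult_left_mono)
        then show "W k * S k powr (p - 1) \<le> A * M * (y * g ^ k) powr p" using WS(5)[OF k] by (simp add: mult_ac)
      next
        fix i j :: nat assume ij: "i \<le> j \<and> j \<le> K"
        have "\<delta>1 / M \<le> 1" using \<delta> M1 by (simp add: divide_le_eq)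
        then show "W i \<le> (1 - \<delta>1 / M) ^ (j - i) * W j" using step(1) ij by (intro geometric_decay[of K]) auto
        have "M powr (1 - q) \<le> M powr 0" using M1 qp by (intro powr_mono) auto
        then have "\<delta>2 * M powr (1 - q) \<le> 1 * 1" using \<delta> M1 by (intro mult_mono) auto
        then show "S i \<le> (1 - \<delta>2 * M powr (1 - q)) ^ (j - i) * S j" using step(2) ij by (intro geometric_decay[of K]) auto
      qed (use M1 y in auto)
      have X0: "X \<ge> 0" "Y \<ge> 0"
        unfolding X_def Y_def by (intro sum_nonneg mult_nonneg_nonneg; use WS in \<open>auto intro: less_imp_le\<close>)+
      have RN: "R k powr (- N * s) = (y * g ^ k) powr (- s)" "R0 powr (N * s / 2) = y powr (s / 2)" for k s
        by (simp add: yg powr_powr) (simp add: y_def powr_powr)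
      have BA: "berezin \<gamma> (\<lambda>u. w u * cmod (bergman_kernel \<gamma> z u powr complex_of_real (p - 2))) z \<le> ennreal (G powr p * y powr (p / 2) * X)"
        unfolding berezin_power_eq[OF z1] G_def X_def RN[symmetric] R_def
        by (rule nn_integral_kernel_le_sum[OF z1 N' N _ \<tau>(1) R0 meas(1)])
          (use p WS in \<open>auto simp: I_def R_def intro: less_imp_le\<close>)
      have BB: "berezin \<gamma> (\<lambda>u. \<sigma> u * cmod (bergman_kernel \<gamma> z u powr complex_of_real (q - 2))) z \<le> ennreal (G powr q * y powr (q / 2) * Y)"
        unfolding berezin_power_eq[OF z1] G_def Y_def RN[symmetric] R_def
        by (rule nn_integral_kernel_le_sum[OF z1 N' N _ \<tau>(1) R0 meas(2)])
          (use qp WS in \<open>auto simp: J_def R_def intro: less_imp_le\<close>)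
      have "berezin \<gamma> (\<lambda>u. w u * cmod (bergman_kernel \<gamma> z u powr complex_of_real (p - 2))) z
       * epowr (berezin \<gamma> (\<lambda>u. \<sigma> u * cmod (bergman_kernel \<gamma> z u powr complex_of_real (q - 2))) z) (p - 1)
       \<le> ennreal (G powr p * y powr (p / 2) * X) * epowr (ennreal (G powr q * y powr (q / 2) * Y)) (p - 1)"
        using p by (intro mult_mono BA BB epowr_mono) auto
      also have "\<dots> = ennreal ((G powr p * y powr (p / 2) * X) * (G powr q * y powr (q / 2) * Y) powr (p - 1))"
        by (subst epowr_ennreal, use X0 in simp, rule ennreal_mult[symmetric]) (use X0 in auto)
      \<comment> \<open>Since \<open>q * (p - 1) = p\<close>, both Berezin factors contribute
        \<open>y powr (p / 2)\<close> and \<open>G powr p\<close>. This produces exactly the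
        prefactor \<open>y powr p\<close> of the double sum.\<close>
      also have "(G powr p * y powr (p / 2) * X) * (G powr q * y powr (q / 2) * Y) powr (p - 1) = G powr (2 * p) * (y powr p * X * Y powr (p - 1))"
      proof -
        have "(G powr q * y powr (q / 2) * Y) powr (p - 1) = G powr (q * (p - 1)) * y powr (q * (p - 1) / 2) * Y powr (p - 1)"
          using G y X0 by (simp add: powr_mult powr_powr)
        moreover have "G powr (2 * p) = G powr p * G powr p" "y powr p = y powr (p / 2) * y powr (p / 2)"
          by (simp_all flip: powr_add)
        ultimately show ?thesis unfolding qp(2) by (simp only: mult_ac)
      qed
      also have "ennreal (G powr (2 * p) * (y powr p * X * Y powr (p - 1))) \<le> ennreal (G powr (2 * p) * (C * M powr max (p + 1) (q + 1)))"
        using XY by (intro ennreal_leI mult_left_mono) auto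
      finally show ?thesis by (simp only: mult.assoc)
    qed
    then have "ber_norm p q \<gamma> w \<le> ennreal (G powr (2 * p) * C * M powr (max (p + 1) (q + 1)))"
      unfolding ber_norm_def \<sigma>_def by (intro SUP_least)
    also have "\<dots> = ennreal (G powr (2 * p) * C) * epowr (bb_norm p \<gamma> w) (max (p + 1) (q + 1))"
      using M G C by (simp add: epowr_ennreal ennreal_mult)
    finally show ?thesis .
  qed
  moreover have "G powr (2 * p) * C > 0" using G C by simp
  ultimately show ?thesis by blast
qed

section \<open>The Berezin quantity from below\<close>

lemma nn_integral_pball_le_kernel:
  fixes z0 :: "complex^'n" and f :: "complex^'n \<Rightarrow> real"
  assumes z0: "norm z0 < 1" and R: "R > 1 - norm z0" and N: "real CARD('n) + 1 + \<gamma> = N" "N > 0" and s: "s > 0"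
    and f: "f \<in> borel_measurable (vol \<gamma>)"
  defines "R' \<equiv> min R 1"
  defines "z \<equiv> ((1 - R') / norm z0) *\<^sub>R z0"
  shows "(\<integral>\<^sup>+u\<in>pball z0 R. ennreal (f u) \<partial>vol \<gamma>)
    \<le> ennreal (4 powr (N * s) * R' powr (N * s / 2)) * (\<integral>\<^sup>+u. ennreal (f u * cmod (bergman_kernel \<gamma> z u) powr s) \<partial>vol \<gamma>)"
proof -
  note [measurable] = f pball_sets_vol
  have R': "R' > 0" using z0 R by (simp add: R'_def)
  define k where "k = 4 powr (- N) * R' powr (- N / 2)"
  have k: "k > 0" using R' by (simp add: k_def)
  have inv: "4 powr (N * s) * R' powr (N * s / 2) = inverse (k powr s)"
    unfolding powr_minus[symmetric] by (simp add: k_def powr_mult powr_powr)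
  have "ennreal (k powr s) * (\<integral>\<^sup>+u\<in>pball z0 R. ennreal (f u) \<partial>vol \<gamma>)
     = (\<integral>\<^sup>+u. ennreal (k powr s) * (ennreal (f u) * indicator (pball z0 R) u) \<partial>vol \<gamma>)"
    by (rule nn_integral_cmult[symmetric]) measurable
  also have "\<dots> \<le> (\<integral>\<^sup>+u. ennreal (f u * cmod (bergman_kernel \<gamma> z u) powr s) \<partial>vol \<gamma>)"
  proof (rule nn_integral_mono)
    fix u :: "complex^'n"
    show "ennreal (k powr s) * (ennreal (f u) * indicator (pball z0 R) u) \<le> ennreal (f u * cmod (bergman_kernel \<gamma> z u) powr s)"
    proof (cases "u \<in> pball z0 R")
      case True
      then have "k \<le> cmod (bergman_kernel \<gamma> z u)"
        unfolding k_def z_def R'_def by (rule cmod_bergman_kernel_ge(2)[OF z0 R N])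
      then have "k powr s \<le> cmod (bergman_kernel \<gamma> z u) powr s" using k s by (intro powr_mono2) auto
      then have "ennreal (f u) * ennreal (k powr s) \<le> ennreal (f u) * ennreal (cmod (bergman_kernel \<gamma> z u) powr s)"
        by (intro mult_left_mono ennreal_leI) auto
      also have "\<dots> = ennreal (f u * cmod (bergman_kernel \<gamma> z u) powr s)"
        by (rule ennreal_mult''[symmetric]) simp
      finally show ?thesis using True by (simp add: mult.commute)
    qed simp
  qed
  \<comment> \<open>The integrals may be infinite, so the constant changes sides by multiplication
    with its inverse.\<close>
  finally have "ennreal (inverse (k powr s)) * (ennreal (k powr s) * (\<integral>\<^sup>+u\<in>pball z0 R. ennreal (f u) \<partial>vol \<gamma>))
     \<le> ennreal (inverse (k powr s)) * (\<integral>\<^sup>+u. ennreal (f u * cmod (bergman_kernel \<gamma> z u) powr s) \<partial>vol \<gamma>)"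
    by (intro mult_left_mono) auto
  moreover have "ennreal (inverse (k powr s)) * ennreal (k powr s) = 1"
    using k by (simp flip: ennreal_mult)
  ultimately show ?thesis unfolding inv by (simp flip: mult.assoc)
qed

lemma bb_norm_upper:
  fixes \<gamma> p q :: real
  assumes \<gamma>: "\<gamma> > -1" and p: "1 < p" and pq: "1 / p + 1 / q = 1"
  shows "\<exists>C>0. \<forall>w :: complex^'n \<Rightarrow> real. weight w \<longrightarrow> bb_norm p \<gamma> w \<le> ennreal C * ber_norm p q \<gamma> w"
proof -
  define N where "N = real CARD('n) + 1 + \<gamma>"
  have N: "N > 0" using \<gamma> by (simp add: N_def)
  note qp = conjugate_exponent[OF p pq]
  obtain c1 c2 where c: "c1 > 0" "c2 > 0" and vb: "\<And>(z::complex^'n) R. norm z < 1 \<Longrightarrow> 1 - norm z < R \<Longrightarrow> R \<le> 3 \<Longrightarrow>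
    ennreal (c1 * R powr N) \<le> emeasure (vol \<gamma>) (pball z R) \<and> emeasure (vol \<gamma>) (pball z R) \<le> ennreal (c2 * R powr N)"
    using emeasure_vol_pball[OF \<gamma>, where 'n='n] unfolding N_def by blast
  \<comment> \<open>Each of the two factors loses \<open>4 powr (N * p)\<close> through the lower
    bound for the kernel, and \<open>c1 powr (- p)\<close> is left over from the volumes once the
    powers of \<open>y\<close> cancel.\<close>
  define C where "C = 4 powr (2 * (N * p)) * c1 powr (- p)"
  have "avg \<gamma> (pball z0 R) w * epowr (avg \<gamma> (pball z0 R) (\<lambda>u. w u powr (- 1 / (p - 1)))) (p - 1) \<le> ennreal C * ber_norm p q \<gamma> w"
    if w: "weight w" and z0: "norm z0 < 1" "R > 1 - norm z0" for w and z0 :: "complex^'n" and R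
  proof -
    define R' where "R' = min R 1"
    define z where "z = ((1 - R') / norm z0) *\<^sub>R z0"
    have R': "R' > 0" using z0 by (simp add: R'_def)
    define y where "y = R' powr N"
    have y: "y > 0" using R' by (simp add: y_def)
    \<comment> \<open>The volume bound reaches up to radius 3; a larger ball contains the one of
      radius 3, and \<open>R' \<le> min R 3\<close>.\<close>
    have V: "ennreal (c1 * y) \<le> emeasure (vol \<gamma>) (pball z0 R)"
    proof -
      have R3: "R' \<le> min R 3" "1 - norm z0 < min R 3"
        using z0 norm_ge_zero[of z0] unfolding R'_def by linarith+
      have "ennreal (c1 * y) \<le> ennreal (c1 * (min R 3) powr N)"
        unfolding y_def using c N R' R3 by (intro ennreal_leI mult_left_mono powr_mono2) auto
      also have "\<dots> \<le> emeasure (vol \<gamma>) (pball z0 (min R 3))" using vb[OF z0(1) R3(2)] by simp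
      also have "\<dots> \<le> emeasure (vol \<gamma>) (pball z0 R)"
        by (intro emeasure_mono pball_mono pball_sets_vol) simp
      finally show ?thesis .
    qed
    have div: "I / emeasure (vol \<gamma>) (pball z0 R) \<le> ennreal (1 / (c1 * y)) * I" for I
    proof -
      have "inverse (emeasure (vol \<gamma>) (pball z0 R)) \<le> ennreal (1 / (c1 * y))"
      proof (cases "emeasure (vol \<gamma>) (pball z0 R)")
        case (real v)
        then have "c1 * y \<le> v" using V by simp
        moreover have "c1 * y > 0" using c y by simp
        ultimately have "inverse v \<le> 1 / (c1 * y)" "v > 0" by (auto simp: inverse_eq_divide intro: frac_le)
        then show ?thesis using real by (simp add: inverse_ennreal ennreal_leI)
      qed simp
      then show ?thesis by (simp add: divide_ennreal_def mult.commute mult_left_mono)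
    qed
    have RN: "R' powr (N * s / 2) = y powr (s / 2)" for s by (simp add: y_def powr_powr)
    have z: "norm z < 1"
      unfolding z_def R'_def by (rule cmod_bergman_kernel_ge(1)[OF z0 N_def[symmetric] N])
    define A where "A = berezin \<gamma> (\<lambda>u. w u * cmod (bergman_kernel \<gamma> z u powr complex_of_real (p - 2))) z"
    define B where "B = berezin \<gamma> (\<lambda>u. w u powr (- 1 / (p - 1)) * cmod (bergman_kernel \<gamma> z u powr complex_of_real (q - 2))) z"
    have avg: "avg \<gamma> (pball z0 R) f \<le> ennreal (4 powr (N * s) * y powr (s / 2) / (c1 * y))
        * (\<integral>\<^sup>+u. ennreal (f u * cmod (bergman_kernel \<gamma> z u) powr s) \<partial>vol \<gamma>)"
      if f: "f \<in> borel_measurable (vol \<gamma>)" and s: "s > 0" for f :: "complex^'n \<Rightarrow> real" and s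
    proof -
      have "avg \<gamma> (pball z0 R) f \<le> ennreal (1 / (c1 * y)) * (\<integral>\<^sup>+u\<in>pball z0 R. ennreal (f u) \<partial>vol \<gamma>)"
        unfolding avg_def by (rule div)
      also have "\<dots> \<le> ennreal (1 / (c1 * y)) * (ennreal (4 powr (N * s) * y powr (s / 2))
        * (\<integral>\<^sup>+u. ennreal (f u * cmod (bergman_kernel \<gamma> z u) powr s) \<partial>vol \<gamma>))"
        using nn_integral_pball_le_kernel[OF z0 N_def[symmetric] N s f] unfolding RN[symmetric] z_def R'_def
        by (intro mult_left_mono) auto
      also have "\<dots> = (ennreal (1 / (c1 * y)) * ennreal (4 powr (N * s) * y powr (s / 2)))
        * (\<integral>\<^sup>+u. ennreal (f u * cmod (bergman_kernel \<gamma> z u) powr s) \<partial>vol \<gamma>)"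
        by (simp only: mult.assoc)
      also have "ennreal (1 / (c1 * y)) * ennreal (4 powr (N * s) * y powr (s / 2)) = ennreal (4 powr (N * s) * y powr (s / 2) / (c1 * y))"
        using c y by (subst ennreal_mult[symmetric]) auto
      finally show ?thesis .
    qed
    define a b where "a = 4 powr (N * p) * y powr (p / 2) / (c1 * y)" and "b = 4 powr (N * q) * y powr (q / 2) / (c1 * y)"
    have ab: "a > 0" "b > 0" using c y by (simp_all add: a_def b_def)
    have "avg \<gamma> (pball z0 R) w * epowr (avg \<gamma> (pball z0 R) (\<lambda>u. w u powr (- 1 / (p - 1)))) (p - 1)
      \<le> (ennreal a * A) * epowr (ennreal b * B) (p - 1)"
    proof (intro mult_mono epowr_mono)
      show "avg \<gamma> (pball z0 R) w \<le> ennreal a * A"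
        unfolding A_def berezin_power_eq[OF z] a_def using p by (intro avg weightD[OF w]) auto
      show "avg \<gamma> (pball z0 R) (\<lambda>u. w u powr (- 1 / (p - 1))) \<le> ennreal b * B"
        unfolding B_def berezin_power_eq[OF z] b_def using qp by (intro avg dual_weightD[OF w]) auto
    qed (use p in auto)
    also have "\<dots> = (ennreal a * ennreal (b powr (p - 1))) * (A * epowr B (p - 1))"
      unfolding epowr_cmult[OF ab(2)] by (simp only: mult_ac)
    \<comment> \<open>By \<open>q * (p - 1) = p\<close> the kernel contributes
      \<open>y powr (p / 2)\<close> twice, and the volumes contribute
      \<open>(c1 * y) powr (- p)\<close>; what remains does not depend on the ball.\<close>
    also have "ennreal a * ennreal (b powr (p - 1)) = ennreal C"
    proof -
      define x where "x = c1 * y"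
      have x: "x > 0" using c y by (simp add: x_def)
      have a': "a = 4 powr (N * p) * y powr (p / 2) * x powr (- 1)"
        and b': "b = 4 powr (N * q) * y powr (q / 2) * x powr (- 1)"
        using x by (simp_all add: a_def b_def x_def[symmetric] powr_minus_divide)
      have "b powr (p - 1) = 4 powr (N * (q * (p - 1))) * y powr (q * (p - 1) / 2) * x powr (1 - p)"
        unfolding b' powr_mult powr_powr by (simp add: mult.assoc)
      then have b'': "b powr (p - 1) = 4 powr (N * p) * y powr (p / 2) * x powr (1 - p)" by (simp only: qp(2))
      have "a * b powr (p - 1) = (4 powr (N * p) * 4 powr (N * p)) * (y powr (p / 2) * y powr (p / 2)) * (x powr (- 1) * x powr (1 - p))"
        unfolding a' b'' by (simp only: mult_ac)
      also have "\<dots> = 4 powr (2 * (N * p)) * y powr p * x powr (- p)"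
        unfolding powr_add[symmetric] by simp
      also have "\<dots> = C" using c y by (simp add: C_def x_def powr_mult powr_minus)
      finally show ?thesis using ab by (simp flip: ennreal_mult)
    qed
    also have "A * epowr B (p - 1) \<le> ber_norm p q \<gamma> w"
      unfolding ber_norm_def A_def B_def using z by (intro SUP_upper) auto
    finally show ?thesis by (simp add: mult_left_mono)
  qed
  then have "bb_norm p \<gamma> w \<le> ennreal C * ber_norm p q \<gamma> w" if "weight w" for w :: "complex^'n \<Rightarrow> real"
    unfolding bb_norm_def using that by (intro SUP_least) auto
  moreover have "C > 0" using c by (simp add: C_def)
  ultimately show ?thesis by blast
qed

theorem proposition4p1:
  fixes \<gamma> p q :: real
  assumes "\<gamma> > -1" and "1 < p" and "1 / p + 1 / q = 1"
  shows "(\<forall>w :: complex^'n \<Rightarrow> real. weight w \<longrightarrow>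
            (w \<in> bb_class p \<gamma> \<longleftrightarrow> ber_norm p q \<gamma> w < \<infinity>))
       \<and> (\<exists>C::real. C > 0 \<and> (\<forall>w :: complex^'n \<Rightarrow> real. weight w \<longrightarrow>
            ennreal (1 / C) * bb_norm p \<gamma> w \<le> ber_norm p q \<gamma> w
          \<and> ber_norm p q \<gamma> w \<le> ennreal C * epowr (bb_norm p \<gamma> w) (max (p + 1) (q + 1))))"
proof -
  obtain C1 where C1: "C1 > 0" "\<And>w :: complex^'n \<Rightarrow> real. weight w \<Longrightarrow> bb_norm p \<gamma> w \<le> ennreal C1 * ber_norm p q \<gamma> w"
    using bb_norm_upper[OF assms, where 'n='n] by blast
  obtain C2 where C2: "C2 > 0" "\<And>w :: complex^'n \<Rightarrow> real. weight w \<Longrightarrow>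
      ber_norm p q \<gamma> w \<le> ennreal C2 * epowr (bb_norm p \<gamma> w) (max (p + 1) (q + 1))"
    using ber_norm_upper[OF assms, where 'n='n] by blast
  define C where "C = max C1 C2"
  have C: "C > 0" using C1 by (simp add: C_def)
  have lower: "ennreal (1 / C) * bb_norm p \<gamma> w \<le> ber_norm p q \<gamma> w" if "weight w" for w :: "complex^'n \<Rightarrow> real"
  proof -
    have "ennreal (1 / C) * bb_norm p \<gamma> w \<le> ennreal (1 / C) * (ennreal C1 * ber_norm p q \<gamma> w)"
      using C1(2)[OF that] by (rule mult_left_mono) simp
    also have "\<dots> = ennreal (C1 / C) * ber_norm p q \<gamma> w"
      using C C1(1) by (simp flip: mult.assoc ennreal_mult)
    also have "\<dots> \<le> 1 * ber_norm p q \<gamma> w"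
      using C C1(1) by (intro mult_right_mono) (auto simp: C_def)
    finally show ?thesis by simp
  qed
  have upper: "ber_norm p q \<gamma> w \<le> ennreal C * epowr (bb_norm p \<gamma> w) (max (p + 1) (q + 1))"
    if "weight w" for w :: "complex^'n \<Rightarrow> real"
    using C2(2)[OF that] by (rule order_trans) (auto simp: C_def intro!: mult_right_mono ennreal_leI)
  \<comment> \<open>\<open>epowr\<close> is finite exactly where its base is, so the two estimates
    carry finiteness in both directions.\<close>
  have "w \<in> bb_class p \<gamma> \<longleftrightarrow> ber_norm p q \<gamma> w < \<infinity>" if w: "weight w" for w :: "complex^'n \<Rightarrow> real"
  proof
    assume "w \<in> bb_class p \<gamma>"
    then have "epowr (bb_norm p \<gamma> w) (max (p + 1) (q + 1)) < \<infinity>" by (auto simp: bb_class_def epowr_def)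
    then have "ennreal C * epowr (bb_norm p \<gamma> w) (max (p + 1) (q + 1)) < \<infinity>" by (simp add: ennreal_mult_less_top)
    with upper[OF w] show "ber_norm p q \<gamma> w < \<infinity>" by (rule le_less_trans)
  next
    assume "ber_norm p q \<gamma> w < \<infinity>"
    then have "ennreal C1 * ber_norm p q \<gamma> w < \<infinity>" by (simp add: ennreal_mult_less_top)
    with C1(2)[OF w] have "bb_norm p \<gamma> w < \<infinity>" by (rule le_less_trans)
    then show "w \<in> bb_class p \<gamma>" using w by (simp add: bb_class_def)
  qed
  then show ?thesis using lower upper C by blast
qed

end
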